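(* Let $X_1,\ldots,X_n$ be a sequence of martingale differences with values in the set of $d\times d$ self-adjoint (complex) matrices, such that $\|X_i\|\leq U$ almost surely for all $1\leq i\leq n$ and some positive $U\in\mathbb{R}$. Denote $W_n:=\sum_{i=1}^n\mathbb{E}_{i-1}X_i^2$, and let $\sigma>0$. Then for any $t\geq\frac{1}{6}\left(U+\sqrt{U^2+36\sigma^2}\right)$, $$\mathbb{P}\left(\left\|\sum_{i=1}^n X_i\right\|>t,\ \lambda_{\max}(W_n)\leq\sigma^2\right)\leq 50\,\operatorname{tr}\left[p\left(-\frac{t}{U}\,\frac{\mathbb{E}W_n}{\sigma^2}\right)\right]\exp\left(-\frac{t^2/2}{\sigma^2+tU/3}\right).$$
   Context: $\|\cdot\|$ is the operator norm and $\lambda_{\max}$ is the largest eigenvalue of a self-adjoint matrix. $\mathbb{E}_j[\cdot]:=\mathbb{E}[\cdot\mid X_1,\ldots,X_j]$ is the (entrywise) conditional expectation, with $\mathbb{E}_0=\mathbb{E}$; being a martingale difference sequence means $\mathbb{E}_{i-1}X_i=0$ for $i=1,\ldots,n$. The function $p:\mathbb{R}\to\mathbb{R}$ is $p(s):=\min(-s,1)$. For a self-adjoint matrix $A$ with eigenvalue decomposition $A=V\Lambda V^*$ ($V$ unitary, $\Lambda=\operatorname{diag}(\lambda_1,\ldots,\lambda_d)$), a real function $f$ is applied to $A$ by $f(A)=V\operatorname{diag}(f(\lambda_1),\ldots,f(\lambda_d))V^*$. *)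

theory Defs
  imports "HOL-Probability.Probability"
begin

definition adjoint_mat :: "complex^'d^'d \<Rightarrow> complex^'d^'d" where
  "adjoint_mat A = (\<chi> i j. cnj (A $ j $ i))"

definition self_adjoint :: "complex^'d^'d \<Rightarrow> bool" where
  "self_adjoint A \<longleftrightarrow> adjoint_mat A = A"

definition unitary_mat :: "complex^'d^'d \<Rightarrow> bool" where
  "unitary_mat V \<longleftrightarrow> adjoint_mat V ** V = mat 1 \<and> V ** adjoint_mat V = mat 1"

definition diag_real :: "('d \<Rightarrow> real) \<Rightarrow> complex^'d^'d" where
  "diag_real l = (\<chi> i j. if i = j then complex_of_real (l i) else 0)"

text \<open>
  The norm on \<open>complex^'d\<close> is the Euclidean one, so the following is the spectral norm.
  (The \<open>norm\<close> of the type \<open>complex^'d^'d\<close> itself is the Frobenius norm.)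
\<close>

definition op_norm :: "complex^'d^'d \<Rightarrow> real" where
  "op_norm A = onorm ((*v) A)"

text \<open>The largest real eigenvalue; it is only meaningful for self-adjoint \<open>A\<close>.\<close>

definition lambda_max :: "complex^'d^'d \<Rightarrow> real" where
  "lambda_max A = Max {l. \<exists>v. v \<noteq> 0 \<and> A *v v = complex_of_real l *s v}"

text \<open>
  For self-adjoint \<open>A\<close> an eigenvalue decomposition exists, and the value \<open>B\<close> does not
  depend on which one is chosen.
\<close>

definition mat_fun :: "(real \<Rightarrow> real) \<Rightarrow> complex^'d^'d \<Rightarrow> complex^'d^'d" where
  "mat_fun f A = (SOME B. \<exists>V l. unitary_mat V \<and>
      A = V ** diag_real l ** adjoint_mat V \<and>
      B = V ** diag_real (\<lambda>i. f (l i)) ** adjoint_mat V)"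

definition p_trunc :: "real \<Rightarrow> real" where
  "p_trunc s = min (- s) 1"

text \<open>
  The sub-sigma-algebra of \<open>M\<close> generated by \<open>X 1, \<dots>, X j\<close>; it is the trivial one for \<open>j = 0\<close>.
\<close>

definition gen_sigma ::
  "'w measure \<Rightarrow> (nat \<Rightarrow> 'w \<Rightarrow> complex^'d^'d) \<Rightarrow> nat \<Rightarrow> 'w measure" where
  "gen_sigma M X j = sigma (space M) (\<Union>i\<in>{1..j}. {X i -` B \<inter> space M | B. B \<in> sets borel})"

definition cond_exp_mat ::
  "'w measure \<Rightarrow> 'w measure \<Rightarrow> ('w \<Rightarrow> complex^'d^'d) \<Rightarrow> 'w \<Rightarrow> complex^'d^'d" where
  "cond_exp_mat M F Y \<omega> = (\<chi> k l. Complex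
      (real_cond_exp M F (\<lambda>\<omega>'. Re (Y \<omega>' $ k $ l)) \<omega>)
      (real_cond_exp M F (\<lambda>\<omega>'. Im (Y \<omega>' $ k $ l)) \<omega>))"

definition martingale_diff_seq ::
  "'w measure \<Rightarrow> nat \<Rightarrow> (nat \<Rightarrow> 'w \<Rightarrow> complex^'d^'d) \<Rightarrow> bool" where
  "martingale_diff_seq M n X \<longleftrightarrow>
     (\<forall>i\<in>{1..n}. integrable M (X i) \<and>
        (AE \<omega> in M. cond_exp_mat M (gen_sigma M X (i - 1)) (X i) \<omega> = 0))"

definition quad_var ::
  "'w measure \<Rightarrow> (nat \<Rightarrow> 'w \<Rightarrow> complex^'d^'d) \<Rightarrow> nat \<Rightarrow> 'w \<Rightarrow> complex^'d^'d" where
  "quad_var M X n \<omega> =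
     (\<Sum>i=1..n. cond_exp_mat M (gen_sigma M X (i - 1)) (\<lambda>\<omega>'. X i \<omega>' ** X i \<omega>') \<omega>)"

end

theory Submission
  imports Defs "HOL-Real_Asymp.Real_Asymp"
begin

text \<open>
  Write \<open>S\<close> for the sum of the \<open>X i\<close> and \<open>W\<close> for its predictable quadratic variation. If
  \<open>exp (\<theta> x) \<le> 1 + \<theta> x + g x\<^sup>2\<close> for \<open>\<bar>x\<bar> \<le> U\<close>, then Lieb's concavity theorem makes
  \<open>tr exp (\<theta> S - g W)\<close> a supermartingale. Only the tangent inequality of Lieb's theorem is needed: it is
  linear in the matrix that is averaged, so conditional expectations pass through it. It is derived from
  the joint convexity of the relative entropy, which for the kernel \<open>- ln x\<close> follows from the integral of
  the resolvents \<open>1 / (x + s)\<close>.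

  The intrinsic dimension arises by subtracting from \<open>exp (\<theta> S - g W)\<close> its tangent at 0, but only on the span
  of those eigenvectors of \<open>E W\<close> whose eigenvalue \<open>w\<close> satisfies \<open>g w \<le> 1\<close>. The rest is nonnegative, has
  expectation at most \<open>tr min (1, g E W)\<close>, and dominates \<open>exp b - 1 - b\<close> whenever \<open>\<theta> S - g W\<close> has an
  eigenvalue \<open>\<ge> b \<ge> 0\<close>. Markov's inequality with \<open>\<theta> = t / (\<sigma>\<^sup>2 + t U / 3)\<close>, applied to \<open>S\<close> and \<open>- S\<close>,
  concludes.
\<close>


text \<open>In each step the matrix tested against the new \<open>X i\<close> has to be measurable
  with respect to the past. It is the derivative of the logarithm at \<open>exp (g V)\<close>,
  applied to \<open>exp K\<close>, where \<open>V\<close> is the conditional second moment of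
  \<open>X i\<close> and \<open>K\<close> the previous exponent. Its formula in an eigenbasis of
  \<open>V\<close> yields positivity and the trace identities, but an eigenbasis need not depend
  measurably on the outcome. A power series in \<open>exp (g V)\<close>, scaled by one almost sure
  bound on its eigenvalues, gives the same matrix and settles measurability. The tangent is linear
  rather than affine because \<open>tr exp (H + ln Y)\<close> is homogeneous of degree one in
  \<open>Y\<close>.

  Origin of the constant: the lower bound on \<open>t\<close> amounts to
  \<open>t^2 >= \<sigma>^2 + t U / 3\<close>, so the exponent
  \<open>b = \<theta> t - g \<sigma>^2\<close> is at least 1/2 and
  \<open>exp b <= 16 (exp b - 1 - b)\<close>. Replacing \<open>g\<close> by the factor
  \<open>t / (U \<sigma>^2)\<close> of the claim costs 3/2, and the two signs cost 2. The product is
  48, which is below 50.\<close>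

lemma adjoint_mat_nth [simp]: "adjoint_mat A $ i $ j = cnj (A $ j $ i)"
  by (simp add: adjoint_mat_def)

lemma diag_real_nth [simp]: "diag_real l $ i $ j = (if i = j then complex_of_real (l i) else 0)"
  by (simp add: diag_real_def)

lemma mat_mult_nth: "(A ** B) $ i $ j = (\<Sum>k\<in>UNIV. A $ i $ k * B $ k $ j)"
  by (simp add: matrix_matrix_mult_def)

lemma mat_eqI: "(\<And>i j. A $ i $ j = B $ i $ j) \<Longrightarrow> A = B"
  by (simp add: vec_eq_iff)

lemma adjoint_mat_adjoint [simp]: "adjoint_mat (adjoint_mat A) = A"
  by (rule mat_eqI) simp

lemma adjoint_mat_mult: "adjoint_mat (A ** B) = adjoint_mat B ** adjoint_mat A"
  by (rule mat_eqI) (simp add: mat_mult_nth mult.commute)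

lemma adjoint_mat_add: "adjoint_mat (A + B) = adjoint_mat A + adjoint_mat B"
  by (rule mat_eqI) simp

lemma adjoint_mat_diff: "adjoint_mat (A - B) = adjoint_mat A - adjoint_mat B"
  by (rule mat_eqI) simp

lemma adjoint_mat_scaleR: "adjoint_mat (c *\<^sub>R A) = c *\<^sub>R adjoint_mat A"
  by (rule mat_eqI) (simp add: scaleR_complex.ctr complex_eq_iff)

lemma adjoint_mat_diag_real [simp]: "adjoint_mat (diag_real l) = diag_real l"
  by (rule mat_eqI) simp

lemma self_adjoint_add: "self_adjoint A \<Longrightarrow> self_adjoint B \<Longrightarrow> self_adjoint (A + B)"
  by (simp add: self_adjoint_def adjoint_mat_add)

lemma self_adjoint_diff: "self_adjoint A \<Longrightarrow> self_adjoint B \<Longrightarrow> self_adjoint (A - B)"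
  by (simp add: self_adjoint_def adjoint_mat_diff)

lemma self_adjoint_scaleR: "self_adjoint A \<Longrightarrow> self_adjoint (c *\<^sub>R A)"
  by (simp add: self_adjoint_def adjoint_mat_scaleR)

lemma self_adjoint_sum: "(\<And>i. i \<in> I \<Longrightarrow> self_adjoint (A i)) \<Longrightarrow> self_adjoint (\<Sum>i\<in>I. A i)"
proof (induction I rule: infinite_finite_induct)
  case empty
  show ?case by (simp add: self_adjoint_def) (rule mat_eqI, simp)
next
  case (infinite I)
  show ?case by (simp add: infinite self_adjoint_def) (rule mat_eqI, simp)
qed (simp add: self_adjoint_add)

lemma mat_mult_scaleR_left: "(c *\<^sub>R A) ** B = c *\<^sub>R (A ** B :: complex^'n^'m)"
  by (rule mat_eqI) (simp add: mat_mult_nth scaleR_sum_right)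

lemma mat_mult_scaleR_right: "A ** (c *\<^sub>R B) = c *\<^sub>R (A ** B :: complex^'n^'m)"
  by (rule mat_eqI) (simp add: mat_mult_nth scaleR_sum_right)

lemma mat_vec_scaleR: "A *v (c *\<^sub>R v) = c *\<^sub>R (A *v v :: complex^'m)"
  by (simp add: vec_eq_iff matrix_vector_mult_def scaleR_sum_right)

lemma mat_mult_diff_left: "(A - B) ** C = A ** C - (B ** C :: complex^'n^'m)"
  by (rule mat_eqI) (simp add: mat_mult_nth algebra_simps sum_subtractf)

lemma mat_mult_diff_right: "A ** (B - C) = A ** B - (A ** C :: complex^'n^'m)"
  by (rule mat_eqI) (simp add: mat_mult_nth algebra_simps sum_subtractf)

lemma mat_mult_sum_right: "A ** (\<Sum>i\<in>I. B i) = (\<Sum>i\<in>I. A ** B i :: complex^'n^'m)"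
  by (induction I rule: infinite_finite_induct) (simp_all add: matrix_add_ldistrib)

lemma trace_scaleR: "trace (c *\<^sub>R A) = c *\<^sub>R trace (A :: complex^'n^'n)"
  by (simp add: trace_def scaleR_sum_right)

lemma trace_sum: "trace (\<Sum>i\<in>I. A i :: complex^'n^'n) = (\<Sum>i\<in>I. trace (A i))"
  by (induction I rule: infinite_finite_induct) (simp_all add: trace_add, simp_all add: trace_def)

section \<open>The spectral theorem\<close>

text \<open>The overloaded \<open>inner\<close> on this type is the real part of this form, which is
  conjugate-linear in \<open>u\<close>. Unitarity of an eigenvector matrix requires complex
  orthogonality.\<close>

definition hip :: "complex^'n \<Rightarrow> complex^'n \<Rightarrow> complex" where
  "hip u v = (\<Sum>i\<in>UNIV. cnj (u $ i) * v $ i)"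

lemma hip_add_right: "hip u (v + w) = hip u v + hip u w"
  by (simp add: hip_def algebra_simps sum.distrib)

lemma hip_scaleR_right: "hip u (c *\<^sub>R v) = c *\<^sub>R hip u v"
  by (simp add: hip_def scaleR_sum_right)

lemma hip_scale_left: "hip (c *s u) v = cnj c * hip u v"
  by (simp add: hip_def sum_distrib_left algebra_simps)

lemma cnj_hip: "cnj (hip u v) = hip v u"
  by (simp add: hip_def mult.commute)

lemma inner_eq_Re_hip: "inner u v = Re (hip u v)"
  by (simp add: hip_def inner_vec_def inner_complex_def)

lemma hip_self: "hip v v = complex_of_real ((norm v)\<^sup>2)"
proof -
  have "Im (hip v v) = 0"
    using cnj_hip[of v v] by (metis cnj.simps(2) neg_equal_zero)
  moreover have "Re (hip v v) = (norm v)\<^sup>2"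
    by (simp add: inner_eq_Re_hip[symmetric] dot_square_norm)
  ultimately show ?thesis by (simp add: complex_eq_iff)
qed

lemma hip_adjoint: "hip u (A *v v) = hip (adjoint_mat A *v u) v"
proof -
  have "hip u (A *v v) = (\<Sum>i\<in>UNIV. \<Sum>j\<in>UNIV. cnj (u $ i) * (A $ i $ j * v $ j))"
    by (simp add: hip_def matrix_vector_mult_def sum_distrib_left)
  also have "\<dots> = (\<Sum>j\<in>UNIV. \<Sum>i\<in>UNIV. cnj (u $ i) * (A $ i $ j * v $ j))"
    by (rule sum.swap)
  also have "\<dots> = hip (adjoint_mat A *v u) v"
    by (simp add: hip_def matrix_vector_mult_def sum_distrib_right sum_distrib_left algebra_simps)
  finally show ?thesis .
qed

lemma hip_self_adjoint: "self_adjoint A \<Longrightarrow> hip u (A *v v) = hip (A *v u) v"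
  by (simp add: hip_adjoint self_adjoint_def)

lemma continuous_on_mat_vec: "continuous_on S (\<lambda>v. (A :: complex^'n^'m) *v v)"
  unfolding matrix_vector_mult_def
  by (intro continuous_on_vec_lambda continuous_intros)

lemma continuous_on_hip: "continuous_on S (\<lambda>v. hip u v)"
  unfolding hip_def by (intro continuous_intros)

text \<open>The conjugates of the \<open>e i\<close> with \<open>i\<close> in \<open>I\<close> are
  rows of a square matrix whose row \<open>k\<close> vanishes. Its determinant is 0, and any kernel
  vector is orthogonal to all of them.\<close>

lemma exists_orthogonal_vector:
  fixes e :: "'n::finite \<Rightarrow> complex^'n"
  assumes "k \<notin> I"
  shows "\<exists>v. v \<noteq> 0 \<and> (\<forall>i\<in>I. hip (e i) v = 0)"
proof -
  define A :: "complex^'n^'n" where "A = (\<chi> i j. if i \<in> I then cnj (e i $ j) else 0)"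
  have "row k A = 0"
    using assms by (simp add: row_def A_def vec_eq_iff)
  then have "det A = 0" by (rule det_zero_row)
  then have "\<not> invertible A" by (simp add: invertible_det_nz)
  then obtain v where v: "A *v v = 0" "v \<noteq> 0"
    by (metis invertible_left_inverse matrix_left_invertible_ker)
  have "hip (e i) v = (A *v v) $ i" if "i \<in> I" for i
    using that by (simp add: hip_def A_def matrix_vector_mult_def)
  with v show ?thesis by (intro exI[of _ v]) simp
qed

text \<open>The maximiser of the Rayleigh quotient on the orthogonal complement of the eigenvectors
  found so far is a further eigenvector.\<close>

lemma exists_orthogonal_eigenvector:
  fixes A :: "complex^'n^'n" and e :: "'n \<Rightarrow> complex^'n"
  assumes sa: "self_adjoint A" and k: "k \<notin> I"
    and eig: "\<And>i. i \<in> I \<Longrightarrow> A *v e i = complex_of_real (l i) *s e i"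
  shows "\<exists>v c. hip v v = 1 \<and> (\<forall>i\<in>I. hip (e i) v = 0) \<and> A *v v = complex_of_real c *s v"
proof -
  define S where "S = {v. \<forall>i\<in>I. hip (e i) v = 0}"
  define f where "f v = inner v (A *v v)" for v
  have closed: "closed S"
  proof -
    have "S = (\<Inter>i\<in>I. {v. hip (e i) v = 0})" by (auto simp: S_def)
    moreover have "closed {v. hip (e i) v = 0}" for i
      by (intro closed_Collect_eq continuous_on_hip continuous_on_const)
    ultimately show ?thesis by (simp only:) (intro closed_INT ballI)
  qed
  have S_scale: "c *\<^sub>R v \<in> S" if "v \<in> S" for c v
    using that by (simp add: S_def hip_scaleR_right)
  have S_add: "v + w \<in> S" if "v \<in> S" "w \<in> S" for v w
    using that by (simp add: S_def hip_add_right)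
  have S_A: "A *v v \<in> S" if "v \<in> S" for v
    using that eig by (simp add: S_def hip_self_adjoint[OF sa] hip_scale_left)
  have compact: "compact (S \<inter> sphere 0 1)"
    using closed by (simp add: closed_Int_compact)
  obtain v0 where v0: "v0 \<noteq> 0" "v0 \<in> S"
    using exists_orthogonal_vector[OF k, of e] by (auto simp: S_def)
  have "(1 / norm v0) *\<^sub>R v0 \<in> S \<inter> sphere 0 1"
    using v0 S_scale by simp
  then have ne: "S \<inter> sphere 0 1 \<noteq> {}" by blast
  have "continuous_on (S \<inter> sphere 0 1) f"
    unfolding f_def by (intro continuous_intros continuous_on_mat_vec)
  then obtain v where v: "v \<in> S \<inter> sphere 0 1"
      and max: "\<And>w. w \<in> S \<inter> sphere 0 1 \<Longrightarrow> f w \<le> f v"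
    using continuous_attains_sup[OF compact ne] by blast
  have f_scale: "f (c *\<^sub>R w) = c\<^sup>2 * f w" for c w
    by (simp add: f_def mat_vec_scaleR power2_eq_square)
  have le: "f w \<le> f v * (norm w)\<^sup>2" if "w \<in> S" for w
  proof (cases "w = 0")
    case True
    then show ?thesis by (simp add: f_def)
  next
    case False
    then have "(1 / norm w) *\<^sub>R w \<in> S \<inter> sphere 0 1"
      using that S_scale by simp
    from max[OF this] have "(1 / norm w)\<^sup>2 * f w \<le> f v" by (simp only: f_scale)
    with False show ?thesis by (simp add: power_divide field_simps)
  qed
  \<comment> \<open>The residual of the eigenvalue equation is itself an admissible direction in
    \<open>S\<close>. Along \<open>v + t r\<close> the quantity \<open>f - f v * norm^2\<close>,
    which is at most 0 on \<open>S\<close>, has first-order term \<open>2 t (norm r)^2\<close>;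
    hence \<open>r\<close> must vanish.\<close>
  define r where "r = A *v v - f v *\<^sub>R v"
  have rS: "r \<in> S"
    using v S_A S_add[of "A *v v" "(- f v) *\<^sub>R v"] S_scale[of v "- f v"] by (simp add: r_def)
  have sym: "inner a (A *v b) = inner (A *v a) b" for a b
    by (simp add: inner_eq_Re_hip hip_self_adjoint[OF sa])
  define q where "q = f r - f v * (norm r)\<^sup>2"
  have nv: "(norm v)\<^sup>2 = 1" using v by simp
  have ineq: "2 * t * (norm r)\<^sup>2 + t\<^sup>2 * q \<le> 0" for t
  proof -
    have "v + t *\<^sub>R r \<in> S" using v rS S_add S_scale by blast
    from le[OF this] have le_v: "f (v + t *\<^sub>R r) - f v * (norm (v + t *\<^sub>R r))\<^sup>2 \<le> 0" by simp
    have "f (v + t *\<^sub>R r) = f v + 2 * t * inner r (A *v v) + t\<^sup>2 * f r"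
      by (simp add: f_def mat_vec_scaleR inner_add_left inner_add_right
          matrix_vector_right_distrib sym[of v r] inner_commute[of "A *v v" r] power2_eq_square
          algebra_simps)
    moreover have "(norm (v + t *\<^sub>R r))\<^sup>2 = 1 + 2 * t * inner r v + t\<^sup>2 * (norm r)\<^sup>2"
      unfolding nv[symmetric] power2_norm_eq_inner
      by (simp add: inner_add_left inner_add_right inner_commute[of v r] power2_eq_square algebra_simps)
    moreover have "(norm r)\<^sup>2 = inner r (A *v v) - f v * inner r v"
      by (simp add: power2_norm_eq_inner) (simp add: r_def inner_diff_right)
    ultimately have "2 * t * (norm r)\<^sup>2 + t\<^sup>2 * q = f (v + t *\<^sub>R r) - f v * (norm (v + t *\<^sub>R r))\<^sup>2"
      unfolding q_def by algebra
    then show ?thesis using le_v by simp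
  qed
  have "r = 0"
  proof (rule ccontr)
    assume "r \<noteq> 0"
    define c where "c = (norm r)\<^sup>2"
    have c: "c > 0" using \<open>r \<noteq> 0\<close> by (simp add: c_def)
    \<comment> \<open>Small enough for the linear term to win, since
      \<open>t \<bar>q\<bar> \<le> c\<close>. The \<open>+ 1\<close> keeps the quotient meaningful
      for \<open>q = 0\<close>.\<close>
    define t where "t = c / (\<bar>q\<bar> + 1)"
    have t: "t > 0" using c by (simp add: t_def)
    have "t * (2 * c + t * q) \<le> 0"
      using ineq[of t] by (simp add: c_def power2_eq_square algebra_simps)
    then have "2 * c + t * q \<le> 0"
      using t by (simp add: mult_le_0_iff)
    moreover have "- (t * q) \<le> c"
    proof -
      have "- (t * q) \<le> t * \<bar>q\<bar>" using t by (simp add: abs_if)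
      also have "\<dots> \<le> t * (\<bar>q\<bar> + 1)" using t by simp
      also have "\<dots> = c" by (simp add: t_def)
      finally show ?thesis .
    qed
    ultimately show False using c by linarith
  qed
  then have "A *v v = complex_of_real (f v) *s v"
    by (simp add: r_def vec_eq_iff scaleR_conv_of_real[where 'a = complex])
  moreover have "hip v v = 1" using nv by (simp add: hip_self)
  moreover have "\<forall>i\<in>I. hip (e i) v = 0" using v by (simp add: S_def)
  ultimately show ?thesis by blast
qed

text \<open>The induction runs over subsets of the index type of the matrix, so that the completed
  family can serve directly as the columns of a square matrix. An index outside \<open>I\<close> is
  what leaves room for one more orthogonal eigenvector.\<close>

lemma exists_orthonormal_eigenbasis:
  fixes A :: "complex^'n^'n"
  assumes sa: "self_adjoint A"
  shows "\<exists>(e :: 'n \<Rightarrow> complex^'n) l. \<forall>i j. hip (e i) (e j) = (if i = j then 1 else 0) \<and>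
    A *v e i = complex_of_real (l i) *s e i"
proof -
  have "\<exists>e l. (\<forall>i\<in>I. \<forall>j\<in>I. hip (e i) (e j) = (if i = j then 1 else 0)) \<and>
      (\<forall>i\<in>I. A *v e i = complex_of_real (l i) *s e i)" for I :: "'n set"
  proof (induction I rule: finite_induct[OF finite])
    case 1
    show ?case by simp
  next
    case (2 k I)
    then obtain e l where on: "\<And>i j. i \<in> I \<Longrightarrow> j \<in> I \<Longrightarrow> hip (e i) (e j) = (if i = j then 1 else 0)"
        and eig: "\<And>i. i \<in> I \<Longrightarrow> A *v e i = complex_of_real (l i) *s e i"
      by metis
    obtain v c where v: "hip v v = 1" "\<And>i. i \<in> I \<Longrightarrow> hip (e i) v = 0" "A *v v = complex_of_real c *s v"
      using exists_orthogonal_eigenvector[OF sa \<open>k \<notin> I\<close>, of e l] eig by blast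
    have "hip v (e i) = 0" if "i \<in> I" for i
      using v(2)[OF that] cnj_hip[of "e i" v] by simp
    then show ?case
      using 2 on eig v by (intro exI[of _ "e(k := v)"] exI[of _ "l(k := c)"]) auto
  qed
  from this[of UNIV] show ?thesis by (metis UNIV_I)
qed

lemma unitary_matD: "unitary_mat V \<Longrightarrow> adjoint_mat V ** V = mat 1" "unitary_mat V \<Longrightarrow> V ** adjoint_mat V = mat 1"
  by (simp_all add: unitary_mat_def)

lemma unitary_mat_adjoint: "unitary_mat V \<Longrightarrow> unitary_mat (adjoint_mat V)"
  by (simp add: unitary_mat_def)

lemma unitary_mat_mult: "unitary_mat V \<Longrightarrow> unitary_mat W \<Longrightarrow> unitary_mat (V ** W)"
  by (simp add: unitary_mat_def adjoint_mat_mult)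
     (metis matrix_mul_assoc matrix_mul_rid)

definition spec :: "complex^'n^'n \<Rightarrow> ('n \<Rightarrow> real) \<Rightarrow> complex^'n^'n" where
  "spec V l = V ** diag_real l ** adjoint_mat V"

theorem spectral_theorem:
  fixes A :: "complex^'n^'n"
  assumes "self_adjoint A"
  obtains V l where "unitary_mat V" "A = spec V l"
proof -
  obtain e :: "'n \<Rightarrow> complex^'n" and l where
    on: "\<And>i j. hip (e i) (e j) = (if i = j then 1 else 0)"
    and eig: "\<And>i. A *v e i = complex_of_real (l i) *s e i"
    using exists_orthonormal_eigenbasis[OF assms] by blast
  define V :: "complex^'n^'n" where "V = (\<chi> i j. e j $ i)"
  have "adjoint_mat V ** V = mat 1"
    using on by (intro mat_eqI) (simp add: mat_mult_nth V_def hip_def mat_def)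
  then have V: "unitary_mat V"
    by (simp add: unitary_mat_def matrix_left_right_inverse)
  have "A ** V = V ** diag_real l"
  proof (rule mat_eqI)
    fix i j
    have "(A ** V) $ i $ j = (A *v e j) $ i"
      by (simp add: mat_mult_nth matrix_vector_mult_def V_def)
    also have "\<dots> = (V ** diag_real l) $ i $ j"
      by (simp add: eig mat_mult_nth V_def if_distrib[of "\<lambda>x. _ * x"] mult.commute cong: if_cong)
    finally show "(A ** V) $ i $ j = (V ** diag_real l) $ i $ j" .
  qed
  then have "A = spec V l"
    unfolding spec_def by (metis V matrix_mul_assoc matrix_mul_rid unitary_matD(2))
  with V that show thesis by blast
qed


section \<open>Calculus in a fixed eigenbasis and traces of products\<close>

lemma diag_mult_left_nth: "(diag_real l ** A) $ i $ j = complex_of_real (l i) * A $ i $ j"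
proof -
  have "(diag_real l ** A) $ i $ j = (\<Sum>k\<in>UNIV. if k = i then complex_of_real (l i) * A $ i $ j else 0)"
    unfolding mat_mult_nth by (rule sum.cong) auto
  then show ?thesis by simp
qed

lemma diag_mult_right_nth: "(A ** diag_real l) $ i $ j = A $ i $ j * complex_of_real (l j)"
proof -
  have "(A ** diag_real l) $ i $ j = (\<Sum>k\<in>UNIV. if k = j then A $ i $ j * complex_of_real (l j) else 0)"
    unfolding mat_mult_nth by (rule sum.cong) auto
  then show ?thesis by simp
qed

lemma diag_real_mult: "diag_real l ** diag_real k = diag_real (\<lambda>i. l i * k i)"
  by (rule mat_eqI) (simp add: diag_mult_left_nth)

lemma spec_nth: "spec V l $ i $ j = (\<Sum>k\<in>UNIV. V $ i $ k * complex_of_real (l k) * cnj (V $ j $ k))"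
  by (simp add: spec_def mat_mult_nth[of "V ** diag_real l"] diag_mult_right_nth)

lemma spec_add: "spec V l + spec V k = spec V (\<lambda>i. l i + k i)"
  by (rule mat_eqI) (simp add: spec_nth algebra_simps sum.distrib)

lemma spec_diff: "spec V l - spec V k = spec V (\<lambda>i. l i - k i)"
  by (rule mat_eqI) (simp add: spec_nth algebra_simps sum_subtractf)

lemma spec_scaleR: "c *\<^sub>R spec V l = spec V (\<lambda>i. c * l i)"
  by (rule mat_eqI) (simp add: spec_nth scaleR_conv_of_real[where 'a = complex] sum_distrib_left algebra_simps)

lemma spec_one:
  assumes "unitary_mat (V :: complex^'n^'n)"
  shows "spec V (\<lambda>_. 1) = mat 1"
proof -
  have "diag_real (\<lambda>_. 1) = (mat 1 :: complex^'n^'n)"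
    by (rule mat_eqI) (simp add: mat_def)
  then show ?thesis
    using assms by (simp add: spec_def unitary_mat_def)
qed

lemma unitary_cancel:
  assumes "unitary_mat V"
  shows "A ** V ** adjoint_mat V = A" "A ** adjoint_mat V ** V = A"
  by (simp_all add: matrix_mul_assoc[symmetric] unitary_matD[OF assms])

lemma spec_mult: "unitary_mat V \<Longrightarrow> spec V l ** spec V k = spec V (\<lambda>i. l i * k i)"
  unfolding spec_def diag_real_mult[symmetric] by (simp add: matrix_mul_assoc unitary_cancel)

lemma self_adjoint_spec [simp]: "self_adjoint (spec V l)"
  by (simp add: self_adjoint_def spec_def adjoint_mat_mult matrix_mul_assoc)

lemma trace_spec_mult_left:
  "trace (spec V l ** A) = (\<Sum>i\<in>UNIV. complex_of_real (l i) * (adjoint_mat V ** A ** V) $ i $ i)"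
proof -
  have "trace (spec V l ** A) = trace (V ** (diag_real l ** adjoint_mat V ** A))"
    by (simp add: spec_def matrix_mul_assoc)
  also have "\<dots> = trace (diag_real l ** adjoint_mat V ** A ** V)"
    by (rule trace_mul_sym)
  also have "\<dots> = trace (diag_real l ** (adjoint_mat V ** A ** V))"
    by (simp add: matrix_mul_assoc)
  finally show ?thesis by (simp add: trace_def diag_mult_left_nth)
qed

text \<open>For unitary \<open>V\<close> and \<open>W\<close> this array is doubly stochastic. It
  turns the trace of a product of two matrices with different eigenbases into a real double sum over
  their eigenvalues.\<close>

definition overlap :: "complex^'n^'n \<Rightarrow> complex^'n^'n \<Rightarrow> 'n \<Rightarrow> 'n \<Rightarrow> real" where
  "overlap V W i j = (cmod ((adjoint_mat V ** W) $ i $ j))\<^sup>2"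

lemma overlap_nonneg [simp]: "overlap V W i j \<ge> 0"
  by (simp add: overlap_def)

lemma unitary_row_sum:
  assumes "unitary_mat V"
  shows "(\<Sum>j\<in>UNIV. (cmod (V $ i $ j))\<^sup>2) = 1"
proof -
  have "(V ** adjoint_mat V) $ i $ i = 1"
    by (simp add: unitary_matD[OF assms] mat_def)
  then have "complex_of_real (\<Sum>j\<in>UNIV. (cmod (V $ i $ j))\<^sup>2) = 1"
    by (simp add: mat_mult_nth complex_norm_square[symmetric] flip: of_real_power)
  then show ?thesis by (simp only: of_real_eq_1_iff)
qed

lemma sum_overlap_right:
  assumes "unitary_mat V" "unitary_mat W"
  shows "(\<Sum>j\<in>UNIV. overlap V W i j) = 1"
  unfolding overlap_def
  by (rule unitary_row_sum) (intro unitary_mat_mult unitary_mat_adjoint assms)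

lemma overlap_commute: "overlap V W i j = overlap W V j i"
proof -
  have "(adjoint_mat V ** W) $ i $ j = cnj ((adjoint_mat W ** V) $ j $ i)"
    by (simp add: mat_mult_nth mult.commute)
  then show ?thesis by (simp add: overlap_def)
qed

lemma sum_overlap_left:
  assumes "unitary_mat V" "unitary_mat W"
  shows "(\<Sum>i\<in>UNIV. overlap V W i j) = 1"
  by (subst overlap_commute) (rule sum_overlap_right[OF assms(2,1)])

lemma trace_spec_spec:
  "trace (spec V l ** spec W k) = complex_of_real (\<Sum>i\<in>UNIV. \<Sum>j\<in>UNIV. l i * k j * overlap V W i j)"
proof -
  define G where "G = adjoint_mat V ** W"
  have G: "adjoint_mat V ** spec W k ** V = G ** diag_real k ** adjoint_mat G"
    by (simp add: G_def spec_def adjoint_mat_mult matrix_mul_assoc)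
  have "(G ** diag_real k ** adjoint_mat G) $ i $ i = complex_of_real (\<Sum>j\<in>UNIV. k j * overlap V W i j)" for i
    unfolding mat_mult_nth[of "G ** diag_real k"] overlap_def G_def[symmetric]
    by (simp add: diag_mult_right_nth complex_norm_square[unfolded of_real_power] algebra_simps)
  then show ?thesis
    by (simp add: trace_spec_mult_left G sum_distrib_left algebra_simps)
qed

lemma trace_spec:
  assumes "unitary_mat (V :: complex^'n^'n)"
  shows "trace (spec V l) = complex_of_real (\<Sum>i\<in>UNIV. l i)"
proof -
  have "trace (spec V l) = trace (spec V l ** mat 1)" by simp
  also have "\<dots> = (\<Sum>i\<in>UNIV. complex_of_real (l i) * (mat 1 :: complex^'n^'n) $ i $ i)"
    by (subst trace_spec_mult_left) (simp only: matrix_mul_rid unitary_matD[OF assms])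
  finally show ?thesis by (simp add: mat_def)
qed

section \<open>Matrix series\<close>

lemma mat_sumsI:
  fixes c :: "nat \<Rightarrow> complex^'n^'m"
  assumes "\<And>i j. (\<lambda>k. c k $ i $ j) sums C $ i $ j"
  shows "c sums C"
  unfolding sums_def
  by (intro vec_tendstoI) (use assms in \<open>simp add: sums_def\<close>)

lemma mat_mult_add_left: "(A + B) ** C = A ** C + (B ** C :: complex^'n^'m)"
  by (rule mat_eqI) (simp add: mat_mult_nth algebra_simps sum.distrib)

lemma bounded_linear_sandwich: "bounded_linear (\<lambda>A :: complex^'n^'n. V ** A ** (W :: complex^'n^'n))"
  by (intro linear_conv_bounded_linear[THEN iffD1] linearI)
     (simp_all add: matrix_add_ldistrib mat_mult_add_left mat_mult_scaleR_left mat_mult_scaleR_right)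

lemma spec_sums:
  assumes "\<And>i. (\<lambda>k. f k i) sums F i"
  shows "(\<lambda>k. spec V (f k)) sums spec V F"
  unfolding spec_def
proof (rule bounded_linear.sums[OF bounded_linear_sandwich], rule mat_sumsI)
  fix i j
  show "(\<lambda>k. diag_real (f k) $ i $ j) sums diag_real F $ i $ j"
    using assms by (simp add: sums_of_real)
qed

primrec mpow :: "complex^'n^'n \<Rightarrow> nat \<Rightarrow> complex^'n^'n" where
  "mpow A 0 = mat 1"
| "mpow A (Suc k) = A ** mpow A k"

text \<open>A power series rather than \<open>mat_fun exp\<close>: it makes \<open>mexp\<close> of a
  random matrix measurable term by term, whereas a chosen eigendecomposition carries no information
  on measurability.\<close>

definition mexp :: "complex^'n^'n \<Rightarrow> complex^'n^'n" where
  "mexp A = (\<Sum>k. mpow A k /\<^sub>R fact k)"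

lemma mpow_spec: "unitary_mat V \<Longrightarrow> mpow (spec V l) k = spec V (\<lambda>i. l i ^ k)"
  by (induction k) (simp_all add: spec_one spec_mult)

lemma mexp_spec:
  assumes "unitary_mat V"
  shows "mexp (spec V l) = spec V (\<lambda>i. exp (l i))"
proof -
  have "(\<lambda>k. spec V (\<lambda>i. l i ^ k /\<^sub>R fact k)) sums spec V (\<lambda>i. exp (l i))"
    by (intro spec_sums exp_converges)
  then show ?thesis
    by (simp add: mexp_def mpow_spec[OF assms] spec_scaleR sums_iff)
qed

text \<open>The kernel of the Frechet derivative of the matrix logarithm in an eigenbasis.\<close>

definition dln :: "real \<Rightarrow> real \<Rightarrow> real" where
  "dln x y = (if x = y then 1 / x else (ln x - ln y) / (x - y))"

text \<open>The Schur multiplier with symbol \<open>k\<close>, taken in the basis \<open>V\<close>.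
  By the Daleckii-Krein formula the symbol \<open>dln (l a) (l b)\<close> gives the derivative of
  the logarithm at \<open>spec V l\<close>, for positive \<open>l\<close>.\<close>

definition schur :: "complex^'n^'n \<Rightarrow> ('n \<Rightarrow> 'n \<Rightarrow> real) \<Rightarrow> complex^'n^'n \<Rightarrow> complex^'n^'n" where
  "schur V k A = V ** (\<chi> a b. complex_of_real (k a b) * (adjoint_mat V ** A ** V) $ a $ b) ** adjoint_mat V"

text \<open>The power series of the derivative of the logarithm, which is visibly measurable.\<close>

definition dln_series :: "real \<Rightarrow> complex^'n^'n \<Rightarrow> complex^'n^'n \<Rightarrow> complex^'n^'n" where
  "dln_series L A N = (\<Sum>m. (1 / (L * real (Suc m))) *\<^sub>R
     (\<Sum>j\<le>m. mpow (mat 1 - (1 / L) *\<^sub>R A) j ** N ** mpow (mat 1 - (1 / L) *\<^sub>R A) (m - j)))"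

text \<open>With \<open>u = 1 - x / L\<close> and \<open>v = 1 - y / L\<close>, the logarithm is
  \<open>ln L\<close> minus the series of \<open>u ^ (m + 1) / (m + 1)\<close>. The inner sum is the
  difference quotient of the power \<open>m + 1\<close> between \<open>u\<close> and
  \<open>v\<close>, or its derivative if they coincide. The upper bound \<open>L\<close> puts both
  into \<open>[0, 1)\<close>, where the series converge.\<close>

lemma dln_sums:
  fixes x y L :: real
  assumes "0 < x" "x \<le> L" "0 < y" "y \<le> L"
  shows "(\<lambda>m. 1 / (L * real (Suc m)) * (\<Sum>j\<le>m. (1 - x / L) ^ j * (1 - y / L) ^ (m - j))) sums dln x y"
proof -
  define u v where "u = 1 - x / L" and "v = 1 - y / L"
  have L: "L > 0" using assms by linarith
  have uv: "0 \<le> u" "u < 1" "0 \<le> v" "v < 1"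
    using assms L by (simp_all add: u_def v_def)
  have xy: "x = L * (1 - u)" "y = L * (1 - v)"
    using L by (simp_all add: u_def v_def)
  have ln_sums: "(\<lambda>m. z ^ Suc m / real (Suc m)) sums (- ln (1 - z))" if "0 \<le> z" "z < 1" for z :: real
  proof -
    have "(\<lambda>n. - ((- (-z)) ^ n) / real n) sums ln (1 + - z)"
      by (rule ln_series') (use that in simp)
    then have "(\<lambda>n. z ^ n / real n) sums (- ln (1 - z))"
      using sums_minus[of "\<lambda>n. - (z ^ n / real n)"] by simp
    then show ?thesis by (subst sums_Suc_iff) simp
  qed
  show ?thesis
  proof (cases "x = y")
    case True
    have "(\<Sum>j\<le>m. u ^ j * u ^ (m - j)) = real (Suc m) * u ^ m" for m
      by (simp add: power_add[symmetric])
    then have *: "1 / (L * real (Suc m)) * (\<Sum>j\<le>m. u ^ j * u ^ (m - j)) = u ^ m / L" for m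
      by (simp only:) (simp del: of_nat_Suc)
    have "(\<lambda>m. u ^ m / L) sums (1 / (1 - u) / L)"
      by (intro sums_divide geometric_sums) (use uv in simp)
    moreover have "1 / (1 - u) / L = dln x y"
      using True by (simp add: dln_def xy)
    ultimately show ?thesis
      unfolding u_def[symmetric] True[symmetric] by (simp only: * )
  next
    case False
    then have ne: "u \<noteq> v" using xy by auto
    have *: "1 / (L * real (Suc m)) * (\<Sum>j\<le>m. u ^ j * v ^ (m - j)) =
        (u ^ Suc m / real (Suc m) - v ^ Suc m / real (Suc m)) / (L * (u - v))" for m
    proof -
      have "u ^ Suc m - v ^ Suc m = (u - v) * (\<Sum>j\<le>m. u ^ j * v ^ (m - j))"
        by (subst diff_power_eq_sum) (simp add: lessThan_Suc_atMost)
      then show ?thesis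
        using ne by (simp add: diff_divide_distrib[symmetric] del: of_nat_Suc power_Suc)
    qed
    have "(\<lambda>m. (u ^ Suc m / real (Suc m) - v ^ Suc m / real (Suc m)) / (L * (u - v))) sums
       ((- ln (1 - u) - (- ln (1 - v))) / (L * (u - v)))"
      by (intro sums_divide sums_diff ln_sums uv)
    moreover have "(- ln (1 - u) - (- ln (1 - v))) / (L * (u - v)) = dln x y"
    proof -
      have "ln x = ln L + ln (1 - u)" "ln y = ln L + ln (1 - v)"
        using L uv by (simp_all add: xy ln_mult)
      moreover have "x - y = - (L * (u - v))" by (simp add: xy algebra_simps)
      ultimately show ?thesis using False
        by (simp add: dln_def minus_divide_left[symmetric] minus_divide_right[symmetric])
           (metis minus_diff_eq minus_divide_left)
    qed
    ultimately show ?thesis unfolding u_def[symmetric] v_def[symmetric] * by simp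
  qed
qed

lemma spec_sandwich_spec:
  assumes V: "unitary_mat V"
  shows "spec V f ** N ** spec V g = schur V (\<lambda>a b. f a * g b) N"
proof -
  have "(\<chi> a b. complex_of_real (f a * g b) * (adjoint_mat V ** N ** V) $ a $ b) =
      diag_real f ** (adjoint_mat V ** N ** V) ** diag_real g"
    by (rule mat_eqI) (simp add: diag_mult_right_nth diag_mult_left_nth algebra_simps)
  then show ?thesis by (simp add: schur_def spec_def matrix_mul_assoc)
qed

lemma schur_scaleR: "c *\<^sub>R schur V k N = schur V (\<lambda>a b. c * k a b) N"
proof -
  have "(\<chi> a b. complex_of_real (c * k a b) * (adjoint_mat V ** N ** V) $ a $ b) =
      c *\<^sub>R (\<chi> a b. complex_of_real (k a b) * (adjoint_mat V ** N ** V) $ a $ b)"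
    by (rule mat_eqI) (simp add: scaleR_conv_of_real[where 'a = complex])
  then show ?thesis by (simp add: schur_def mat_mult_scaleR_left mat_mult_scaleR_right)
qed

lemma schur_sums:
  assumes "\<And>a b. (\<lambda>m. k m a b) sums K a b"
  shows "(\<lambda>m. schur V (k m) N) sums schur V K N"
  unfolding schur_def
proof (rule bounded_linear.sums[OF bounded_linear_sandwich], rule mat_sumsI)
  fix a b
  show "(\<lambda>m. (\<chi> a b. complex_of_real (k m a b) * (adjoint_mat V ** N ** V) $ a $ b) $ a $ b) sums
    (\<chi> a b. complex_of_real (K a b) * (adjoint_mat V ** N ** V) $ a $ b) $ a $ b"
    using assms by (simp add: sums_of_real sums_mult2)
qed

lemma schur_sum: "(\<Sum>j\<in>J. schur V (k j) N) = schur V (\<lambda>a b. \<Sum>j\<in>J. k j a b) N"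
proof -
  have "(\<chi> a b. complex_of_real (\<Sum>j\<in>J. k j a b) * (adjoint_mat V ** N ** V) $ a $ b) =
      (\<Sum>j\<in>J. \<chi> a b. complex_of_real (k j a b) * (adjoint_mat V ** N ** V) $ a $ b)"
    by (rule mat_eqI) (simp add: sum_distrib_right)
  then show ?thesis
    unfolding schur_def
    by (simp only: linear_sum[OF bounded_linear.linear[OF bounded_linear_sandwich[of V "adjoint_mat V"]]])
qed

text \<open>Every summand of the matrix series is a Schur multiplier of the same \<open>N\<close> in
  the same basis \<open>V\<close>, so convergence and value can be read off entrywise from the
  scalar series.\<close>

lemma dln_series_eq:
  assumes V: "unitary_mat V" and \<mu>: "\<And>i. 0 < \<mu> i" "\<And>i. \<mu> i \<le> L"
  shows "dln_series L (spec V \<mu>) N = schur V (\<lambda>a b. dln (\<mu> a) (\<mu> b)) N"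
proof -
  have D: "mat 1 - (1 / L) *\<^sub>R spec V \<mu> = spec V (\<lambda>i. 1 - \<mu> i / L)"
    by (simp add: spec_one[OF V, symmetric] spec_scaleR spec_diff)
  have "(\<lambda>m. schur V (\<lambda>a b. 1 / (L * real (Suc m)) * (\<Sum>j\<le>m. (1 - \<mu> a / L) ^ j * (1 - \<mu> b / L) ^ (m - j))) N)
      sums schur V (\<lambda>a b. dln (\<mu> a) (\<mu> b)) N"
    by (intro schur_sums dln_sums \<mu>)
  then show ?thesis
    by (simp only: dln_series_def D mpow_spec[OF V] spec_sandwich_spec[OF V] schur_sum schur_scaleR sums_iff)
qed


section \<open>The tangent inequality of Lieb's theorem\<close>

lemma trace_mult: "trace (A ** B) = (\<Sum>a\<in>UNIV. \<Sum>b\<in>UNIV. A $ a $ b * B $ b $ a)"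
  by (simp add: trace_def mat_mult_nth)

lemma Re_of_real_mult: "Re (complex_of_real r * z) = r * Re z"
  by simp

lemma trace_sandwich_mult:
  fixes V :: "complex^'n^'n"
  shows "trace (V ** A ** adjoint_mat V ** B) = trace (A ** (adjoint_mat V ** B ** V))"
proof -
  have "trace (V ** (A ** adjoint_mat V ** B)) = trace (A ** adjoint_mat V ** B ** V)"
    by (rule trace_mul_sym)
  then show ?thesis by (simp add: matrix_mul_assoc)
qed

lemma trace_conj_unitary:
  assumes "unitary_mat V"
  shows "trace (adjoint_mat V ** A ** V) = trace A"
proof -
  have "trace (adjoint_mat V ** A ** V) = trace (V ** (adjoint_mat V ** A))"
    by (rule trace_mul_sym)
  then show ?thesis by (simp add: matrix_mul_assoc unitary_matD[OF assms])
qed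

text \<open>The antiderivative \<open>F\<close> is normalised to vanish at infinity, so the integral
  is \<open>- F 0\<close>. The three integrals that follow are reduced to this one by rescaling and
  regrouping.\<close>

lemma has_integral_dln:
  fixes x y :: real
  assumes xy: "x > 0" "y > 0"
  shows "((\<lambda>s. 1 / ((x + s) * (y + s))) has_integral dln x y) {0..}"
proof -
  define F where "F s = (if x = y then - 1 / (x + s) else (ln (y + s) - ln (x + s)) / (x - y))" for s
  have deriv: "(F has_real_derivative 1 / ((x + s) * (y + s))) (at s)" if "s \<ge> 0" for s
  proof (cases "x = y")
    case True
    have "x + s \<noteq> 0" using that xy by linarith
    then show ?thesis unfolding F_def using True
      by (auto intro!: derivative_eq_intros simp: power2_eq_square)
  next
    case False
    have "((\<lambda>s. (ln (y + s) - ln (x + s)) / (x - y)) has_real_derivative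
        (1 / (y + s) - 1 / (x + s)) / (x - y)) (at s)"
      using that xy False by (auto intro!: derivative_eq_intros)
    moreover have "(1 / (y + s) - 1 / (x + s)) / (x - y) = 1 / ((x + s) * (y + s))"
    proof -
      have "1 / (y + s) - 1 / (x + s) = (x - y) / ((x + s) * (y + s))"
        using that xy by (simp add: field_simps)
      then show ?thesis using False by simp
    qed
    ultimately show ?thesis using False by (simp add: F_def[abs_def])
  qed
  have FTC: "((\<lambda>s. 1 / ((x + s) * (y + s))) has_integral F b - F 0) {0..b}" if "b \<ge> 0" for b
    using that deriv
    by (intro fundamental_theorem_of_calculus)
       (auto simp: has_real_derivative_iff_has_vector_derivative[symmetric] intro: DERIV_subset)
  have lim: "(F \<longlongrightarrow> 0) at_top"
  proof (cases "x = y")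
    case True
    have "((\<lambda>s. - 1 / (x + s)) \<longlongrightarrow> 0) at_top" by real_asymp
    then show ?thesis using True by (simp add: F_def[abs_def])
  next
    case False
    have "((\<lambda>s. ln (y + s) - ln (x + s)) \<longlongrightarrow> 0) at_top" by real_asymp
    from tendsto_divide[OF this tendsto_const, of "x - y"] show ?thesis
      using False by (simp add: F_def[abs_def])
  qed
  have F0: "dln x y = 0 - F 0"
    using xy by (simp add: dln_def F_def) (metis minus_diff_eq minus_divide_left)
  show ?thesis
  proof (rule has_integral_to_inf)
    fix b :: real
    show "(\<lambda>s. 1 / ((x + s) * (y + s))) integrable_on {0..b}"
      using FTC[of b] by (cases "b \<ge> 0") auto
  next
    have "((\<lambda>b. F b - F 0) \<longlongrightarrow> dln x y) at_top"
      unfolding F0 by (intro tendsto_diff lim tendsto_const)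
    moreover have "\<forall>\<^sub>F b in at_top. F b - F 0 = integral {0..b} (\<lambda>s. 1 / ((x + s) * (y + s)))"
      using eventually_ge_at_top[of 0] by eventually_elim (simp add: integral_unique[OF FTC])
    ultimately show "((\<lambda>b. integral {0..b} (\<lambda>s. 1 / ((x + s) * (y + s)))) \<longlongrightarrow> dln x y) at_top"
      by (rule Lim_transform_eventually)
  qed (use xy in auto)
qed

text \<open>The counterterm \<open>1 / (1 + s)\<close> makes the tail integrable. By partial
  fractions the difference is \<open>(1 - a)\<close> times the resolvent product at
  \<open>a = y / m\<close> and 1.\<close>

lemma has_integral_ln_ratio:
  fixes m y :: real
  assumes "m > 0" "y > 0"
  shows "((\<lambda>s. m / (y + s * m) - 1 / (1 + s)) has_integral ln m - ln y) {0..}"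
proof -
  define a where "a = y / m"
  have a: "a > 0" using assms by (simp add: a_def)
  have "(1 - a) * dln a 1 = ln m - ln y"
    using assms a by (cases "a = 1") (auto simp: dln_def a_def ln_div field_simps)
  moreover have "((\<lambda>s. (1 - a) * (1 / ((a + s) * (1 + s)))) has_integral (1 - a) * dln a 1) {0..}"
    by (intro has_integral_mult_right has_integral_dln) (use a in auto)
  moreover have "(1 - a) * (1 / ((a + s) * (1 + s))) = m / (y + s * m) - 1 / (1 + s)" if "s \<in> {0..}" for s
  proof -
    have e: "m / (y + s * m) = 1 / (a + s)"
      using assms by (simp add: a_def field_simps)
    show ?thesis unfolding e using that a by (simp add: field_simps)
  qed
  ultimately show ?thesis by (metis (no_types, lifting) has_integral_eq)
qed

lemma has_integral_resolvent_product:
  fixes x y \<nu> :: real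
  assumes "x > 0" "y > 0" "\<nu> > 0"
  shows "((\<lambda>s. \<nu> / (x + s * \<nu>) * (\<nu> / (y + s * \<nu>))) has_integral \<nu> * dln x y) {0..}"
proof -
  have "1 / (x / \<nu> + s) = \<nu> / (x + s * \<nu>)" if "x > 0" for x s
    using assms by (simp add: field_simps)
  then have *: "1 / ((x / \<nu> + s) * (y / \<nu> + s)) = \<nu> / (x + s * \<nu>) * (\<nu> / (y + s * \<nu>))" for s
    using assms by (metis mult_1 times_divide_times_eq)
  have "dln (x / \<nu>) (y / \<nu>) = \<nu> * dln x y"
    using assms by (simp add: dln_def ln_div diff_divide_distrib[symmetric])
  then show ?thesis
    using has_integral_dln[of "x / \<nu>" "y / \<nu>"] assms unfolding * by simp
qed

text \<open>Write \<open>p = \<nu> / (\<mu> + s \<nu>)\<close> and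
  \<open>q = \<kappa> / (\<mu> + s \<kappa>)\<close>. The integrand regroups as
  \<open>(p - 1 / (1 + s)) + q (1 - s p)\<close> with
  \<open>1 - s p = \<mu> / (\<mu> + s \<nu>)\<close>: a logarithmic ratio plus a multiple of a
  resolvent product.\<close>

lemma has_integral_entropy_kernel:
  fixes \<mu> \<nu> \<kappa> :: real
  assumes pos: "\<mu> > 0" "\<nu> > 0" "\<kappa> > 0"
  shows "((\<lambda>s. \<nu> / (\<mu> + s * \<nu>) + \<kappa> / (\<mu> + s * \<kappa>) - s * (\<nu> / (\<mu> + s * \<nu>) * (\<kappa> / (\<mu> + s * \<kappa>))) - 1 / (1 + s))
    has_integral ln \<nu> + \<kappa> * dln \<nu> \<kappa> - ln \<mu>) {0..}"
proof -
  have dln: "\<mu> * (1 / \<nu>) * dln (\<mu> / \<nu>) (\<mu> / \<kappa>) = \<kappa> * dln \<nu> \<kappa>"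
  proof (cases "\<nu> = \<kappa>")
    case True
    then show ?thesis using pos by (simp add: dln_def)
  next
    case False
    then have ne: "\<mu> / \<nu> \<noteq> \<mu> / \<kappa>" using pos by (simp add: field_simps)
    have "\<mu> / \<nu> - \<mu> / \<kappa> = - (\<mu> * (\<nu> - \<kappa>) / (\<nu> * \<kappa>))" using pos by (simp add: field_simps)
    then show ?thesis using ne False pos
      by (simp add: dln_def ln_div divide_simps) (simp add: algebra_simps)
  qed
  have "((\<lambda>s. (\<nu> / (\<mu> + s * \<nu>) - 1 / (1 + s)) + \<mu> * (1 / \<nu>) * (1 / ((\<mu> / \<nu> + s) * (\<mu> / \<kappa> + s))))
    has_integral (ln \<nu> - ln \<mu>) + \<mu> * (1 / \<nu>) * dln (\<mu> / \<nu>) (\<mu> / \<kappa>)) {0..}"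
    by (intro has_integral_add has_integral_mult_right has_integral_ln_ratio has_integral_dln)
       (use pos in auto)
  moreover have "(\<nu> / (\<mu> + s * \<nu>) - 1 / (1 + s)) + \<mu> * (1 / \<nu>) * (1 / ((\<mu> / \<nu> + s) * (\<mu> / \<kappa> + s)))
    = \<nu> / (\<mu> + s * \<nu>) + \<kappa> / (\<mu> + s * \<kappa>) - s * (\<nu> / (\<mu> + s * \<nu>) * (\<kappa> / (\<mu> + s * \<kappa>))) - 1 / (1 + s)"
    if "s \<in> {0..}" for s
  proof -
    have nz: "\<mu> + s * \<nu> \<noteq> 0" "\<mu> + s * \<kappa> \<noteq> 0"
      using that pos by (simp_all add: add_pos_nonneg less_imp_neq[symmetric])
    have e: "\<mu> / \<nu> + s = (\<mu> + s * \<nu>) / \<nu>" "\<mu> / \<kappa> + s = (\<mu> + s * \<kappa>) / \<kappa>"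
      using pos by (simp_all add: field_simps)
    have "\<mu> * (1 / \<nu>) * (1 / ((\<mu> / \<nu> + s) * (\<mu> / \<kappa> + s))) = \<kappa> / (\<mu> + s * \<kappa>) * (\<mu> / (\<mu> + s * \<nu>))"
      unfolding e using pos by (simp add: mult.commute)
    also have "\<mu> / (\<mu> + s * \<nu>) = 1 - s * (\<nu> / (\<mu> + s * \<nu>))"
      using nz by (simp add: field_simps)
    finally show ?thesis by (simp add: algebra_simps)
  qed
  ultimately have "((\<lambda>s. \<nu> / (\<mu> + s * \<nu>) + \<kappa> / (\<mu> + s * \<kappa>) - s * (\<nu> / (\<mu> + s * \<nu>) * (\<kappa> / (\<mu> + s * \<kappa>))) - 1 / (1 + s))
    has_integral (ln \<nu> - ln \<mu>) + \<mu> * (1 / \<nu>) * dln (\<mu> / \<nu>) (\<mu> / \<kappa>)) {0..}"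
    by (rule has_integral_eq[rotated])
  then show ?thesis unfolding dln by (simp add: algebra_simps)
qed

text \<open>The minimum over \<open>Z\<close> of the quadratic functional \<open>tr Z Z* Y + s tr Z* Z M - 2 Re tr Z* M\<close>.\<close>

lemma quadratic_functional_bound:
  assumes W: "unitary_mat W" and R: "unitary_mat R"
    and y: "\<And>i. y i > 0" and m: "\<And>i. m i > 0" and s: "s \<ge> 0"
  shows "0 \<le> Re (trace (Z ** adjoint_mat Z ** spec W y)) + s * Re (trace (adjoint_mat Z ** Z ** spec R m))
    - 2 * Re (trace (adjoint_mat Z ** spec R m))
    + (\<Sum>a\<in>UNIV. \<Sum>j\<in>UNIV. (m j)\<^sup>2 / (y a + s * m j) * overlap W R a j)"
proof -
  \<comment> \<open>In the eigenbases \<open>W\<close> of \<open>Y\<close> and \<open>R\<close> of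
    \<open>M\<close> all three traces become sums over single entries, so the minimisation decouples
    into scalar problems. The matrix \<open>w\<close> is the identity seen in these two
    bases.\<close>
  define z where "z = adjoint_mat W ** Z ** R"
  define w where "w = adjoint_mat W ** R"
  have 1: "Re (trace (Z ** adjoint_mat Z ** spec W y)) = (\<Sum>a\<in>UNIV. \<Sum>j\<in>UNIV. y a * (cmod (z $ a $ j))\<^sup>2)"
  proof -
    have "adjoint_mat W ** (Z ** adjoint_mat Z) ** W = z ** adjoint_mat z"
      by (simp add: z_def adjoint_mat_mult matrix_mul_assoc unitary_cancel[OF R])
    then have "trace (Z ** adjoint_mat Z ** spec W y) = (\<Sum>a\<in>UNIV. complex_of_real (y a) * (z ** adjoint_mat z) $ a $ a)"
      by (subst trace_mul_sym) (simp add: trace_spec_mult_left)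
    then show ?thesis
      by (simp add: mat_mult_nth complex_norm_square[symmetric] sum_distrib_left flip: of_real_power)
  qed
  have 2: "Re (trace (adjoint_mat Z ** Z ** spec R m)) = (\<Sum>a\<in>UNIV. \<Sum>j\<in>UNIV. m j * (cmod (z $ a $ j))\<^sup>2)"
  proof -
    have "adjoint_mat R ** (adjoint_mat Z ** Z) ** R = adjoint_mat z ** z"
      by (simp add: z_def adjoint_mat_mult matrix_mul_assoc unitary_cancel[OF W])
    then have "trace (adjoint_mat Z ** Z ** spec R m) = (\<Sum>j\<in>UNIV. complex_of_real (m j) * (adjoint_mat z ** z) $ j $ j)"
      by (subst trace_mul_sym) (simp add: trace_spec_mult_left)
    also have "\<dots> = complex_of_real (\<Sum>j\<in>UNIV. \<Sum>a\<in>UNIV. m j * (cmod (z $ a $ j))\<^sup>2)"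
      by (simp add: mat_mult_nth mult.commute[of "cnj _"] complex_norm_square[symmetric] sum_distrib_left)
    finally show ?thesis by (subst sum.swap) simp
  qed
  have 3: "Re (trace (adjoint_mat Z ** spec R m)) = (\<Sum>a\<in>UNIV. \<Sum>j\<in>UNIV. m j * Re (cnj (z $ a $ j) * w $ a $ j))"
  proof -
    have "adjoint_mat R ** adjoint_mat Z ** R = adjoint_mat z ** w"
      by (simp add: z_def w_def adjoint_mat_mult matrix_mul_assoc unitary_cancel[OF W])
    then have "trace (adjoint_mat Z ** spec R m) = (\<Sum>j\<in>UNIV. complex_of_real (m j) * (adjoint_mat z ** w) $ j $ j)"
      by (subst trace_mul_sym) (simp add: trace_spec_mult_left)
    then have "Re (trace (adjoint_mat Z ** spec R m)) = (\<Sum>j\<in>UNIV. \<Sum>a\<in>UNIV. m j * Re (cnj (z $ a $ j) * w $ a $ j))"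
      by (simp add: mat_mult_nth sum_distrib_left)
    then show ?thesis by (subst sum.swap) simp
  qed
  have "0 \<le> y a * (cmod (z $ a $ j))\<^sup>2 + s * (m j * (cmod (z $ a $ j))\<^sup>2)
      - 2 * (m j * Re (cnj (z $ a $ j) * w $ a $ j)) + (m j)\<^sup>2 / (y a + s * m j) * overlap W R a j" for a j
  proof -
    define D where "D = y a + s * m j"
    have D: "D > 0" using y[of a] m[of j] s by (simp add: D_def add_pos_nonneg)
    \<comment> \<open>Here \<open>v\<close> minimises the quadratic function of \<open>u\<close>
      that belongs to this entry, and the summand with \<open>overlap\<close> is minus the minimum.
      The claim for the entry is therefore
      \<open>0 \<le> D * (cmod (u - v))\<^sup>2\<close>.\<close>
    define u v where "u = z $ a $ j" and "v = complex_of_real (m j / D) * w $ a $ j"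
    have "0 \<le> D * (cmod (u - v))\<^sup>2" using D by simp
    also have "(cmod (u - v))\<^sup>2 = (cmod u)\<^sup>2 + (cmod v)\<^sup>2 - 2 * Re (cnj u * v)"
      unfolding cmod_power2 by (simp add: power2_eq_square algebra_simps)
    also have "D * \<dots> = D * (cmod u)\<^sup>2 + D * (cmod v)\<^sup>2 - 2 * (D * Re (cnj u * v))"
      by (simp add: algebra_simps)
    also have "D * Re (cnj u * v) = m j * Re (cnj u * w $ a $ j)"
    proof -
      have "cnj u * v = (m j / D) *\<^sub>R (cnj u * w $ a $ j)"
        by (simp add: v_def scaleR_conv_of_real)
      then show ?thesis using D by simp
    qed
    also have "D * (cmod v)\<^sup>2 = (m j)\<^sup>2 / D * overlap W R a j"
    proof -
      have "(cmod v)\<^sup>2 = (m j / D)\<^sup>2 * overlap W R a j"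
        by (simp add: v_def overlap_def w_def norm_mult power_mult_distrib power2_abs norm_divide power_divide)
      then show ?thesis using D by (simp add: power2_eq_square)
    qed
    finally show ?thesis by (simp add: u_def D_def algebra_simps)
  qed
  then have "0 \<le> (\<Sum>a\<in>UNIV. \<Sum>j\<in>UNIV. y a * (cmod (z $ a $ j))\<^sup>2 + s * (m j * (cmod (z $ a $ j))\<^sup>2)
      - 2 * (m j * Re (cnj (z $ a $ j) * w $ a $ j)) + (m j)\<^sup>2 / (y a + s * m j) * overlap W R a j)"
    by (intro sum_nonneg)
  then show ?thesis
    unfolding 1 2 3 by (simp add: sum.distrib sum_subtractf sum_distrib_left)
qed

text \<open>The right-hand side is linear in \<open>exp C\<close> and is the tangent at \<open>C = B\<close> of the
  concave function \<open>exp C \<mapsto> tr exp (K - B + C)\<close> from Lieb's theorem, for \<open>B = spec V \<beta>\<close>. The proof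
  writes the relative entropy of \<open>M = exp (K - B + C)\<close> and \<open>Y = exp C\<close> as an integral over \<open>s\<close> of maxima
  of quadratic functionals linear in \<open>(M, Y)\<close>, and inserts the maximisers \<open>Z s\<close> that belong
  to the pair \<open>(exp K, exp B)\<close>.\<close>

theorem Lieb_tangent:
  fixes K C V :: "complex^'n^'n"
  assumes K: "self_adjoint K" and C: "self_adjoint C" and V: "unitary_mat V"
  shows "Re (trace (mexp (K - spec V \<beta> + C)))
    \<le> Re (trace (schur V (\<lambda>a b. dln (exp (\<beta> a)) (exp (\<beta> b))) (mexp K) ** mexp C))"
proof -
  obtain P \<kappa> where P: "unitary_mat P" and K_eq: "K = spec P \<kappa>"
    using spectral_theorem[OF K] .
  obtain W c where W: "unitary_mat W" and C_eq: "C = spec W c"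
    using spectral_theorem[OF C] .
  have "self_adjoint (K - spec V \<beta> + C)"
    by (intro self_adjoint_add self_adjoint_diff K C self_adjoint_spec)
  then obtain R h where R: "unitary_mat R" and H_eq: "K - spec V \<beta> + C = spec R h"
    using spectral_theorem by metis
  define \<nu> \<mu> y m where "\<nu> i = exp (\<kappa> i)" and "\<mu> i = exp (\<beta> i)" and "y i = exp (c i)" and "m i = exp (h i)" for i
  have pos: "\<nu> i > 0" "\<mu> i > 0" "y i > 0" "m i > 0" for i
    by (simp_all add: \<nu>_def \<mu>_def y_def m_def)
  have expK: "mexp K = spec P \<nu>" and expC: "mexp C = spec W y"
    by (simp_all add: K_eq C_eq mexp_spec P W \<nu>_def[abs_def] y_def[abs_def])
  have expH: "mexp (K - spec V \<beta> + C) = spec R m"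
    unfolding H_eq by (simp add: mexp_spec R m_def[abs_def])
  define M Y G M' Y' where "M = spec R m" and "Y = spec W y" and "G = adjoint_mat V ** P"
    and "M' = adjoint_mat P ** M ** P" and "Y' = adjoint_mat V ** Y ** V"
  have G: "unitary_mat G" unfolding G_def by (intro unitary_mat_mult unitary_mat_adjoint V P)
  have saM: "self_adjoint M" by (simp add: M_def)
  have trM: "trace M = complex_of_real (\<Sum>i\<in>UNIV. m i)"
    by (simp add: M_def trace_spec R)
  \<comment> \<open>The optimal entry in \<open>quadratic_functional_bound\<close> is
    \<open>m j / (y a + s * m j)\<close> times the entry of the change of basis. Here
    \<open>\<nu>\<close> and \<open>\<mu>\<close> take the roles of \<open>m\<close> and
    \<open>y\<close>, and \<open>G\<close> is the change of basis.\<close>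
  define x where "x s a j = \<nu> j / (\<mu> a + s * \<nu> j)" for s a j
  define \<zeta> :: "real \<Rightarrow> complex^'n^'n" where "\<zeta> s = (\<chi> a j. complex_of_real (x s a j) * G $ a $ j)" for s
  define Z where "Z s = V ** \<zeta> s ** adjoint_mat P" for s
  define c2 where "c2 a b j = Re (G $ a $ j * cnj (G $ b $ j) * Y' $ b $ a)" for a b j
  define c3 where "c3 j k a = Re (cnj (G $ a $ j) * G $ a $ k * M' $ k $ j)" for j k a

  have ZY: "Re (trace (Z s ** adjoint_mat (Z s) ** Y)) = (\<Sum>a\<in>UNIV. \<Sum>b\<in>UNIV. \<Sum>j\<in>UNIV. x s a j * x s b j * c2 a b j)" for s
  proof -
    have "Z s ** adjoint_mat (Z s) = V ** (\<zeta> s ** adjoint_mat (\<zeta> s)) ** adjoint_mat V"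
      by (simp add: Z_def adjoint_mat_mult matrix_mul_assoc unitary_cancel[OF P])
    then have "trace (Z s ** adjoint_mat (Z s) ** Y) = trace (\<zeta> s ** adjoint_mat (\<zeta> s) ** Y')"
      by (simp add: trace_sandwich_mult Y'_def)
    also have "\<dots> = (\<Sum>a\<in>UNIV. \<Sum>b\<in>UNIV. \<Sum>j\<in>UNIV.
        complex_of_real (x s a j * x s b j) * (G $ a $ j * cnj (G $ b $ j) * Y' $ b $ a))"
      by (simp add: trace_mult[of "_ ** _"] mat_mult_nth \<zeta>_def sum_distrib_left sum_distrib_right mult_ac)
    finally show ?thesis
      by (simp only: Re_sum Re_of_real_mult c2_def)
  qed
  have ZM: "Re (trace (adjoint_mat (Z s) ** Z s ** M)) = (\<Sum>j\<in>UNIV. \<Sum>k\<in>UNIV. \<Sum>a\<in>UNIV. x s a j * x s a k * c3 j k a)" for s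
  proof -
    have "adjoint_mat (Z s) ** Z s = P ** (adjoint_mat (\<zeta> s) ** \<zeta> s) ** adjoint_mat P"
      by (simp add: Z_def adjoint_mat_mult matrix_mul_assoc unitary_cancel[OF V])
    then have "trace (adjoint_mat (Z s) ** Z s ** M) = trace (adjoint_mat (\<zeta> s) ** \<zeta> s ** M')"
      by (simp add: trace_sandwich_mult M'_def)
    also have "\<dots> = (\<Sum>j\<in>UNIV. \<Sum>k\<in>UNIV. \<Sum>a\<in>UNIV.
        complex_of_real (x s a j * x s a k) * (cnj (G $ a $ j) * G $ a $ k * M' $ k $ j))"
      by (simp add: trace_mult[of "_ ** _"] mat_mult_nth \<zeta>_def sum_distrib_left sum_distrib_right mult_ac)
    finally show ?thesis
      by (simp only: Re_sum Re_of_real_mult c3_def)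
  qed
  have Z1: "Re (trace (adjoint_mat (Z s) ** M)) = (\<Sum>j\<in>UNIV. \<Sum>k\<in>UNIV. \<Sum>a\<in>UNIV. x s a j * c3 j k a)" for s
  proof -
    have "adjoint_mat (Z s) = P ** (adjoint_mat (\<zeta> s) ** G) ** adjoint_mat P"
      by (simp add: Z_def G_def adjoint_mat_mult matrix_mul_assoc unitary_cancel[OF P])
    then have "trace (adjoint_mat (Z s) ** M) = trace (adjoint_mat (\<zeta> s) ** G ** M')"
      by (simp add: trace_sandwich_mult M'_def)
    also have "\<dots> = (\<Sum>j\<in>UNIV. \<Sum>k\<in>UNIV. \<Sum>a\<in>UNIV.
        complex_of_real (x s a j) * (cnj (G $ a $ j) * G $ a $ k * M' $ k $ j))"
      by (simp add: trace_mult[of "_ ** _"] mat_mult_nth \<zeta>_def sum_distrib_left sum_distrib_right mult_ac)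
    finally show ?thesis
      by (simp only: Re_sum Re_of_real_mult c3_def)
  qed
  \<comment> \<open>Since \<open>M'\<close> is self-adjoint, \<open>2 Re tr Z* M\<close> can be
    split evenly between the weights \<open>x s a j\<close> and \<open>x s a k\<close>. This
    produces the symmetric integrand of \<open>has_integral_entropy_kernel\<close>.\<close>
  have c3_sym: "c3 j k a = c3 k j a" for j k a
  proof -
    have "adjoint_mat M' = M'"
      using saM by (simp add: M'_def adjoint_mat_mult matrix_mul_assoc self_adjoint_def)
    then have "M' $ k $ j = cnj (M' $ j $ k)" by (metis adjoint_mat_nth)
    then have "cnj (G $ a $ j) * G $ a $ k * M' $ k $ j = cnj (cnj (G $ a $ k) * G $ a $ j * M' $ j $ k)"
      by simp
    from arg_cong[OF this, of Re] show ?thesis by (simp only: c3_def cnj.simps)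
  qed
  have Z2: "Re (trace (adjoint_mat (Z s) ** M)) = (\<Sum>j\<in>UNIV. \<Sum>k\<in>UNIV. \<Sum>a\<in>UNIV. x s a k * c3 j k a)" for s
    unfolding Z1 by (subst sum.swap) (simp add: c3_sym)
  have G_delta: "(\<Sum>a\<in>UNIV. cnj (G $ a $ j) * G $ a $ k) = (if j = k then 1 else 0)" for j k
  proof -
    have "(adjoint_mat G ** G) $ j $ k = (if j = k then 1 else 0)"
      by (simp add: unitary_matD[OF G] mat_def)
    then show ?thesis by (simp add: mat_mult_nth)
  qed
  \<comment> \<open>Once the weight is independent of \<open>a\<close>, unitarity of
    \<open>G\<close> removes the off-diagonal pairs, and only diagonal values of the kernel at
    \<open>j = k\<close> survive.\<close>
  have sum_c3: "(\<Sum>a\<in>UNIV. c3 j k a) = (if j = k then Re (M' $ j $ j) else 0)" for j k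
  proof -
    have "(\<Sum>a\<in>UNIV. c3 j k a) = Re ((\<Sum>a\<in>UNIV. cnj (G $ a $ j) * G $ a $ k) * M' $ k $ j)"
      by (simp only: c3_def Re_sum[symmetric] sum_distrib_right)
    then show ?thesis by (simp add: G_delta)
  qed
  have sum_c3_fun: "(\<Sum>j\<in>UNIV. \<Sum>k\<in>UNIV. \<Sum>a\<in>UNIV. f j k * c3 j k a) = (\<Sum>j\<in>UNIV. f j j * Re (M' $ j $ j))" for f
    by (simp add: sum_distrib_left[symmetric] sum_c3 if_distrib[of "\<lambda>x. _ * x"] cong: if_cong)
  have trM': "(\<Sum>j\<in>UNIV. Re (M' $ j $ j)) = (\<Sum>i\<in>UNIV. m i)"
  proof -
    have "trace M' = trace M" unfolding M'_def by (rule trace_conj_unitary[OF P])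
    then have "Re (trace M') = (\<Sum>i\<in>UNIV. m i)" by (simp only: trM Re_complex_of_real)
    then show ?thesis by (simp add: trace_def)
  qed
  have ov: "(\<Sum>a\<in>UNIV. \<Sum>j\<in>UNIV. m j * r * overlap W R a j) = r * (\<Sum>i\<in>UNIV. m i)" for r
  proof -
    have "(\<Sum>j\<in>UNIV. \<Sum>a\<in>UNIV. m j * r * overlap W R a j) = (\<Sum>j\<in>UNIV. m j * r)"
      by (simp add: sum_distrib_left[symmetric] sum_overlap_left[OF W R])
    then show ?thesis by (subst sum.swap) (simp add: sum_distrib_left mult.commute)
  qed

  \<comment> \<open>\<open>I1\<close> collects the term with \<open>Y\<close>, \<open>I2\<close> the
    terms with \<open>M\<close>, and \<open>I3\<close> the minima with opposite sign. The
    counterterm \<open>tr M / (1 + s)\<close> is subtracted in both \<open>I2\<close> and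
    \<open>I3\<close> to make them converge, and it cancels in \<open>- I2 + I3\<close>.\<close>
  define I1 where "I1 = (\<Sum>a\<in>UNIV. \<Sum>b\<in>UNIV. \<Sum>j\<in>UNIV. \<nu> j * dln (\<mu> a) (\<mu> b) * c2 a b j)"
  define I2 where "I2 = (\<Sum>j\<in>UNIV. \<Sum>k\<in>UNIV. \<Sum>a\<in>UNIV. (ln (\<nu> j) + \<nu> k * dln (\<nu> j) (\<nu> k) - ln (\<mu> a)) * c3 j k a)"
  define I3 where "I3 = (\<Sum>a\<in>UNIV. \<Sum>j\<in>UNIV. (ln (m j) - ln (y a)) * (m j * overlap W R a j))"
  have int1: "((\<lambda>s. \<Sum>a\<in>UNIV. \<Sum>b\<in>UNIV. \<Sum>j\<in>UNIV. x s a j * x s b j * c2 a b j) has_integral I1) {0..}"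
    unfolding I1_def x_def
    by (intro has_integral_sum has_integral_mult_left has_integral_resolvent_product finite pos)
  have int2: "((\<lambda>s. \<Sum>j\<in>UNIV. \<Sum>k\<in>UNIV. \<Sum>a\<in>UNIV. (x s a j + x s a k - s * (x s a j * x s a k) - 1 / (1 + s)) * c3 j k a)
      has_integral I2) {0..}"
    unfolding I2_def x_def
    by (intro has_integral_sum has_integral_mult_left has_integral_entropy_kernel finite pos)
  have int3: "((\<lambda>s. \<Sum>a\<in>UNIV. \<Sum>j\<in>UNIV. (m j / (y a + s * m j) - 1 / (1 + s)) * (m j * overlap W R a j))
      has_integral I3) {0..}"
    unfolding I3_def
    by (intro has_integral_sum has_integral_mult_left has_integral_ln_ratio finite pos)
  have "0 \<le> I1 - I2 + I3"
  proof (rule has_integral_nonneg[OF has_integral_add[OF has_integral_diff[OF int1 int2] int3]])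
    fix s :: real assume "s \<in> {0..}"
    then have s: "s \<ge> 0" by simp
    have "0 \<le> Re (trace (Z s ** adjoint_mat (Z s) ** Y)) + s * Re (trace (adjoint_mat (Z s) ** Z s ** M))
      - 2 * Re (trace (adjoint_mat (Z s) ** M))
      + (\<Sum>a\<in>UNIV. \<Sum>j\<in>UNIV. (m j)\<^sup>2 / (y a + s * m j) * overlap W R a j)"
      unfolding Y_def M_def by (intro quadratic_functional_bound W R pos s)
    also have "2 * Re (trace (adjoint_mat (Z s) ** M)) =
       (\<Sum>j\<in>UNIV. \<Sum>k\<in>UNIV. \<Sum>a\<in>UNIV. x s a j * c3 j k a) + (\<Sum>j\<in>UNIV. \<Sum>k\<in>UNIV. \<Sum>a\<in>UNIV. x s a k * c3 j k a)"
      using Z1[of s] Z2[of s] by simp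
    also have "Re (trace (Z s ** adjoint_mat (Z s) ** Y)) + s * Re (trace (adjoint_mat (Z s) ** Z s ** M)) -
        ((\<Sum>j\<in>UNIV. \<Sum>k\<in>UNIV. \<Sum>a\<in>UNIV. x s a j * c3 j k a) + (\<Sum>j\<in>UNIV. \<Sum>k\<in>UNIV. \<Sum>a\<in>UNIV. x s a k * c3 j k a)) +
        (\<Sum>a\<in>UNIV. \<Sum>j\<in>UNIV. (m j)\<^sup>2 / (y a + s * m j) * overlap W R a j) =
      (\<Sum>a\<in>UNIV. \<Sum>b\<in>UNIV. \<Sum>j\<in>UNIV. x s a j * x s b j * c2 a b j) -
      (\<Sum>j\<in>UNIV. \<Sum>k\<in>UNIV. \<Sum>a\<in>UNIV. (x s a j + x s a k - s * (x s a j * x s a k) - 1 / (1 + s)) * c3 j k a) +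
      (\<Sum>a\<in>UNIV. \<Sum>j\<in>UNIV. (m j / (y a + s * m j) - 1 / (1 + s)) * (m j * overlap W R a j))"
    proof -
      have A: "(\<Sum>j\<in>UNIV. \<Sum>k\<in>UNIV. \<Sum>a\<in>UNIV. (x s a j + x s a k - s * (x s a j * x s a k) - 1 / (1 + s)) * c3 j k a) =
          (\<Sum>j\<in>UNIV. \<Sum>k\<in>UNIV. \<Sum>a\<in>UNIV. x s a j * c3 j k a) + (\<Sum>j\<in>UNIV. \<Sum>k\<in>UNIV. \<Sum>a\<in>UNIV. x s a k * c3 j k a)
          - s * Re (trace (adjoint_mat (Z s) ** Z s ** M)) - 1 / (1 + s) * (\<Sum>i\<in>UNIV. m i)"
        unfolding ZM trM'[symmetric] sum_distrib_left sum_c3_fun[of "\<lambda>_ _. 1 / (1 + s)", symmetric]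
          sum.distrib[symmetric] sum_subtractf[symmetric]
        by (intro sum.cong refl) (simp add: ring_distribs mult.assoc)
      have B: "(\<Sum>a\<in>UNIV. \<Sum>j\<in>UNIV. (m j / (y a + s * m j) - 1 / (1 + s)) * (m j * overlap W R a j)) =
          (\<Sum>a\<in>UNIV. \<Sum>j\<in>UNIV. (m j)\<^sup>2 / (y a + s * m j) * overlap W R a j) - 1 / (1 + s) * (\<Sum>i\<in>UNIV. m i)"
        unfolding ov[of "1 / (1 + s)", symmetric] sum_subtractf[symmetric]
        by (intro sum.cong refl) (simp add: left_diff_distrib power2_eq_square)
      show ?thesis unfolding A B ZY by simp
    qed
    finally show "0 \<le> (\<Sum>a\<in>UNIV. \<Sum>b\<in>UNIV. \<Sum>j\<in>UNIV. x s a j * x s b j * c2 a b j) -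
      (\<Sum>j\<in>UNIV. \<Sum>k\<in>UNIV. \<Sum>a\<in>UNIV. (x s a j + x s a k - s * (x s a j * x s a k) - 1 / (1 + s)) * c3 j k a) +
      (\<Sum>a\<in>UNIV. \<Sum>j\<in>UNIV. (m j / (y a + s * m j) - 1 / (1 + s)) * (m j * overlap W R a j))" .
  qed
  moreover have "I1 = Re (trace (schur V (\<lambda>a b. dln (\<mu> a) (\<mu> b)) (mexp K) ** Y))"
  proof -
    have "adjoint_mat V ** mexp K ** V = G ** diag_real \<nu> ** adjoint_mat G"
      by (simp add: expK spec_def G_def adjoint_mat_mult matrix_mul_assoc)
    then have N_nth: "(adjoint_mat V ** mexp K ** V) $ a $ b = (\<Sum>j\<in>UNIV. complex_of_real (\<nu> j) * (G $ a $ j * cnj (G $ b $ j)))" for a b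
      by (simp add: mat_mult_nth[of "G ** diag_real \<nu>"] diag_mult_right_nth algebra_simps)
    have "trace (schur V (\<lambda>a b. dln (\<mu> a) (\<mu> b)) (mexp K) ** Y) =
        trace ((\<chi> a b. complex_of_real (dln (\<mu> a) (\<mu> b)) * (adjoint_mat V ** mexp K ** V) $ a $ b) ** Y')"
      by (simp only: schur_def trace_sandwich_mult Y'_def)
    also have "\<dots> = (\<Sum>a\<in>UNIV. \<Sum>b\<in>UNIV. \<Sum>j\<in>UNIV.
        complex_of_real (\<nu> j * dln (\<mu> a) (\<mu> b)) * (G $ a $ j * cnj (G $ b $ j) * Y' $ b $ a))"
      by (simp add: trace_mult[of _ Y'] N_nth sum_distrib_left sum_distrib_right mult_ac)
    finally show ?thesis
      by (simp only: Re_sum Re_of_real_mult I1_def c2_def)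
  qed
  \<comment> \<open>The diagonal value \<open>\<nu> j * dln (\<nu> j) (\<nu> j) = 1\<close> is the
    source of the isolated \<open>tr M\<close>, which becomes the left-hand side of the
    claim.\<close>
  moreover have "I2 = Re (trace (K ** M)) + (\<Sum>i\<in>UNIV. m i) - Re (trace (spec V \<beta> ** M))"
  proof -
    have KM: "Re (trace (K ** M)) = (\<Sum>j\<in>UNIV. \<kappa> j * Re (M' $ j $ j))"
      by (simp add: K_eq trace_spec_mult_left M'_def)
    have "adjoint_mat P ** spec V \<beta> ** P = adjoint_mat G ** diag_real \<beta> ** G"
      by (simp add: spec_def G_def adjoint_mat_mult matrix_mul_assoc)
    then have "spec V \<beta> = P ** (adjoint_mat G ** diag_real \<beta> ** G) ** adjoint_mat P"
      by (metis P matrix_mul_assoc matrix_mul_lid matrix_mul_rid unitary_matD(2))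
    then have "trace (spec V \<beta> ** M) = trace (adjoint_mat G ** diag_real \<beta> ** G ** M')"
      by (simp add: trace_sandwich_mult M'_def)
    also have "\<dots> = (\<Sum>j\<in>UNIV. \<Sum>k\<in>UNIV. \<Sum>a\<in>UNIV.
        complex_of_real (\<beta> a) * (cnj (G $ a $ j) * G $ a $ k * M' $ k $ j))"
      by (simp add: trace_mult[of _ M'] mat_mult_nth[of "adjoint_mat G ** diag_real \<beta>"] diag_mult_right_nth
          sum_distrib_left sum_distrib_right mult_ac)
    finally have VM: "Re (trace (spec V \<beta> ** M)) = (\<Sum>j\<in>UNIV. \<Sum>k\<in>UNIV. \<Sum>a\<in>UNIV. \<beta> a * c3 j k a)"
      by (simp only: Re_sum Re_of_real_mult c3_def)
    have "I2 = (\<Sum>j\<in>UNIV. \<Sum>k\<in>UNIV. \<Sum>a\<in>UNIV. (\<kappa> j + \<nu> k * dln (\<nu> j) (\<nu> k)) * c3 j k a)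
        - (\<Sum>j\<in>UNIV. \<Sum>k\<in>UNIV. \<Sum>a\<in>UNIV. \<beta> a * c3 j k a)"
      unfolding I2_def sum_subtractf[symmetric] left_diff_distrib[symmetric] by (simp add: \<nu>_def \<mu>_def)
    also have "(\<Sum>j\<in>UNIV. \<Sum>k\<in>UNIV. \<Sum>a\<in>UNIV. (\<kappa> j + \<nu> k * dln (\<nu> j) (\<nu> k)) * c3 j k a) =
        (\<Sum>j\<in>UNIV. (\<kappa> j + 1) * Re (M' $ j $ j))"
      using pos(1) by (simp add: sum_c3_fun dln_def less_imp_neq[symmetric])
    finally show ?thesis
      by (simp add: KM VM trM'[symmetric] algebra_simps sum.distrib)
  qed
  \<comment> \<open>This is the relative entropy \<open>tr M (ln M - ln Y)\<close> with
    \<open>ln M = K - B + C\<close> and \<open>ln Y = C\<close>. In \<open>I2 - I3\<close> all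
    logarithms cancel, and \<open>I1 - I2 + I3 \<ge> 0\<close> reduces to
    \<open>tr M \<le> I1\<close>.\<close>
  moreover have "I3 = Re (trace (spec R h ** M)) - Re (trace (C ** M))"
  proof -
    have "Re (trace (spec R h ** M)) = (\<Sum>i\<in>UNIV. h i * m i)"
      by (simp add: M_def spec_mult[OF R] trace_spec[OF R])
    moreover have "(\<Sum>a\<in>UNIV. \<Sum>j\<in>UNIV. h j * (m j * overlap W R a j)) = (\<Sum>i\<in>UNIV. h i * m i)"
      by (subst sum.swap) (simp add: sum_distrib_left[symmetric] sum_overlap_left[OF W R])
    moreover have "Re (trace (C ** M)) = (\<Sum>a\<in>UNIV. \<Sum>j\<in>UNIV. c a * (m j * overlap W R a j))"
      by (simp add: C_eq M_def trace_spec_spec mult.assoc)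
    ultimately show ?thesis
      by (simp add: I3_def m_def y_def left_diff_distrib sum_subtractf)
  qed
  moreover have "trace (spec R h ** M) = trace (K ** M) - trace (spec V \<beta> ** M) + trace (C ** M)"
    by (simp add: H_eq[symmetric] mat_mult_add_left mat_mult_diff_left trace_add trace_sub)
  ultimately have "(\<Sum>i\<in>UNIV. m i) \<le> Re (trace (schur V (\<lambda>a b. dln (\<mu> a) (\<mu> b)) (mexp K) ** Y))"
    by simp
  then show ?thesis
    by (simp add: expH expC M_def[symmetric] trM Y_def \<mu>_def)
qed


section \<open>Positivity of the derivative of the logarithm\<close>

lemma trace_spec_congruence_nonneg:
  assumes "\<And>i. \<nu> i \<ge> 0" "\<And>i. w i \<ge> 0"
  shows "Re (trace (A ** spec P \<nu> ** adjoint_mat A ** spec W w)) \<ge> 0"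
proof -
  define T where "T = adjoint_mat W ** A ** P"
  have "adjoint_mat W ** (A ** spec P \<nu> ** adjoint_mat A) ** W = T ** diag_real \<nu> ** adjoint_mat T"
    by (simp add: T_def spec_def adjoint_mat_mult matrix_mul_assoc)
  then have "trace (A ** spec P \<nu> ** adjoint_mat A ** spec W w) =
      (\<Sum>i\<in>UNIV. complex_of_real (w i) * (T ** diag_real \<nu> ** adjoint_mat T) $ i $ i)"
    by (subst trace_mul_sym) (simp add: trace_spec_mult_left)
  moreover have "(T ** diag_real \<nu> ** adjoint_mat T) $ i $ i = complex_of_real (\<Sum>j\<in>UNIV. \<nu> j * (cmod (T $ i $ j))\<^sup>2)" for i
    by (simp add: mat_mult_nth[of "T ** diag_real \<nu>"] diag_mult_right_nth complex_norm_square[unfolded of_real_power] mult_ac)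
  ultimately have "trace (A ** spec P \<nu> ** adjoint_mat A ** spec W w) =
      complex_of_real (\<Sum>i\<in>UNIV. w i * (\<Sum>j\<in>UNIV. \<nu> j * (cmod (T $ i $ j))\<^sup>2))"
    by simp
  then show ?thesis
    using assms by (simp add: sum_nonneg del: of_real_sum)
qed

lemma spec_psd_diag_nonneg:
  assumes "\<And>i. \<nu> i \<ge> 0"
  shows "Re ((adjoint_mat V ** spec P \<nu> ** V) $ a $ a) \<ge> 0"
proof -
  define T where "T = adjoint_mat V ** P"
  have "adjoint_mat V ** spec P \<nu> ** V = T ** diag_real \<nu> ** adjoint_mat T"
    by (simp add: T_def spec_def adjoint_mat_mult matrix_mul_assoc)
  moreover have "(T ** diag_real \<nu> ** adjoint_mat T) $ a $ a = complex_of_real (\<Sum>j\<in>UNIV. \<nu> j * (cmod (T $ a $ j))\<^sup>2)"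
    by (simp add: mat_mult_nth[of "T ** diag_real \<nu>"] diag_mult_right_nth complex_norm_square[unfolded of_real_power] mult_ac)
  ultimately show ?thesis
    using assms by (simp add: sum_nonneg del: of_real_sum)
qed

lemma trace_schur_mult:
  assumes V: "unitary_mat V"
  shows "Re (trace (schur V k N ** Y)) = (\<Sum>a\<in>UNIV. \<Sum>b\<in>UNIV.
    k a b * Re ((adjoint_mat V ** N ** V) $ a $ b * (adjoint_mat V ** Y ** V) $ b $ a))"
proof -
  have "trace (schur V k N ** Y) = (\<Sum>a\<in>UNIV. \<Sum>b\<in>UNIV. complex_of_real (k a b) *
      ((adjoint_mat V ** N ** V) $ a $ b * (adjoint_mat V ** Y ** V) $ b $ a))"
    by (simp add: schur_def trace_sandwich_mult trace_mult[of _ "adjoint_mat V ** Y ** V"] mult.assoc)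
  then show ?thesis by (simp only: Re_sum Re_of_real_mult)
qed

text \<open>A test matrix that is diagonal in the basis of the multiplier sees only the diagonal of
  the symbol. For \<open>dln\<close> these values are the reciprocals
  \<open>1 / \<mu> a\<close>.\<close>

lemma trace_schur_spec:
  assumes V: "unitary_mat V"
  shows "Re (trace (schur V k N ** spec V f)) = (\<Sum>a\<in>UNIV. k a a * f a * Re ((adjoint_mat V ** N ** V) $ a $ a))"
proof -
  have "adjoint_mat V ** spec V f ** V = diag_real f"
    by (simp add: spec_def matrix_mul_assoc unitary_matD[OF V] unitary_cancel[OF V])
  then have "Re (trace (schur V k N ** spec V f)) = (\<Sum>a\<in>UNIV. \<Sum>b\<in>UNIV.
      if b = a then k a a * f a * Re ((adjoint_mat V ** N ** V) $ a $ a) else 0)"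
    unfolding trace_schur_mult[OF V] by (intro sum.cong refl) (auto simp: mult_ac)
  then show ?thesis by simp
qed

text \<open>The logarithm is operator monotone: its derivative at a positive matrix is the integral
  over \<open>s\<close> of the congruences by the resolvent \<open>1 / (\<mu> + s)\<close>, and each
  of them preserves positive semidefiniteness.\<close>

lemma trace_schur_dln_nonneg:
  assumes V: "unitary_mat V" and "\<And>i. \<mu> i > 0" "\<And>i. \<nu> i \<ge> 0" "\<And>i. w i \<ge> 0"
  shows "Re (trace (schur V (\<lambda>a b. dln (\<mu> a) (\<mu> b)) (spec P \<nu>) ** spec W w)) \<ge> 0"
proof (rule has_integral_nonneg)
  let ?N = "adjoint_mat V ** spec P \<nu> ** V" and ?Y = "adjoint_mat V ** spec W w ** V"
  show "((\<lambda>s. \<Sum>a\<in>UNIV. \<Sum>b\<in>UNIV. 1 / ((\<mu> a + s) * (\<mu> b + s)) * Re (?N $ a $ b * ?Y $ b $ a))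
      has_integral Re (trace (schur V (\<lambda>a b. dln (\<mu> a) (\<mu> b)) (spec P \<nu>) ** spec W w))) {0..}"
    unfolding trace_schur_mult[OF V]
    by (intro has_integral_sum has_integral_mult_left has_integral_dln finite assms)
  fix s :: real
  let ?d = "\<lambda>a. 1 / (\<mu> a + s)"
  have "(\<Sum>a\<in>UNIV. \<Sum>b\<in>UNIV. 1 / ((\<mu> a + s) * (\<mu> b + s)) * Re (?N $ a $ b * ?Y $ b $ a)) =
      Re (trace (schur V (\<lambda>a b. ?d a * ?d b) (spec P \<nu>) ** spec W w))"
    unfolding trace_schur_mult[OF V] by simp
  also have "schur V (\<lambda>a b. ?d a * ?d b) (spec P \<nu>) = spec V ?d ** spec P \<nu> ** adjoint_mat (spec V ?d)"
    using self_adjoint_spec[of V ?d] by (simp add: spec_sandwich_spec[OF V] self_adjoint_def)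
  finally show "0 \<le> (\<Sum>a\<in>UNIV. \<Sum>b\<in>UNIV. 1 / ((\<mu> a + s) * (\<mu> b + s)) * Re (?N $ a $ b * ?Y $ b $ a))"
    using trace_spec_congruence_nonneg[OF assms(3,4)] by simp
qed

section \<open>Bounds on entries and eigenvalues\<close>

text \<open>The entrywise l1 norm. It is submultiplicative, and it dominates the Frobenius norm as
  well as, for self-adjoint matrices, every eigenvalue. The dimension factors it causes affect only
  integrability, never the final constant.\<close>

definition entry_sum :: "complex^'n^'m \<Rightarrow> real" where
  "entry_sum A = (\<Sum>i\<in>UNIV. \<Sum>j\<in>UNIV. cmod (A $ i $ j))"

lemma entry_sum_nonneg [simp]: "entry_sum A \<ge> 0"
  by (simp add: entry_sum_def sum_nonneg)

lemma entry_le_entry_sum: "cmod (A $ i $ j) \<le> entry_sum A"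
proof -
  have "cmod (A $ i $ j) \<le> (\<Sum>j\<in>UNIV. cmod (A $ i $ j))"
    by (rule member_le_sum) auto
  also have "\<dots> \<le> entry_sum A"
    unfolding entry_sum_def by (rule member_le_sum) (auto intro: sum_nonneg)
  finally show ?thesis .
qed

lemma entry_sum_le: "(\<And>i j. cmod (A $ i $ j) \<le> c) \<Longrightarrow> entry_sum (A :: complex^'n^'m) \<le> real CARD('m) * (real CARD('n) * c)"
  unfolding entry_sum_def by (intro sum_bounded_above)

lemma entry_sum_add: "entry_sum (A + B) \<le> entry_sum A + entry_sum B"
  unfolding entry_sum_def sum.distrib[symmetric] by (intro sum_mono) (simp add: norm_triangle_ineq)

lemma entry_sum_scaleR: "entry_sum (c *\<^sub>R A) = \<bar>c\<bar> * entry_sum A"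
  by (simp add: entry_sum_def sum_distrib_left)

lemma unitary_entry_le_1:
  assumes "unitary_mat V"
  shows "cmod (V $ i $ j) \<le> 1"
proof -
  have "(cmod (V $ i $ j))\<^sup>2 \<le> (\<Sum>j\<in>UNIV. (cmod (V $ i $ j))\<^sup>2)"
    by (rule member_le_sum) auto
  then show ?thesis
    using unitary_row_sum[OF assms] by (simp add: abs_square_le_1)
qed

lemma unitary_sandwich_entry_le:
  assumes V: "unitary_mat V" and W: "unitary_mat W"
  shows "cmod ((V ** A ** W) $ i $ j) \<le> entry_sum A"
proof -
  have "(V ** A ** W) $ i $ j = (\<Sum>l\<in>UNIV. \<Sum>k\<in>UNIV. V $ i $ k * A $ k $ l * W $ l $ j)"
    by (simp add: mat_mult_nth sum_distrib_right)
  also have "cmod \<dots> \<le> (\<Sum>l\<in>UNIV. \<Sum>k\<in>UNIV. cmod (V $ i $ k * A $ k $ l * W $ l $ j))"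
    by (intro order_trans[OF norm_sum] sum_mono order_refl)
  also have "\<dots> \<le> (\<Sum>l\<in>UNIV. \<Sum>k\<in>UNIV. cmod (A $ k $ l))"
  proof (intro sum_mono)
    fix k l
    have "cmod (V $ i $ k) * cmod (A $ k $ l) * cmod (W $ l $ j) \<le> 1 * cmod (A $ k $ l) * 1"
      by (intro mult_mono unitary_entry_le_1 V W) auto
    then show "cmod (V $ i $ k * A $ k $ l * W $ l $ j) \<le> cmod (A $ k $ l)"
      by (simp add: norm_mult)
  qed
  also have "\<dots> = entry_sum A" unfolding entry_sum_def by (rule sum.swap)
  finally show ?thesis .
qed

lemma unitary_unconj_spec: "unitary_mat V \<Longrightarrow> adjoint_mat V ** spec V l ** V = diag_real l"
  by (simp add: spec_def matrix_mul_assoc unitary_matD unitary_cancel)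

lemma eigenvalue_le_entry_sum:
  assumes V: "unitary_mat V"
  shows "\<bar>l i\<bar> \<le> entry_sum (spec V l)"
proof -
  have "cmod (diag_real l $ i $ i) \<le> entry_sum (spec V l)"
    unfolding unitary_unconj_spec[OF V, symmetric]
    by (intro unitary_sandwich_entry_le V unitary_mat_adjoint)
  then show ?thesis by simp
qed

lemma entry_spec_le:
  assumes V: "unitary_mat V"
  shows "cmod (spec V l $ i $ j) \<le> (\<Sum>i\<in>UNIV. \<bar>l i\<bar>)"
proof -
  have "cmod (spec V l $ i $ j) \<le> entry_sum (diag_real l)"
    unfolding spec_def by (intro unitary_sandwich_entry_le V unitary_mat_adjoint)
  also have "\<dots> = (\<Sum>i\<in>UNIV. \<bar>l i\<bar>)"
    by (simp add: entry_sum_def if_distrib[of cmod] cong: if_cong)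
  finally show ?thesis .
qed

lemma entry_mexp_le:
  fixes A :: "complex^'n^'n"
  assumes "self_adjoint A"
  shows "cmod (mexp A $ i $ j) \<le> CARD('n) * exp (entry_sum A)"
proof -
  obtain V l where V: "unitary_mat V" and A: "A = spec V l"
    using spectral_theorem[OF assms] .
  have "cmod (mexp A $ i $ j) \<le> (\<Sum>i\<in>UNIV. \<bar>exp (l i)\<bar>)"
    unfolding A mexp_spec[OF V] by (rule entry_spec_le[OF V])
  also have "\<dots> \<le> (\<Sum>i\<in>(UNIV :: 'n set). exp (entry_sum A))"
    using eigenvalue_le_entry_sum[OF V, of l] abs_le_D1 unfolding A by (intro sum_mono) auto
  finally show ?thesis by simp
qed

lemma bounded_linear_mat_vec: "bounded_linear (\<lambda>v. (A :: complex^'n^'m) *v v)"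
  by (intro linear_conv_bounded_linear[THEN iffD1] linearI)
     (simp_all add: matrix_vector_right_distrib mat_vec_scaleR)

lemma norm_mat_vec_le: "norm (A *v v) \<le> op_norm A * norm v"
  unfolding op_norm_def by (rule onorm[OF bounded_linear_mat_vec])

lemma entry_le_op_norm:
  fixes A :: "complex^'n^'n"
  shows "cmod (A $ i $ j) \<le> op_norm A"
proof -
  have "(A *v axis j 1) $ i = A $ i $ j"
    by (simp add: matrix_vector_mult_def axis_def if_distrib[of "\<lambda>x. _ * x"] cong: if_cong)
  then have "cmod (A $ i $ j) \<le> norm (A *v axis j 1)"
    by (metis Finite_Cartesian_Product.norm_nth_le)
  also have "\<dots> \<le> op_norm A"
    using norm_mat_vec_le[of A "axis j 1"] by (simp add: norm_axis_1)
  finally show ?thesis .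
qed

lemma spec_mult_column:
  assumes V: "unitary_mat V"
  shows "spec V l *v column i V = complex_of_real (l i) *s column i V" "norm (column i V) = 1"
proof -
  have "spec V l ** V = V ** diag_real l"
    by (simp add: spec_def unitary_cancel[OF V])
  then have "(spec V l ** V) $ k $ i = V $ k $ i * complex_of_real (l i)" for k
    by (simp add: diag_mult_right_nth)
  then show "spec V l *v column i V = complex_of_real (l i) *s column i V"
    by (simp add: vec_eq_iff column_def matrix_vector_mult_def mat_mult_nth mult.commute)
  have "(\<Sum>j\<in>UNIV. (cmod (adjoint_mat V $ i $ j))\<^sup>2) = 1"
    by (intro unitary_row_sum unitary_mat_adjoint V)
  then show "norm (column i V) = 1"
    by (simp add: norm_vec_def L2_set_def column_def)
qed

lemma eigenvalue_le_op_norm: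
  assumes V: "unitary_mat V"
  shows "\<bar>l i\<bar> \<le> op_norm (spec V l)"
proof -
  have "norm (spec V l *v column i V) = \<bar>l i\<bar>"
  proof -
    have "complex_of_real (l i) *s column i V = l i *\<^sub>R column i V"
      by (simp add: vec_eq_iff scaleR_conv_of_real[where 'a = complex])
    then show ?thesis by (simp add: spec_mult_column[OF V])
  qed
  then show ?thesis
    using norm_mat_vec_le[of "spec V l" "column i V"] by (simp add: spec_mult_column[OF V])
qed

text \<open>\<open>dln x y\<close> is a mean value of \<open>1 / z\<close> for \<open>z\<close>
  between \<open>x\<close> and \<open>y\<close>. The estimate comes from
  \<open>ln z \<le> z - 1\<close> applied to the ratio of the two arguments.\<close>

lemma dln_le:
  assumes "0 < \<delta>" "\<delta> \<le> x" "\<delta> \<le> y"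
  shows "\<bar>dln x y\<bar> \<le> 1 / \<delta>"
proof -
  have *: "0 \<le> (ln u - ln v) / (u - v) \<and> (ln u - ln v) / (u - v) \<le> 1 / \<delta>" if "u > v" "v \<ge> \<delta>" for u v
  proof -
    have "ln u - ln v = ln (u / v)" using that assms by (simp add: ln_div)
    also have "\<dots> \<le> u / v - 1" using that assms by (intro ln_le_minus_one) simp
    also have "\<dots> = (u - v) / v" using that assms by (simp add: field_simps)
    finally have "(ln u - ln v) / (u - v) \<le> 1 / v"
      using that by (simp add: field_simps)
    also have "\<dots> \<le> 1 / \<delta>" using that assms by (simp add: frac_le)
    finally show ?thesis using that assms by simp
  qed
  consider "x = y" | "x > y" | "y > x" by linarith
  then show ?thesis
  proof cases
    case 1
    then show ?thesis using assms by (simp add: dln_def frac_le)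
  next
    case 2
    then show ?thesis using *[of y x] assms by (simp add: dln_def)
  next
    case 3
    then have "dln x y = (ln y - ln x) / (y - x)"
      by (simp add: dln_def) (metis minus_diff_eq minus_divide_divide)
    then show ?thesis using *[of x y] assms 3 by simp
  qed
qed

lemma entry_schur_le:
  fixes N :: "complex^'n^'n"
  assumes V: "unitary_mat V" and k: "\<And>a b. \<bar>k a b\<bar> \<le> c"
  shows "cmod (schur V k N $ i $ j) \<le> CARD('n) * (CARD('n) * (c * entry_sum N))"
proof -
  have c: "c \<ge> 0" using k[of i i] by simp
  have "cmod (schur V k N $ i $ j) \<le>
      entry_sum (\<chi> a b. complex_of_real (k a b) * (adjoint_mat V ** N ** V) $ a $ b)"
    unfolding schur_def by (intro unitary_sandwich_entry_le V unitary_mat_adjoint)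
  also have "\<dots> \<le> CARD('n) * (CARD('n) * (c * entry_sum N))"
  proof (rule entry_sum_le)
    fix a b
    have "\<bar>k a b\<bar> * cmod ((adjoint_mat V ** N ** V) $ a $ b) \<le> c * entry_sum N"
      by (intro mult_mono k c unitary_sandwich_entry_le unitary_mat_adjoint V) auto
    then show "cmod ((\<chi> a b. complex_of_real (k a b) * (adjoint_mat V ** N ** V) $ a $ b) $ a $ b) \<le> c * entry_sum N"
      by (simp add: norm_mult)
  qed
  finally show ?thesis .
qed


section \<open>One step of the supermartingale for a fixed outcome\<close>

definition Lieb_dual :: "real \<Rightarrow> real \<Rightarrow> complex^'n^'n \<Rightarrow> complex^'n^'n \<Rightarrow> complex^'n^'n" where
  "Lieb_dual L g K V = dln_series L (mexp (g *\<^sub>R V)) (mexp K)"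

text \<open>The first bound is linear in \<open>X\<close> and \<open>X ** X\<close>. After
  conditioning, the \<open>X\<close> term vanishes and \<open>X ** X\<close> becomes
  \<open>V\<close>, which leaves the left-hand side of the second bound; together they return to
  \<open>tr exp K\<close>. The third bound makes \<open>Q\<close> integrable against bounded
  matrices.\<close>

lemma Lieb_dual_step:
  fixes K V X :: "complex^'n^'n"
  assumes K: "self_adjoint K" and sV: "self_adjoint V" and X: "self_adjoint X" "op_norm X \<le> U"
    and L: "exp (entry_sum (g *\<^sub>R V)) \<le> L"
    and exp_le: "\<And>x. \<bar>x\<bar> \<le> U \<Longrightarrow> exp (\<theta> * x) \<le> 1 + \<theta> * x + g * x\<^sup>2"
  defines "Q \<equiv> Lieb_dual L g K V"
  shows "Re (trace (mexp (K - g *\<^sub>R V + \<theta> *\<^sub>R X))) \<le>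
      Re (trace Q) + \<theta> * Re (trace (Q ** X)) + g * Re (trace (Q ** (X ** X)))" (is ?thesis1)
    and "Re (trace Q) + g * Re (trace (Q ** V)) \<le> Re (trace (mexp K))" (is ?thesis2)
    and "cmod (Q $ i $ j) \<le> real CARD('n) * (real CARD('n) * (exp (entry_sum (g *\<^sub>R V)) *
        (real CARD('n) * (real CARD('n) * (real CARD('n) * exp (entry_sum K))))))" (is ?thesis3)
proof -
  obtain T v where T: "unitary_mat T" and V_eq: "V = spec T v"
    using spectral_theorem[OF sV] .
  obtain P \<kappa> where P: "unitary_mat P" and K_eq: "K = spec P \<kappa>"
    using spectral_theorem[OF K] .
  obtain R x where R: "unitary_mat R" and X_eq: "X = spec R x"
    using spectral_theorem[OF X(1)] .
  define \<beta> where "\<beta> i = g * v i" for i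
  have gV: "g *\<^sub>R V = spec T \<beta>" by (simp add: V_eq spec_scaleR \<beta>_def[abs_def])
  have \<beta>: "\<bar>\<beta> i\<bar> \<le> entry_sum (g *\<^sub>R V)" for i
    unfolding gV by (rule eigenvalue_le_entry_sum[OF T])
  have N: "mexp K = spec P (\<lambda>i. exp (\<kappa> i))" by (simp add: K_eq mexp_spec P)
  have Q: "Q = schur T (\<lambda>a b. dln (exp (\<beta> a)) (exp (\<beta> b))) (mexp K)"
    unfolding Q_def Lieb_dual_def gV mexp_spec[OF T]
    using \<beta> L by (intro dln_series_eq T) (auto intro: order_trans[OF _ L] dest: abs_le_D1)
  \<comment> \<open>The spectrum of \<open>X\<close> lies in \<open>[- U, U]\<close>, where the
    scalar gap is nonnegative. Positivity of \<open>Q\<close> lifts this gap to a trace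
    inequality.\<close>
  have "Re (trace (Q ** spec R (\<lambda>i. (1 + \<theta> * x i + g * (x i)\<^sup>2) - exp (\<theta> * x i)))) \<ge> 0"
    unfolding Q N
  proof (rule trace_schur_dln_nonneg[OF T])
    fix i
    have "\<bar>x i\<bar> \<le> U" using eigenvalue_le_op_norm[OF R, of x i] X(2) by (simp add: X_eq)
    from exp_le[OF this] show "0 \<le> 1 + \<theta> * x i + g * (x i)\<^sup>2 - exp (\<theta> * x i)" by simp
  qed auto
  also have "spec R (\<lambda>i. (1 + \<theta> * x i + g * (x i)\<^sup>2) - exp (\<theta> * x i)) =
      mat 1 + \<theta> *\<^sub>R X + g *\<^sub>R (X ** X) - mexp (\<theta> *\<^sub>R X)"
    by (simp add: X_eq spec_mult[OF R] spec_scaleR mexp_spec[OF R] spec_one[OF R, symmetric] spec_add spec_diff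
        power2_eq_square)
  finally have "Re (trace (Q ** mexp (\<theta> *\<^sub>R X))) \<le>
      Re (trace Q) + \<theta> * Re (trace (Q ** X)) + g * Re (trace (Q ** (X ** X)))"
    by (simp add: mat_mult_diff_right matrix_add_ldistrib mat_mult_scaleR_right trace_add trace_sub trace_scaleR)
  moreover have "Re (trace (mexp (K - g *\<^sub>R V + \<theta> *\<^sub>R X))) \<le> Re (trace (Q ** mexp (\<theta> *\<^sub>R X)))"
    unfolding Q gV by (intro Lieb_tangent K self_adjoint_scaleR X T)
  ultimately show ?thesis1 by linarith

  let ?d = "\<lambda>a. Re ((adjoint_mat T ** mexp K ** T) $ a $ a)"
  \<comment> \<open>\<open>V\<close> is diagonal in the basis in which \<open>Q\<close> is a
    multiplier, so only \<open>1 / exp (\<beta> a)\<close> enters. The estimate is then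
    \<open>1 + \<beta> a \<le> exp (\<beta> a)\<close>.\<close>
  have "Re (trace Q) + g * Re (trace (Q ** V)) = Re (trace (Q ** spec T (\<lambda>i. 1 + \<beta> i)))"
    by (simp add: spec_add[symmetric] spec_one[OF T] gV[symmetric] matrix_add_ldistrib mat_mult_scaleR_right
        trace_add trace_scaleR)
  also have "\<dots> = (\<Sum>a\<in>UNIV. (1 + \<beta> a) / exp (\<beta> a) * ?d a)"
    unfolding Q trace_schur_spec[OF T] by (simp add: dln_def)
  also have "\<dots> \<le> (\<Sum>a\<in>UNIV. 1 * ?d a)"
    by (intro sum_mono mult_right_mono) (auto simp: N spec_psd_diag_nonneg exp_ge_add_one_self)
  also have "\<dots> = Re (trace (adjoint_mat T ** mexp K ** T))"
    by (simp add: trace_def)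
  finally show ?thesis2 by (simp only: trace_conj_unitary[OF T])

  have "cmod (Q $ i $ j) \<le> real CARD('n) * (real CARD('n) * (exp (entry_sum (g *\<^sub>R V)) * entry_sum (mexp K)))"
    unfolding Q
  proof (rule entry_schur_le[OF T])
    fix a b
    have "exp (- entry_sum (g *\<^sub>R V)) \<le> exp (\<beta> c)" for c
      using \<beta>[of c] by (simp add: abs_le_iff)
    then show "\<bar>dln (exp (\<beta> a)) (exp (\<beta> b))\<bar> \<le> exp (entry_sum (g *\<^sub>R V))"
      using dln_le[of "exp (- entry_sum (g *\<^sub>R V))" "exp (\<beta> a)" "exp (\<beta> b)"]
      by (simp add: exp_minus field_simps)
  qed
  also have "\<dots> \<le> real CARD('n) * (real CARD('n) * (exp (entry_sum (g *\<^sub>R V)) *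
        (real CARD('n) * (real CARD('n) * (real CARD('n) * exp (entry_sum K))))))"
    by (intro mult_left_mono entry_sum_le entry_mexp_le K) auto
  finally show ?thesis3 .
qed

text \<open>Double stochasticity turns the weights \<open>r\<close> in the basis \<open>V\<close>
  into weights \<open>w j\<close> in \<open>[0, 1]\<close> with the same sum, attached to the
  eigenvectors of \<open>spec R \<alpha>\<close>. The quantity becomes the sum of
  \<open>exp (\<alpha> j) - w j * (1 + \<alpha> j)\<close>. Every term is nonnegative, so a single
  large eigenvalue already bounds the sum from below.\<close>

lemma trace_exp_excess:
  assumes V: "unitary_mat V" and R: "unitary_mat R" and r: "\<And>k. 0 \<le> r k" "\<And>k. r k \<le> 1"
  shows "0 \<le> Re (trace (mexp (spec R \<alpha>))) - (\<Sum>k\<in>UNIV. r k) - Re (trace (spec V r ** spec R \<alpha>))" (is "0 \<le> ?Z")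
    and "0 \<le> b \<Longrightarrow> b \<le> \<alpha> j \<Longrightarrow> exp b - 1 - b \<le>
      Re (trace (mexp (spec R \<alpha>))) - (\<Sum>k\<in>UNIV. r k) - Re (trace (spec V r ** spec R \<alpha>))"
proof -
  define w where "w j = (\<Sum>k\<in>UNIV. r k * overlap V R k j)" for j
  have w0: "0 \<le> w j" for j
    unfolding w_def by (intro sum_nonneg mult_nonneg_nonneg r overlap_nonneg)
  have w1: "w j \<le> 1" for j
  proof -
    have "w j \<le> (\<Sum>k\<in>UNIV. 1 * overlap V R k j)"
      unfolding w_def by (intro sum_mono mult_right_mono r overlap_nonneg)
    then show ?thesis by (simp add: sum_overlap_left[OF V R])
  qed
  have "(\<Sum>j\<in>UNIV. w j) = (\<Sum>k\<in>UNIV. \<Sum>j\<in>UNIV. r k * overlap V R k j)"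
    unfolding w_def by (rule sum.swap)
  then have sum_w: "(\<Sum>j\<in>UNIV. w j) = (\<Sum>k\<in>UNIV. r k)"
    by (simp add: sum_distrib_left[symmetric] sum_overlap_right[OF V R])
  have "Re (trace (spec V r ** spec R \<alpha>)) = (\<Sum>k\<in>UNIV. \<Sum>j\<in>UNIV. r k * \<alpha> j * overlap V R k j)"
    by (simp only: trace_spec_spec Re_complex_of_real)
  also have "\<dots> = (\<Sum>j\<in>UNIV. w j * \<alpha> j)"
    unfolding w_def sum_distrib_right by (subst sum.swap) (simp add: mult_ac)
  finally have Z: "?Z = (\<Sum>j\<in>UNIV. exp (\<alpha> j) - w j * (1 + \<alpha> j))"
    by (simp add: mexp_spec[OF R] trace_spec[OF R] sum_w[symmetric] algebra_simps sum.distrib sum_subtractf)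
  have ge: "0 \<le> exp (\<alpha> j) - w j * (1 + \<alpha> j)" for j
  proof (cases "1 + \<alpha> j \<ge> 0")
    case True
    then have "w j * (1 + \<alpha> j) \<le> 1 + \<alpha> j" using w0[of j] w1[of j] by (simp add: mult_left_le_one_le)
    then show ?thesis using exp_ge_add_one_self[of "\<alpha> j"] by linarith
  next
    case False
    then have "w j * (1 + \<alpha> j) \<le> 0" using w0[of j] by (simp add: mult_nonneg_nonpos)
    then show ?thesis using exp_ge_zero[of "\<alpha> j"] by linarith
  qed
  show "0 \<le> ?Z" unfolding Z by (intro sum_nonneg ge)
  assume b: "0 \<le> b" "b \<le> \<alpha> j"
  \<comment> \<open>Monotonicity of \<open>exp x - 1 - x\<close> on the nonnegative
    half-line.\<close>
  have "exp b - 1 - b \<le> exp (\<alpha> j) - 1 - \<alpha> j"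
  proof -
    have "exp b * (1 + (\<alpha> j - b)) \<le> exp b * exp (\<alpha> j - b)"
      by (intro mult_left_mono exp_ge_add_one_self) simp
    also have "\<dots> = exp (\<alpha> j)" by (simp add: exp_add[symmetric])
    finally have 1: "exp b + exp b * (\<alpha> j - b) \<le> exp (\<alpha> j)" by (simp add: algebra_simps)
    have "1 * (\<alpha> j - b) \<le> exp b * (\<alpha> j - b)"
      using b by (intro mult_right_mono) auto
    from order_trans[OF add_left_mono[OF this] 1] show ?thesis by simp
  qed
  also have "\<dots> \<le> exp (\<alpha> j) - w j * (1 + \<alpha> j)"
    using b w0[of j] w1[of j] mult_left_le_one_le[of "1 + \<alpha> j" "w j"] by linarith
  also have "\<dots> \<le> (\<Sum>j\<in>UNIV. exp (\<alpha> j) - w j * (1 + \<alpha> j))"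
    using ge by (intro member_le_sum) auto
  finally show "exp b - 1 - b \<le> ?Z" unfolding Z .
qed

section \<open>Rayleigh quotients, the largest eigenvalue and the operator norm\<close>

lemma sum_adjoint_mult_vec:
  assumes R: "unitary_mat R"
  shows "(\<Sum>i\<in>UNIV. (cmod ((adjoint_mat R *v v) $ i))\<^sup>2) = (norm v)\<^sup>2"
proof -
  have "hip (adjoint_mat R *v v) (adjoint_mat R *v v) = hip v v"
    by (simp add: hip_adjoint matrix_vector_mul_assoc unitary_matD[OF R])
  then have "(norm (adjoint_mat R *v v))\<^sup>2 = (norm v)\<^sup>2"
    by (simp add: hip_self flip: of_real_power)
  then show ?thesis
    by (simp add: norm_vec_def L2_set_def sum_nonneg)
qed

lemma diag_mat_vec: "(diag_real \<alpha> *v u) $ i = complex_of_real (\<alpha> i) * u $ i"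
proof -
  have "(diag_real \<alpha> *v u) $ i = (\<Sum>k\<in>UNIV. if k = i then complex_of_real (\<alpha> i) * u $ i else 0)"
    unfolding matrix_vector_mult_def vec_lambda_beta by (rule sum.cong) auto
  then show ?thesis by simp
qed

lemma inner_spec:
  "inner v (spec R \<alpha> *v v) = (\<Sum>i\<in>UNIV. \<alpha> i * (cmod ((adjoint_mat R *v v) $ i))\<^sup>2)"
proof -
  have "hip v (spec R \<alpha> *v v) = hip (adjoint_mat R *v v) (diag_real \<alpha> *v (adjoint_mat R *v v))"
    by (simp add: spec_def matrix_vector_mul_assoc[symmetric] hip_adjoint[of v])
  also have "\<dots> = (\<Sum>i\<in>UNIV. complex_of_real (\<alpha> i) * (cnj ((adjoint_mat R *v v) $ i) * (adjoint_mat R *v v) $ i))"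
    by (simp add: hip_def diag_mat_vec mult_ac)
  also have "\<dots> = complex_of_real (\<Sum>i\<in>UNIV. \<alpha> i * (cmod ((adjoint_mat R *v v) $ i))\<^sup>2)"
    by (simp add: complex_norm_square[unfolded of_real_power] mult.commute)
  finally show ?thesis by (simp add: inner_eq_Re_hip)
qed

lemma inner_spec_le:
  assumes R: "unitary_mat R" and "\<And>i. \<alpha> i \<le> c"
  shows "inner v (spec R \<alpha> *v v) \<le> c * (norm v)\<^sup>2"
  unfolding inner_spec sum_adjoint_mult_vec[OF R, symmetric] sum_distrib_left
  by (intro sum_mono mult_right_mono assms) auto

text \<open>\<open>Max\<close> is informative only on a finite set, so the main work is to show that
  every real eigenvalue occurs in the family \<open>\<alpha>\<close>.\<close>

lemma eigenvalue_le_lambda_max: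
  assumes R: "unitary_mat R"
  shows "\<alpha> i \<le> lambda_max (spec R \<alpha>)"
proof -
  let ?E = "{l. \<exists>v. v \<noteq> 0 \<and> spec R \<alpha> *v v = complex_of_real l *s v}"
  have "?E \<subseteq> range \<alpha>"
  proof
    fix l assume "l \<in> ?E"
    then obtain v where v: "v \<noteq> 0" "spec R \<alpha> *v v = complex_of_real l *s v" by blast
    define u where "u = adjoint_mat R *v v"
    have "adjoint_mat R ** spec R \<alpha> = diag_real \<alpha> ** adjoint_mat R"
      by (simp add: spec_def matrix_mul_assoc unitary_matD[OF R])
    then have "diag_real \<alpha> *v u = adjoint_mat R *v (spec R \<alpha> *v v)"
      by (simp add: u_def matrix_vector_mul_assoc)
    then have du: "diag_real \<alpha> *v u = complex_of_real l *s u"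
      by (simp add: v(2) u_def matrix_vector_mult_scaleR vec.scale)
    have "R *v u = v" by (simp add: u_def matrix_vector_mul_assoc unitary_matD[OF R])
    then have "u \<noteq> 0" using v(1) by auto
    then obtain k where k: "u $ k \<noteq> 0" by (auto simp: vec_eq_iff)
    have "complex_of_real (\<alpha> k) * u $ k = complex_of_real l * u $ k"
      using diag_mat_vec[of \<alpha> u k] unfolding du vector_smult_component by (rule sym)
    then show "l \<in> range \<alpha>" using k by (metis mult_right_cancel of_real_eq_iff rangeI)
  qed
  then have fin: "finite ?E" by (rule finite_subset) simp
  have "column i R \<noteq> 0" using spec_mult_column(2)[OF R, of i] by auto
  then have "\<alpha> i \<in> ?E" using spec_mult_column(1)[OF R, of \<alpha> i] by blast
  then show ?thesis unfolding lambda_max_def by (rule Max_ge[OF fin])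
qed

lemma op_norm_spec_le:
  assumes R: "unitary_mat R" and s: "\<And>i. \<bar>s i\<bar> \<le> t" and t: "0 \<le> t"
  shows "op_norm (spec R s) \<le> t"
  unfolding op_norm_def
proof (rule onorm_le)
  fix v
  have "(norm (spec R s *v v))\<^sup>2 = Re (hip (spec R s *v v) (spec R s *v v))"
    by (simp only: power2_norm_eq_inner inner_eq_Re_hip)
  also have "\<dots> = inner v (spec R (\<lambda>i. (s i)\<^sup>2) *v v)"
    unfolding hip_self_adjoint[OF self_adjoint_spec, symmetric]
    by (simp add: inner_eq_Re_hip matrix_vector_mul_assoc spec_mult[OF R] power2_eq_square)
  also have "\<dots> \<le> t\<^sup>2 * (norm v)\<^sup>2"
    by (rule inner_spec_le[OF R]) (use s t in \<open>simp add: abs_le_square_iff[symmetric]\<close>)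
  finally show "norm (spec R s *v v) \<le> t * norm v"
    using t by (simp add: power_mult_distrib[symmetric] power2_le_iff_abs_le)
qed

text \<open>An eigenvector \<open>v\<close> of \<open>S\<close> for an eigenvalue of modulus above
  \<open>t\<close> serves as test vector for \<open>\<theta> \<epsilon> S - g W\<close>, with
  \<open>\<epsilon>\<close> the sign of that eigenvalue. The Rayleigh quotient at \<open>v\<close>
  is at least \<open>\<theta> t - g c\<close>, hence so is some eigenvalue. The sign is fixed before
  the decomposition, which leaves the latter free.\<close>

lemma large_eigenvalue:
  fixes S W :: "complex^'n^'n"
  assumes S: "self_adjoint S" and W: "self_adjoint W" and t: "0 \<le> t" "op_norm S > t"
    and W_le: "lambda_max W \<le> c" and \<theta>: "0 \<le> \<theta>" and g: "0 \<le> g"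
  shows "\<exists>\<epsilon>\<in>{1, -1}. \<forall>R \<alpha>. unitary_mat R \<longrightarrow> \<theta> *\<^sub>R (\<epsilon> *\<^sub>R S) - g *\<^sub>R W = spec R \<alpha> \<longrightarrow>
    (\<exists>j. \<theta> * t - g * c \<le> \<alpha> j)"
proof -
  obtain P s where P: "unitary_mat P" and S_eq: "S = spec P s" using spectral_theorem[OF S] .
  obtain T w where T: "unitary_mat T" and W_eq: "W = spec T w" using spectral_theorem[OF W] .
  obtain i where i: "\<bar>s i\<bar> > t"
    using op_norm_spec_le[OF P, of s t] t unfolding S_eq by (meson not_less)
  define v where "v = column i P"
  have nv: "norm v = 1" by (simp add: v_def spec_mult_column[OF P])
  define \<epsilon> :: real where "\<epsilon> = (if s i \<ge> 0 then 1 else -1)"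
  have \<epsilon>: "\<epsilon> \<in> {1, -1}" "\<epsilon> * s i = \<bar>s i\<bar>" by (auto simp: \<epsilon>_def)
  have "S *v v = s i *\<^sub>R v"
    by (simp add: S_eq v_def spec_mult_column[OF P] vec_eq_iff scaleR_conv_of_real[where 'a = complex])
  then have inner_S: "inner v (S *v v) = s i"
    using nv by (simp add: dot_square_norm)
  have "inner v (W *v v) \<le> c * (norm v)\<^sup>2"
    unfolding W_eq by (rule inner_spec_le[OF T]) (use W_le in \<open>auto simp: W_eq intro: order_trans[OF eigenvalue_le_lambda_max[OF T]]\<close>)
  then have inner_W: "g * inner v (W *v v) \<le> g * c"
    using nv g by (simp add: mult_left_mono)
  have "\<exists>j. \<theta> * t - g * c \<le> \<alpha> j" if R: "unitary_mat R" and eq: "\<theta> *\<^sub>R (\<epsilon> *\<^sub>R S) - g *\<^sub>R W = spec R \<alpha>" for R \<alpha>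
  proof (rule ccontr)
    assume "\<not> ?thesis"
    then have lt: "\<alpha> j < \<theta> * t - g * c" for j by (simp add: not_le)
    \<comment> \<open>\<open>inner_spec_le\<close> yields a weak inequality only. Passing through
      the maximum of the finitely many eigenvalues preserves strictness.\<close>
    have "inner v (spec R \<alpha> *v v) \<le> Max (range \<alpha>) * (norm v)\<^sup>2"
      by (rule inner_spec_le[OF R]) simp
    also have "\<dots> < \<theta> * t - g * c"
      using nv lt by (simp add: Max_less_iff)
    finally have "inner v (spec R \<alpha> *v v) < \<theta> * t - g * c" .
    moreover have "inner v (spec R \<alpha> *v v) = \<theta> * (\<epsilon> * s i) - g * inner v (W *v v)"
      unfolding eq[symmetric] inner_S[symmetric]
      by (simp add: inner_eq_Re_hip hip_def matrix_vector_mult_def sum_distrib_left sum_subtractf algebra_simps)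
    moreover have "\<theta> * t \<le> \<theta> * (\<epsilon> * s i)"
      using i \<theta> by (intro mult_left_mono) (simp_all add: \<epsilon>)
    ultimately show False using inner_W by linarith
  qed
  with \<epsilon>(1) show ?thesis by blast
qed


section \<open>Random matrices and conditional expectations\<close>

lemma borel_measurable_entry:
  fixes A :: "'w \<Rightarrow> complex^'n^'m"
  assumes "A \<in> borel_measurable N"
  shows "(\<lambda>\<omega>. A \<omega> $ i $ j) \<in> borel_measurable N"
proof -
  have "bounded_linear (\<lambda>B :: complex^'n^'m. B $ i $ j)"
    by (rule bounded_linear_compose[OF bounded_linear_vec_nth bounded_linear_vec_nth])
  then have "(\<lambda>B :: complex^'n^'m. B $ i $ j) \<in> borel_measurable borel"
    by (intro borel_measurable_continuous_onI linear_continuous_on)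
  from measurable_compose[OF assms this] show ?thesis .
qed

lemma borel_measurable_matI:
  fixes A :: "'w \<Rightarrow> complex^'n^'m"
  assumes "\<And>i j. (\<lambda>\<omega>. A \<omega> $ i $ j) \<in> borel_measurable N"
  shows "A \<in> borel_measurable N"
proof (rule borel_measurable_euclidean_space[THEN iffD2], rule ballI)
  fix e :: "complex^'n^'m" assume "e \<in> Basis"
  then obtain i u where u: "e = axis i u" "u \<in> Basis" unfolding Basis_vec_def by blast
  from u(2) obtain j b where "u = axis j b" unfolding Basis_vec_def[where 'a = complex] by blast
  with u(1) have e: "e = axis i (axis j b)" by (simp only:)
  have "(\<lambda>\<omega>. A \<omega> $ i $ j \<bullet> b) \<in> borel_measurable N"
    by (intro borel_measurable_inner assms borel_measurable_const)
  then show "(\<lambda>\<omega>. A \<omega> \<bullet> e) \<in> borel_measurable N"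
    by (simp only: e inner_axis)
qed

lemma borel_measurable_mat_mult [measurable (raw)]:
  fixes A B :: "'w \<Rightarrow> complex^'n^'n"
  assumes [measurable]: "A \<in> borel_measurable N" "B \<in> borel_measurable N"
  shows "(\<lambda>\<omega>. A \<omega> ** B \<omega>) \<in> borel_measurable N"
  by (rule borel_measurable_matI)
     (simp only: mat_mult_nth, intro borel_measurable_sum borel_measurable_times borel_measurable_entry assms)

lemma borel_measurable_mpow [measurable (raw)]:
  fixes A :: "'w \<Rightarrow> complex^'n^'n"
  assumes [measurable]: "A \<in> borel_measurable N"
  shows "(\<lambda>\<omega>. mpow (A \<omega>) k) \<in> borel_measurable N"
proof (induction k)
  case 0
  show ?case unfolding mpow.simps by (rule borel_measurable_const)
next
  case (Suc k)
  show ?case unfolding mpow.simps by (rule borel_measurable_mat_mult[OF assms Suc])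
qed

lemma borel_measurable_mexp [measurable (raw)]:
  fixes A :: "'w \<Rightarrow> complex^'n^'n"
  assumes [measurable]: "A \<in> borel_measurable N"
  shows "(\<lambda>\<omega>. mexp (A \<omega>)) \<in> borel_measurable N"
  unfolding mexp_def
  by (rule borel_measurable_suminf, rule borel_measurable_scaleR, rule borel_measurable_const,
      rule borel_measurable_mpow[OF assms])

lemma borel_measurable_Lieb_dual [measurable (raw)]:
  fixes K V :: "'w \<Rightarrow> complex^'n^'n"
  assumes [measurable]: "K \<in> borel_measurable N" "V \<in> borel_measurable N"
  shows "(\<lambda>\<omega>. Lieb_dual L g (K \<omega>) (V \<omega>)) \<in> borel_measurable N"
proof -
  have D: "(\<lambda>\<omega>. mat 1 - (1 / L) *\<^sub>R mexp (g *\<^sub>R V \<omega>)) \<in> borel_measurable N"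
    by (rule borel_measurable_diff, rule borel_measurable_const, rule borel_measurable_scaleR,
        rule borel_measurable_const, rule borel_measurable_mexp, rule borel_measurable_scaleR,
        rule borel_measurable_const, rule assms)
  show ?thesis
    unfolding Lieb_dual_def dln_series_def
    by (rule borel_measurable_suminf, rule borel_measurable_scaleR, rule borel_measurable_const,
        rule borel_measurable_sum, rule borel_measurable_mat_mult, rule borel_measurable_mat_mult,
        rule borel_measurable_mpow[OF D], rule borel_measurable_mexp[OF assms(1)],
        rule borel_measurable_mpow[OF D])
qed

lemma borel_measurable_cond_exp_mat [measurable]:
  "cond_exp_mat M F Y \<in> borel_measurable F"
proof (rule borel_measurable_matI)
  fix i j
  have "(\<lambda>\<omega>. complex_of_real (real_cond_exp M F (\<lambda>\<omega>'. Re (Y \<omega>' $ i $ j)) \<omega>) +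
      \<i> * complex_of_real (real_cond_exp M F (\<lambda>\<omega>'. Im (Y \<omega>' $ i $ j)) \<omega>)) \<in> borel_measurable F"
    by measurable
  then show "(\<lambda>\<omega>. cond_exp_mat M F Y \<omega> $ i $ j) \<in> borel_measurable F"
    by (simp only: cond_exp_mat_def Complex_eq vec_lambda_beta)
qed

lemma entry_sum_mult:
  fixes A B :: "complex^'n^'n"
  shows "entry_sum (A ** B) \<le> entry_sum A * entry_sum B"
proof -
  have row: "(\<Sum>j\<in>UNIV. cmod (B $ k $ j)) \<le> entry_sum B" for k
    unfolding entry_sum_def by (rule member_le_sum) (auto intro: sum_nonneg)
  have "cmod ((A ** B) $ i $ j) \<le> (\<Sum>k\<in>UNIV. cmod (A $ i $ k) * cmod (B $ k $ j))" for i j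
    unfolding mat_mult_nth norm_mult[symmetric] by (rule norm_sum)
  then have "entry_sum (A ** B) \<le> (\<Sum>i\<in>UNIV. \<Sum>j\<in>UNIV. \<Sum>k\<in>UNIV. cmod (A $ i $ k) * cmod (B $ k $ j))"
    unfolding entry_sum_def by (intro sum_mono)
  also have "\<dots> = (\<Sum>i\<in>UNIV. \<Sum>k\<in>UNIV. cmod (A $ i $ k) * (\<Sum>j\<in>UNIV. cmod (B $ k $ j)))"
    unfolding sum_distrib_left by (rule sum.cong[OF refl], rule sum.swap)
  also have "\<dots> \<le> (\<Sum>i\<in>UNIV. \<Sum>k\<in>UNIV. cmod (A $ i $ k) * entry_sum B)"
    by (intro sum_mono mult_left_mono row) auto
  also have "\<dots> = entry_sum A * entry_sum B"
    by (simp only: entry_sum_def[of A] sum_distrib_right)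
  finally show ?thesis .
qed

lemma norm_le_entry_sum: "norm A \<le> entry_sum (A :: complex^'n^'m)"
proof -
  have "norm A \<le> (\<Sum>i\<in>UNIV. norm (A $ i))"
    unfolding norm_vec_def[of A] by (rule L2_set_le_sum) simp
  also have "\<dots> \<le> entry_sum A"
    unfolding entry_sum_def by (intro sum_mono) (simp add: norm_vec_def L2_set_le_sum)
  finally show ?thesis .
qed


text \<open>The bound is almost sure because both the hypothesis on \<open>op_norm\<close> and the
  bounds on conditional expectations are. The class is closed under sums, products, conditional
  expectation and, for self-adjoint values, \<open>mexp\<close>; every expectation below exists for
  this reason.\<close>

definition ess_bounded :: "'w measure \<Rightarrow> ('w \<Rightarrow> complex^'n^'m) \<Rightarrow> bool" where
  "ess_bounded M A \<longleftrightarrow> A \<in> borel_measurable M \<and> (\<exists>C. AE \<omega> in M. entry_sum (A \<omega>) \<le> C)"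

lemma ess_boundedI: "A \<in> borel_measurable M \<Longrightarrow> AE \<omega> in M. entry_sum (A \<omega>) \<le> C \<Longrightarrow> ess_bounded M A"
  by (auto simp: ess_bounded_def)

lemma ess_bounded_measurable: "ess_bounded M A \<Longrightarrow> A \<in> borel_measurable M"
  by (simp add: ess_bounded_def)

lemma ess_bounded_const: "ess_bounded M (\<lambda>_. A)"
  by (rule ess_boundedI[of _ _ "entry_sum A"]) auto

lemma ess_bounded_add:
  assumes "ess_bounded M A" "ess_bounded M B"
  shows "ess_bounded M (\<lambda>\<omega>. A \<omega> + B \<omega>)"
proof -
  from assms obtain C D where "AE \<omega> in M. entry_sum (A \<omega>) \<le> C" "AE \<omega> in M. entry_sum (B \<omega>) \<le> D"
    by (auto simp: ess_bounded_def)
  then have "AE \<omega> in M. entry_sum (A \<omega> + B \<omega>) \<le> C + D"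
    by eventually_elim (rule order_trans[OF entry_sum_add add_mono])
  then show ?thesis by (rule ess_boundedI[rotated]) (rule borel_measurable_add[OF assms[THEN ess_bounded_measurable]])
qed

lemma ess_bounded_scaleR:
  assumes "ess_bounded M A"
  shows "ess_bounded M (\<lambda>\<omega>. c *\<^sub>R A \<omega>)"
proof -
  from assms obtain C where "AE \<omega> in M. entry_sum (A \<omega>) \<le> C"
    by (auto simp: ess_bounded_def)
  then have "AE \<omega> in M. entry_sum (c *\<^sub>R A \<omega>) \<le> \<bar>c\<bar> * C"
    by eventually_elim (simp add: entry_sum_scaleR mult_left_mono)
  then show ?thesis by (rule ess_boundedI[rotated]) (rule borel_measurable_scaleR[OF borel_measurable_const ess_bounded_measurable[OF assms]])
qed

lemma ess_bounded_diff: "ess_bounded M A \<Longrightarrow> ess_bounded M B \<Longrightarrow> ess_bounded M (\<lambda>\<omega>. A \<omega> - B \<omega>)"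
  using ess_bounded_add[of M A "\<lambda>\<omega>. (-1) *\<^sub>R B \<omega>"] ess_bounded_scaleR[of M B "-1"] by simp

lemma ess_bounded_sum:
  "(\<And>i. i \<in> I \<Longrightarrow> ess_bounded M (A i)) \<Longrightarrow> ess_bounded M (\<lambda>\<omega>. \<Sum>i\<in>I. A i \<omega>)"
  by (induction I rule: infinite_finite_induct) (simp_all add: ess_bounded_const ess_bounded_add)

lemma ess_bounded_mult:
  fixes A B :: "'w \<Rightarrow> complex^'n^'n"
  assumes "ess_bounded M A" "ess_bounded M B"
  shows "ess_bounded M (\<lambda>\<omega>. A \<omega> ** B \<omega>)"
proof -
  from assms obtain C D where "AE \<omega> in M. entry_sum (A \<omega>) \<le> C" "AE \<omega> in M. entry_sum (B \<omega>) \<le> D"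
    by (auto simp: ess_bounded_def)
  then have "AE \<omega> in M. entry_sum (A \<omega> ** B \<omega>) \<le> C * D"
  proof eventually_elim
    case (elim \<omega>)
    have "entry_sum (A \<omega>) * entry_sum (B \<omega>) \<le> C * D"
      using elim order_trans[OF entry_sum_nonneg elim(1)] by (intro mult_mono) auto
    then show ?case using entry_sum_mult order_trans by blast
  qed
  then show ?thesis by (rule ess_boundedI[rotated]) (rule borel_measurable_mat_mult[OF assms[THEN ess_bounded_measurable]])
qed

lemma ess_bounded_mexp:
  fixes A :: "'w \<Rightarrow> complex^'n^'n"
  assumes "ess_bounded M A" "AE \<omega> in M. self_adjoint (A \<omega>)"
  shows "ess_bounded M (\<lambda>\<omega>. mexp (A \<omega>))"
proof -
  from assms obtain C where "AE \<omega> in M. entry_sum (A \<omega>) \<le> C"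
    by (auto simp: ess_bounded_def)
  with assms(2) have "AE \<omega> in M. entry_sum (mexp (A \<omega>)) \<le> real CARD('n) * (real CARD('n) * (real CARD('n) * exp C))"
  proof eventually_elim
    case (elim \<omega>)
    have "entry_sum (mexp (A \<omega>)) \<le> real CARD('n) * (real CARD('n) * (real CARD('n) * exp (entry_sum (A \<omega>))))"
      by (intro entry_sum_le entry_mexp_le elim)
    also have "\<dots> \<le> real CARD('n) * (real CARD('n) * (real CARD('n) * exp C))"
      using elim by (intro mult_left_mono) auto
    finally show ?case .
  qed
  then show ?thesis by (rule ess_boundedI[rotated]) (rule borel_measurable_mexp[OF ess_bounded_measurable[OF assms(1)]])
qed

lemma ess_bounded_entry:
  assumes "ess_bounded M A"
  obtains C where "AE \<omega> in M. \<forall>i j. cmod (A \<omega> $ i $ j) \<le> C"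
proof -
  from assms obtain C where "AE \<omega> in M. entry_sum (A \<omega>) \<le> C"
    by (auto simp: ess_bounded_def)
  then have "AE \<omega> in M. \<forall>i j. cmod (A \<omega> $ i $ j) \<le> C"
    by eventually_elim (blast intro: order_trans[OF entry_le_entry_sum])
  then show thesis using that by blast
qed

lemma bounded_linear_Re_trace: "bounded_linear (\<lambda>A :: complex^'n^'n. Re (trace A))"
  by (intro linear_conv_bounded_linear[THEN iffD1] linearI) (simp_all add: trace_add trace_scaleR)

lemma bounded_linear_Re_trace_mult: "bounded_linear (\<lambda>A :: complex^'n^'n. Re (trace (T ** A)))"
  by (intro linear_conv_bounded_linear[THEN iffD1] linearI)
     (simp_all add: matrix_add_ldistrib mat_mult_scaleR_right trace_add trace_scaleR)


section \<open>Conditional expectations under the trace\<close>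

context prob_space
begin

lemma ess_bounded_integrable:
  assumes "ess_bounded M A"
  shows "integrable M A"
proof -
  from assms obtain C where "AE \<omega> in M. entry_sum (A \<omega>) \<le> C"
    by (auto simp: ess_bounded_def)
  then have "AE \<omega> in M. norm (A \<omega>) \<le> C"
    by eventually_elim (rule order_trans[OF norm_le_entry_sum])
  then show ?thesis
    using ess_bounded_measurable[OF assms] by (rule integrable_const_bound)
qed

lemma ess_bounded_integrable_trace: "ess_bounded M A \<Longrightarrow> integrable M (\<lambda>\<omega>. Re (trace (A \<omega>)))"
  by (rule integrable_bounded_linear[OF bounded_linear_Re_trace ess_bounded_integrable])

lemma finite_measure_subalgebraI: "subalgebra M F \<Longrightarrow> finite_measure_subalgebra M F"
  by unfold_locales

lemma integral_mult_cond_exp: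
  fixes f g :: "'a \<Rightarrow> real"
  assumes F: "subalgebra M F" and f: "f \<in> borel_measurable F" and g: "g \<in> borel_measurable M"
    and bf: "AE \<omega> in M. \<bar>f \<omega>\<bar> \<le> C" and bg: "AE \<omega> in M. \<bar>g \<omega>\<bar> \<le> D"
  shows "integrable M (\<lambda>\<omega>. f \<omega> * g \<omega>)" "integrable M (\<lambda>\<omega>. f \<omega> * real_cond_exp M F g \<omega>)"
    "(\<integral>\<omega>. f \<omega> * real_cond_exp M F g \<omega> \<partial>M) = (\<integral>\<omega>. f \<omega> * g \<omega> \<partial>M)"
proof -
  interpret finite_measure_subalgebra M F by (rule finite_measure_subalgebraI[OF F])
  have [measurable]: "f \<in> borel_measurable M" by (rule measurable_from_subalg[OF F f])
  note [measurable] = g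
  have "AE \<omega> in M. norm (f \<omega> * g \<omega>) \<le> C * D"
    using bf bg
  proof eventually_elim
    case (elim \<omega>)
    then have "\<bar>f \<omega>\<bar> * \<bar>g \<omega>\<bar> \<le> C * D" by (intro mult_mono) auto
    then show ?case by (simp add: abs_mult)
  qed
  then show *: "integrable M (\<lambda>\<omega>. f \<omega> * g \<omega>)" by (rule integrable_const_bound) measurable
  show "integrable M (\<lambda>\<omega>. f \<omega> * real_cond_exp M F g \<omega>)"
    "(\<integral>\<omega>. f \<omega> * real_cond_exp M F g \<omega> \<partial>M) = (\<integral>\<omega>. f \<omega> * g \<omega> \<partial>M)"
    using real_cond_exp_intg[OF * f g] by auto
qed

text \<open>The real part of the trace is a finite sum of products of real and of imaginary parts,
  so the pull-out property of the scalar conditional expectation applies to each product.\<close>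

lemma integral_trace_cond_exp_mat:
  fixes Q Y :: "'a \<Rightarrow> complex^'n^'n"
  assumes F: "subalgebra M F" and Q: "Q \<in> borel_measurable F" and bQ: "ess_bounded M Q" and bY: "ess_bounded M Y"
  shows "(\<integral>\<omega>. Re (trace (Q \<omega> ** cond_exp_mat M F Y \<omega>)) \<partial>M) = (\<integral>\<omega>. Re (trace (Q \<omega> ** Y \<omega>)) \<partial>M)"
proof -
  obtain C where C: "AE \<omega> in M. \<forall>i j. cmod (Q \<omega> $ i $ j) \<le> C" by (rule ess_bounded_entry[OF bQ])
  obtain D where D: "AE \<omega> in M. \<forall>i j. cmod (Y \<omega> $ i $ j) \<le> D" by (rule ess_bounded_entry[OF bY])
  have bdQ: "AE \<omega> in M. \<bar>Re (Q \<omega> $ i $ j)\<bar> \<le> C" "AE \<omega> in M. \<bar>Im (Q \<omega> $ i $ j)\<bar> \<le> C" for i j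
    using C by (auto elim!: eventually_mono intro: order_trans[OF abs_Re_le_cmod] order_trans[OF abs_Im_le_cmod])
  have bdY: "AE \<omega> in M. \<bar>Re (Y \<omega> $ i $ j)\<bar> \<le> D" "AE \<omega> in M. \<bar>Im (Y \<omega> $ i $ j)\<bar> \<le> D" for i j
    using D by (auto elim!: eventually_mono intro: order_trans[OF abs_Re_le_cmod] order_trans[OF abs_Im_le_cmod])
  have [measurable]: "(\<lambda>\<omega>. Q \<omega> $ i $ j) \<in> borel_measurable F" "(\<lambda>\<omega>. Y \<omega> $ i $ j) \<in> borel_measurable M" for i j
    by (rule borel_measurable_entry[OF Q], rule borel_measurable_entry[OF ess_bounded_measurable[OF bY]])
  have meas: "(\<lambda>\<omega>. Re (Q \<omega> $ i $ j)) \<in> borel_measurable F" "(\<lambda>\<omega>. Im (Q \<omega> $ i $ j)) \<in> borel_measurable F"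
    "(\<lambda>\<omega>. Re (Y \<omega> $ i $ j)) \<in> borel_measurable M" "(\<lambda>\<omega>. Im (Y \<omega> $ i $ j)) \<in> borel_measurable M" for i j
    by measurable
  note re = integral_mult_cond_exp[OF F meas(1,3) bdQ(1) bdY(1)]
  note im = integral_mult_cond_exp[OF F meas(2,4) bdQ(2) bdY(2)]
  have tr: "Re (trace (A ** B)) = (\<Sum>a\<in>UNIV. \<Sum>b\<in>UNIV. Re (A $ a $ b) * Re (B $ b $ a) - Im (A $ a $ b) * Im (B $ b $ a))"
    for A B :: "complex^'n^'n"
    by (simp add: trace_mult)
  show ?thesis
    unfolding tr by (simp add: cond_exp_mat_def re im)
qed

lemma cond_exp_mat_ess_bounded:
  fixes Y :: "'a \<Rightarrow> complex^'n^'n"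
  assumes F: "subalgebra M F" and bY: "ess_bounded M Y"
  shows "ess_bounded M (cond_exp_mat M F Y)"
proof -
  interpret finite_measure_subalgebra M F by (rule finite_measure_subalgebraI[OF F])
  obtain D where D: "AE \<omega> in M. \<forall>i j. cmod (Y \<omega> $ i $ j) \<le> D" by (rule ess_bounded_entry[OF bY])
  have bd: "AE \<omega> in M. \<bar>Re (Y \<omega> $ i $ j)\<bar> \<le> D" "AE \<omega> in M. \<bar>Im (Y \<omega> $ i $ j)\<bar> \<le> D" for i j
    using D by (auto elim!: eventually_mono intro: order_trans[OF abs_Re_le_cmod] order_trans[OF abs_Im_le_cmod])
  have [measurable]: "(\<lambda>\<omega>. Y \<omega> $ i $ j) \<in> borel_measurable M" for i j
    by (intro borel_measurable_entry ess_bounded_measurable[OF bY])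
  have ce: "AE \<omega> in M. \<bar>real_cond_exp M F f \<omega>\<bar> \<le> D"
    if f: "f \<in> borel_measurable M" "AE \<omega> in M. \<bar>f \<omega>\<bar> \<le> D" for f :: "'a \<Rightarrow> real"
  proof -
    have int: "integrable M f" using f by (intro integrable_const_bound[of f D]) auto
    have "AE \<omega> in M. real_cond_exp M F f \<omega> \<le> D"
      by (rule real_cond_exp_le_c[OF int]) (use f(2) in \<open>auto elim!: eventually_mono\<close>)
    moreover have "AE \<omega> in M. real_cond_exp M F f \<omega> \<ge> - D"
      by (rule real_cond_exp_ge_c[OF int]) (use f(2) in \<open>auto elim!: eventually_mono\<close>)
    ultimately show ?thesis by eventually_elim auto
  qed
  have "AE \<omega> in M. \<bar>real_cond_exp M F (\<lambda>\<omega>. Re (Y \<omega> $ i $ j)) \<omega>\<bar> \<le> D"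
    "AE \<omega> in M. \<bar>real_cond_exp M F (\<lambda>\<omega>. Im (Y \<omega> $ i $ j)) \<omega>\<bar> \<le> D" for i j
    by (rule ce[OF _ bd(1)], measurable, rule ce[OF _ bd(2)], measurable)
  then have "AE \<omega> in M. \<forall>i j. \<bar>real_cond_exp M F (\<lambda>\<omega>. Re (Y \<omega> $ i $ j)) \<omega>\<bar> \<le> D \<and> \<bar>real_cond_exp M F (\<lambda>\<omega>. Im (Y \<omega> $ i $ j)) \<omega>\<bar> \<le> D"
    by (intro eventually_all_finite AE_conjI)
  then have "AE \<omega> in M. entry_sum (cond_exp_mat M F Y \<omega>) \<le> real CARD('n) * (real CARD('n) * (D + D))"
  proof eventually_elim
    case (elim \<omega>)
    show ?case
    proof (rule entry_sum_le)
      fix i j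
      show "cmod (cond_exp_mat M F Y \<omega> $ i $ j) \<le> D + D"
        using cmod_le[of "cond_exp_mat M F Y \<omega> $ i $ j"] elim[rule_format, of i j] by (simp add: cond_exp_mat_def)
    qed
  qed
  then show ?thesis
    by (rule ess_boundedI[rotated]) (rule measurable_from_subalg[OF F borel_measurable_cond_exp_mat])
qed

text \<open>The entries are conditioned separately, so symmetry of the real parts and antisymmetry
  of the imaginary parts hold only almost surely; finitely many null sets are discarded.\<close>

lemma cond_exp_mat_self_adjoint:
  fixes Y :: "'a \<Rightarrow> complex^'n^'n"
  assumes F: "subalgebra M F" and bY: "ess_bounded M Y" and sa: "AE \<omega> in M. self_adjoint (Y \<omega>)"
  shows "AE \<omega> in M. self_adjoint (cond_exp_mat M F Y \<omega>)"
proof -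
  interpret finite_measure_subalgebra M F by (rule finite_measure_subalgebraI[OF F])
  have [measurable]: "(\<lambda>\<omega>. Y \<omega> $ i $ j) \<in> borel_measurable M" for i j
    by (intro borel_measurable_entry ess_bounded_measurable[OF bY])
  have nth: "Y \<omega> $ i $ j = cnj (Y \<omega> $ j $ i)" if "self_adjoint (Y \<omega>)" for \<omega> i j
    using that unfolding self_adjoint_def by (metis adjoint_mat_nth)
  have re: "AE \<omega> in M. real_cond_exp M F (\<lambda>\<omega>. Re (Y \<omega> $ i $ j)) \<omega> = real_cond_exp M F (\<lambda>\<omega>. Re (Y \<omega> $ j $ i)) \<omega>" for i j
  proof (rule real_cond_exp_cong)
    show "AE \<omega> in M. Re (Y \<omega> $ i $ j) = Re (Y \<omega> $ j $ i)"
      using sa by eventually_elim (metis nth cnj.simps(1))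
  qed measurable
  have im: "AE \<omega> in M. real_cond_exp M F (\<lambda>\<omega>. Im (Y \<omega> $ i $ j)) \<omega> = - real_cond_exp M F (\<lambda>\<omega>. Im (Y \<omega> $ j $ i)) \<omega>" for i j
  proof -
    have "AE \<omega> in M. real_cond_exp M F (\<lambda>\<omega>. Im (Y \<omega> $ i $ j)) \<omega> = real_cond_exp M F (\<lambda>\<omega>. (-1) * Im (Y \<omega> $ j $ i)) \<omega>"
    proof (rule real_cond_exp_cong)
      show "AE \<omega> in M. Im (Y \<omega> $ i $ j) = (-1) * Im (Y \<omega> $ j $ i)"
        using sa by eventually_elim (metis nth cnj.simps(2) mult_minus1)
    qed measurable
    moreover have "integrable M (\<lambda>\<omega>. Im (Y \<omega> $ j $ i))"
    proof -
      have "bounded_linear (\<lambda>A :: complex^'n^'n. Im (A $ j $ i))"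
        by (intro bounded_linear_compose[OF bounded_linear_Im] bounded_linear_compose[OF bounded_linear_vec_nth] bounded_linear_vec_nth)
      then show ?thesis by (rule integrable_bounded_linear[OF _ ess_bounded_integrable[OF bY]])
    qed
    from real_cond_exp_cmult[OF this, of "-1"]
    have "AE \<omega> in M. real_cond_exp M F (\<lambda>\<omega>. (-1) * Im (Y \<omega> $ j $ i)) \<omega> = - real_cond_exp M F (\<lambda>\<omega>. Im (Y \<omega> $ j $ i)) \<omega>"
      by simp
    ultimately show ?thesis by eventually_elim simp
  qed
  have "AE \<omega> in M. \<forall>i j. real_cond_exp M F (\<lambda>\<omega>. Re (Y \<omega> $ i $ j)) \<omega> = real_cond_exp M F (\<lambda>\<omega>. Re (Y \<omega> $ j $ i)) \<omega> \<and>
      real_cond_exp M F (\<lambda>\<omega>. Im (Y \<omega> $ i $ j)) \<omega> = - real_cond_exp M F (\<lambda>\<omega>. Im (Y \<omega> $ j $ i)) \<omega>"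
    by (intro eventually_all_finite AE_conjI re im)
  then show ?thesis
  proof eventually_elim
    case (elim \<omega>)
    show ?case
      unfolding self_adjoint_def
    proof (rule mat_eqI)
      fix i j
      show "adjoint_mat (cond_exp_mat M F Y \<omega>) $ i $ j = cond_exp_mat M F Y \<omega> $ i $ j"
        using elim[rule_format, of i j] by (simp add: cond_exp_mat_def complex_eq_iff)
    qed
  qed
qed

text \<open>The supermartingale property in integrated form. \<open>Q\<close> depends only on
  \<open>K\<close> and on the conditional second moment, hence is \<open>F\<close>-measurable, so
  both conditional expectations can be moved under the trace against it.\<close>

lemma trace_exp_step:
  fixes K X :: "'a \<Rightarrow> complex^'n^'n"
  assumes F: "subalgebra M F" and K: "K \<in> borel_measurable F" "ess_bounded M K" "AE \<omega> in M. self_adjoint (K \<omega>)"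
    and X: "ess_bounded M X" "AE \<omega> in M. self_adjoint (X \<omega>)" "AE \<omega> in M. op_norm (X \<omega>) \<le> U"
    and mart: "AE \<omega> in M. cond_exp_mat M F X \<omega> = 0"
    and exp_le: "\<And>x. \<bar>x\<bar> \<le> U \<Longrightarrow> exp (\<theta> * x) \<le> 1 + \<theta> * x + g * x\<^sup>2"
  shows "(\<integral>\<omega>. Re (trace (mexp (K \<omega> - g *\<^sub>R cond_exp_mat M F (\<lambda>\<omega>. X \<omega> ** X \<omega>) \<omega> + \<theta> *\<^sub>R X \<omega>))) \<partial>M)
    \<le> (\<integral>\<omega>. Re (trace (mexp (K \<omega>))) \<partial>M)"
proof -
  define V where "V = cond_exp_mat M F (\<lambda>\<omega>. X \<omega> ** X \<omega>)"
  have XX: "ess_bounded M (\<lambda>\<omega>. X \<omega> ** X \<omega>)" by (intro ess_bounded_mult X)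
  have VF [measurable]: "V \<in> borel_measurable F" unfolding V_def by measurable
  have bV: "ess_bounded M V" unfolding V_def by (intro cond_exp_mat_ess_bounded F XX)
  have "AE \<omega> in M. self_adjoint (X \<omega> ** X \<omega>)"
    using X(2) by eventually_elim (simp add: self_adjoint_def adjoint_mat_mult)
  then have saV: "AE \<omega> in M. self_adjoint (V \<omega>)"
    unfolding V_def by (intro cond_exp_mat_self_adjoint F XX)
  from ess_bounded_scaleR[OF bV, of g] obtain c where c: "AE \<omega> in M. entry_sum (g *\<^sub>R V \<omega>) \<le> c"
    by (auto simp: ess_bounded_def)
  from K(2) obtain k where k: "AE \<omega> in M. entry_sum (K \<omega>) \<le> k"
    by (auto simp: ess_bounded_def)
  \<comment> \<open>The scale \<open>exp c\<close> must be a constant so that \<open>Q\<close> is a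
    measurable function of \<open>K\<close> and \<open>V\<close>. The almost sure bound
    \<open>c\<close> makes it exceed the eigenvalues of \<open>exp (g V)\<close> for almost all
    outcomes at once.\<close>
  define Q where "Q \<omega> = Lieb_dual (exp c) g (K \<omega>) (V \<omega>)" for \<omega>
  note [measurable] = K(1)
  have QF: "Q \<in> borel_measurable F" unfolding Q_def[abs_def] by measurable
  let ?d = "real CARD('n)"
  have "AE \<omega> in M. entry_sum (Q \<omega>) \<le> ?d * (?d * (?d * (?d * (exp c * (?d * (?d * (?d * exp k)))))))"
    using K(3) saV X(2,3) c k
  proof eventually_elim
    case (elim \<omega>)
    show ?case
    proof (rule entry_sum_le)
      fix i j
      have "exp (entry_sum (g *\<^sub>R V \<omega>)) \<le> exp c" using elim by simp
      from Lieb_dual_step(3)[OF elim(1,2,3,4) this exp_le]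
      have "cmod (Q \<omega> $ i $ j) \<le> ?d * (?d * (exp (entry_sum (g *\<^sub>R V \<omega>)) * (?d * (?d * (?d * exp (entry_sum (K \<omega>)))))))"
        by (simp add: Q_def)
      also have "\<dots> \<le> ?d * (?d * (exp c * (?d * (?d * (?d * exp k)))))"
        using elim by (intro mult_left_mono mult_mono) auto
      finally show "cmod (Q \<omega> $ i $ j) \<le> ?d * (?d * (exp c * (?d * (?d * (?d * exp k)))))" .
    qed
  qed
  then have bQ: "ess_bounded M Q"
    by (rule ess_boundedI[rotated]) (rule measurable_from_subalg[OF F QF])
  note int = ess_bounded_integrable_trace[OF bQ] ess_bounded_integrable_trace[OF ess_bounded_mult[OF bQ X(1)]]
    ess_bounded_integrable_trace[OF ess_bounded_mult[OF bQ XX]] ess_bounded_integrable_trace[OF ess_bounded_mult[OF bQ bV]]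
  have saH: "AE \<omega> in M. self_adjoint (K \<omega> - g *\<^sub>R V \<omega> + \<theta> *\<^sub>R X \<omega>)"
    using K(3) saV X(2) by eventually_elim (intro self_adjoint_add self_adjoint_diff self_adjoint_scaleR)
  have bH: "ess_bounded M (\<lambda>\<omega>. K \<omega> - g *\<^sub>R V \<omega> + \<theta> *\<^sub>R X \<omega>)"
    by (intro ess_bounded_add ess_bounded_diff ess_bounded_scaleR K bV X)
  have "(\<integral>\<omega>. Re (trace (mexp (K \<omega> - g *\<^sub>R V \<omega> + \<theta> *\<^sub>R X \<omega>))) \<partial>M) \<le>
     (\<integral>\<omega>. Re (trace (Q \<omega>)) + \<theta> * Re (trace (Q \<omega> ** X \<omega>)) + g * Re (trace (Q \<omega> ** (X \<omega> ** X \<omega>))) \<partial>M)"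
  proof (rule integral_mono_AE)
    show "integrable M (\<lambda>\<omega>. Re (trace (mexp (K \<omega> - g *\<^sub>R V \<omega> + \<theta> *\<^sub>R X \<omega>))))"
      by (intro ess_bounded_integrable_trace ess_bounded_mexp bH saH)
    show "integrable M (\<lambda>\<omega>. Re (trace (Q \<omega>)) + \<theta> * Re (trace (Q \<omega> ** X \<omega>)) + g * Re (trace (Q \<omega> ** (X \<omega> ** X \<omega>))))"
      using int by simp
    show "AE \<omega> in M. Re (trace (mexp (K \<omega> - g *\<^sub>R V \<omega> + \<theta> *\<^sub>R X \<omega>))) \<le>
      Re (trace (Q \<omega>)) + \<theta> * Re (trace (Q \<omega> ** X \<omega>)) + g * Re (trace (Q \<omega> ** (X \<omega> ** X \<omega>)))"
      using K(3) saV X(2,3) c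
    proof eventually_elim
      case (elim \<omega>)
      have "exp (entry_sum (g *\<^sub>R V \<omega>)) \<le> exp c" using elim by simp
      from Lieb_dual_step(1)[OF elim(1,2,3,4) this exp_le] show ?case by (simp add: Q_def)
    qed
  qed
  also have "\<dots> = (\<integral>\<omega>. Re (trace (Q \<omega>)) \<partial>M) + \<theta> * (\<integral>\<omega>. Re (trace (Q \<omega> ** X \<omega>)) \<partial>M)
      + g * (\<integral>\<omega>. Re (trace (Q \<omega> ** (X \<omega> ** X \<omega>))) \<partial>M)"
    using int by simp
  also have "(\<integral>\<omega>. Re (trace (Q \<omega> ** X \<omega>)) \<partial>M) = 0"
  proof -
    have "(\<integral>\<omega>. Re (trace (Q \<omega> ** cond_exp_mat M F X \<omega>)) \<partial>M) = (\<integral>\<omega>. 0 \<partial>M)"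
    proof (rule integral_cong_AE)
      show "(\<lambda>\<omega>. Re (trace (Q \<omega> ** cond_exp_mat M F X \<omega>))) \<in> borel_measurable M"
        by (intro borel_measurable_integrable ess_bounded_integrable_trace ess_bounded_mult bQ
            cond_exp_mat_ess_bounded F X)
      show "AE \<omega> in M. Re (trace (Q \<omega> ** cond_exp_mat M F X \<omega>)) = 0"
        using mart by eventually_elim (simp add: trace_def)
    qed simp
    then show ?thesis using integral_trace_cond_exp_mat[OF F QF bQ X(1)] by simp
  qed
  also have "(\<integral>\<omega>. Re (trace (Q \<omega> ** (X \<omega> ** X \<omega>))) \<partial>M) = (\<integral>\<omega>. Re (trace (Q \<omega> ** V \<omega>)) \<partial>M)"
    unfolding V_def by (rule integral_trace_cond_exp_mat[OF F QF bQ XX, symmetric])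
  also have "(\<integral>\<omega>. Re (trace (Q \<omega>)) \<partial>M) + \<theta> * 0 + g * (\<integral>\<omega>. Re (trace (Q \<omega> ** V \<omega>)) \<partial>M) =
      (\<integral>\<omega>. Re (trace (Q \<omega>)) + g * Re (trace (Q \<omega> ** V \<omega>)) \<partial>M)"
    using int by simp
  also have "\<dots> \<le> (\<integral>\<omega>. Re (trace (mexp (K \<omega>))) \<partial>M)"
  proof (rule integral_mono_AE)
    show "integrable M (\<lambda>\<omega>. Re (trace (Q \<omega>)) + g * Re (trace (Q \<omega> ** V \<omega>)))"
      using int by simp
    show "integrable M (\<lambda>\<omega>. Re (trace (mexp (K \<omega>))))"
      by (intro ess_bounded_integrable_trace ess_bounded_mexp K)
    show "AE \<omega> in M. Re (trace (Q \<omega>)) + g * Re (trace (Q \<omega> ** V \<omega>)) \<le> Re (trace (mexp (K \<omega>)))"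
      using K(3) saV X(2,3) c
    proof eventually_elim
      case (elim \<omega>)
      have "exp (entry_sum (g *\<^sub>R V \<omega>)) \<le> exp c" using elim by simp
      from Lieb_dual_step(2)[OF elim(1,2,3,4) this exp_le] show ?case by (simp add: Q_def)
    qed
  qed
  finally show ?thesis unfolding V_def .
qed

end


section \<open>The exponential process of a bounded matrix martingale\<close>

lemma bounded_linear_adjoint_mat: "bounded_linear (adjoint_mat :: complex^'n^'n \<Rightarrow> _)"
  by (intro linear_conv_bounded_linear[THEN iffD1] linearI) (simp_all add: adjoint_mat_add adjoint_mat_scaleR)

text \<open>The filtration \<open>F\<close> is a parameter instead of the one generated by
  \<open>X\<close>. Thus \<open>X\<close> and \<open>- X\<close> can be treated over the same
  filtration, with literally the same conditional second moments.\<close>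

locale bounded_matrix_martingale = prob_space M for M :: "'w measure" +
  fixes F :: "nat \<Rightarrow> 'w measure" and X :: "nat \<Rightarrow> 'w \<Rightarrow> complex^'d^'d" and n :: nat and U :: real
  assumes subalg: "k \<le> n \<Longrightarrow> subalgebra M (F k)"
    and filtration: "k < n \<Longrightarrow> subalgebra (F (Suc k)) (F k)"
    and adapted: "i \<in> {1..n} \<Longrightarrow> X i \<in> borel_measurable (F i)"
    and hermitian: "i \<in> {1..n} \<Longrightarrow> AE \<omega> in M. self_adjoint (X i \<omega>)"
    and op_norm_le: "i \<in> {1..n} \<Longrightarrow> AE \<omega> in M. op_norm (X i \<omega>) \<le> U"
    and mart: "i \<in> {1..n} \<Longrightarrow> AE \<omega> in M. cond_exp_mat M (F (i - 1)) (X i) \<omega> = 0"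
begin

definition S :: "nat \<Rightarrow> 'w \<Rightarrow> complex^'d^'d" where
  "S k \<omega> = (\<Sum>i=1..k. X i \<omega>)"

definition W :: "nat \<Rightarrow> 'w \<Rightarrow> complex^'d^'d" where
  "W k \<omega> = (\<Sum>i=1..k. cond_exp_mat M (F (i - 1)) (\<lambda>\<omega>'. X i \<omega>' ** X i \<omega>') \<omega>)"

lemma X_ess_bounded: "i \<in> {1..n} \<Longrightarrow> ess_bounded M (X i)"
proof -
  assume i: "i \<in> {1..n}"
  have "AE \<omega> in M. entry_sum (X i \<omega>) \<le> real CARD('d) * (real CARD('d) * U)"
    using op_norm_le[OF i] by eventually_elim (blast intro: entry_sum_le order_trans[OF entry_le_op_norm])
  moreover have "X i \<in> borel_measurable M"
    using i by (intro measurable_from_subalg[OF subalg adapted]) auto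
  ultimately show ?thesis by (intro ess_boundedI)
qed

lemma XX_ess_bounded: "i \<in> {1..n} \<Longrightarrow> ess_bounded M (\<lambda>\<omega>. X i \<omega> ** X i \<omega>)"
  by (intro ess_bounded_mult X_ess_bounded)

lemma subalg_pred: "i \<in> {1..n} \<Longrightarrow> subalgebra M (F (i - 1))"
  by (intro subalg) auto

lemma V_ess_bounded:
  "i \<in> {1..n} \<Longrightarrow> ess_bounded M (cond_exp_mat M (F (i - 1)) (\<lambda>\<omega>. X i \<omega> ** X i \<omega>))"
  by (intro cond_exp_mat_ess_bounded subalg_pred XX_ess_bounded)

lemma V_self_adjoint:
  assumes i: "i \<in> {1..n}"
  shows "AE \<omega> in M. self_adjoint (cond_exp_mat M (F (i - 1)) (\<lambda>\<omega>. X i \<omega> ** X i \<omega>) \<omega>)"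
proof (rule cond_exp_mat_self_adjoint[OF subalg_pred[OF i] XX_ess_bounded[OF i]])
  show "AE \<omega> in M. self_adjoint (X i \<omega> ** X i \<omega>)"
    using hermitian[OF i] by eventually_elim (simp add: self_adjoint_def adjoint_mat_mult)
qed

lemma S_ess_bounded: "k \<le> n \<Longrightarrow> ess_bounded M (S k)"
  unfolding S_def[abs_def] by (rule ess_bounded_sum) (auto intro: X_ess_bounded)

lemma W_ess_bounded: "k \<le> n \<Longrightarrow> ess_bounded M (W k)"
  unfolding W_def[abs_def] by (rule ess_bounded_sum) (rule V_ess_bounded, auto)

lemma S_self_adjoint: "k \<le> n \<Longrightarrow> AE \<omega> in M. self_adjoint (S k \<omega>)"
proof -
  assume k: "k \<le> n"
  have "AE \<omega> in M. \<forall>i\<in>{1..k}. self_adjoint (X i \<omega>)"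
    by (rule AE_finite_allI) (use k hermitian in auto)
  then show ?thesis unfolding S_def by eventually_elim (auto intro: self_adjoint_sum)
qed

lemma W_self_adjoint: "k \<le> n \<Longrightarrow> AE \<omega> in M. self_adjoint (W k \<omega>)"
proof -
  assume k: "k \<le> n"
  have "AE \<omega> in M. \<forall>i\<in>{1..k}. self_adjoint (cond_exp_mat M (F (i - 1)) (\<lambda>\<omega>. X i \<omega> ** X i \<omega>) \<omega>)"
    by (rule AE_finite_allI) (use k V_self_adjoint in auto)
  then show ?thesis unfolding W_def by eventually_elim (auto intro: self_adjoint_sum)
qed

lemma measurable_filtration: "f \<in> borel_measurable (F k) \<Longrightarrow> k < n \<Longrightarrow> f \<in> borel_measurable (F (Suc k))"
  by (rule measurable_from_subalg[OF filtration])

lemma S_measurable: "k \<le> n \<Longrightarrow> S k \<in> borel_measurable (F k)"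
proof (induction k)
  case 0
  show ?case by (simp add: S_def[abs_def])
next
  case (Suc k)
  have eq: "S (Suc k) = (\<lambda>\<omega>. S k \<omega> + X (Suc k) \<omega>)" by (simp add: S_def fun_eq_iff)
  show ?case unfolding eq
    using Suc by (intro borel_measurable_add measurable_filtration adapted) auto
qed

lemma W_measurable: "k \<le> n \<Longrightarrow> W k \<in> borel_measurable (F k)"
proof (induction k)
  case 0
  show ?case by (simp add: W_def[abs_def])
next
  case (Suc k)
  have eq: "W (Suc k) = (\<lambda>\<omega>. W k \<omega> + cond_exp_mat M (F k) (\<lambda>\<omega>'. X (Suc k) \<omega>' ** X (Suc k) \<omega>') \<omega>)"
    by (simp add: W_def fun_eq_iff)
  show ?case unfolding eq
    using Suc by (intro borel_measurable_add measurable_filtration borel_measurable_cond_exp_mat) auto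
qed

definition A :: "real \<Rightarrow> real \<Rightarrow> nat \<Rightarrow> 'w \<Rightarrow> complex^'d^'d" where
  "A \<theta> g k \<omega> = \<theta> *\<^sub>R S k \<omega> - g *\<^sub>R W k \<omega>"

lemma A_ess_bounded: "k \<le> n \<Longrightarrow> ess_bounded M (A \<theta> g k)"
  unfolding A_def[abs_def] by (intro ess_bounded_diff ess_bounded_scaleR S_ess_bounded W_ess_bounded)

lemma A_self_adjoint: "k \<le> n \<Longrightarrow> AE \<omega> in M. self_adjoint (A \<theta> g k \<omega>)"
proof -
  assume k: "k \<le> n"
  show ?thesis
    using S_self_adjoint[OF k] W_self_adjoint[OF k] unfolding A_def
    by eventually_elim (intro self_adjoint_diff self_adjoint_scaleR)
qed

lemma A_measurable: "k \<le> n \<Longrightarrow> A \<theta> g k \<in> borel_measurable (F k)"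
  unfolding A_def[abs_def]
  by (intro borel_measurable_diff borel_measurable_scaleR borel_measurable_const S_measurable W_measurable)

text \<open>Passing from \<open>k\<close> to \<open>Suc k\<close> adds \<open>\<theta> X\<close> and
  subtracts \<open>g\<close> times its second moment given \<open>F k\<close>, which is the exponent
  of \<open>trace_exp_step\<close>. The start \<open>tr exp 0\<close> is the dimension, and
  \<open>excess_expectation\<close> later removes it by subtracting the tangent.\<close>

lemma trace_exp_le_card:
  assumes exp_le: "\<And>x. \<bar>x\<bar> \<le> U \<Longrightarrow> exp (\<theta> * x) \<le> 1 + \<theta> * x + g * x\<^sup>2" and k: "k \<le> n"
  shows "(\<integral>\<omega>. Re (trace (mexp (A \<theta> g k \<omega>))) \<partial>M) \<le> real CARD('d)"
  using k
proof (induction k)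
  case 0
  have "mexp (0 :: complex^'d^'d) = mat 1"
  proof -
    have u: "unitary_mat (mat 1 :: complex^'d^'d)"
    proof -
      have "adjoint_mat (mat 1) = (mat 1 :: complex^'d^'d)" by (rule mat_eqI) (simp add: mat_def)
      then show ?thesis by (simp add: unitary_mat_def)
    qed
    have "0 = spec (mat 1 :: complex^'d^'d) (\<lambda>_. 0)" by (rule mat_eqI) (simp add: spec_nth)
    then show ?thesis using mexp_spec[OF u, of "\<lambda>_. 0"] spec_one[OF u] by simp
  qed
  then show ?case by (simp add: A_def S_def W_def trace_I prob_space)
next
  case (Suc k)
  then have i: "Suc k \<in> {1..n}" by auto
  have eq: "A \<theta> g (Suc k) \<omega> = A \<theta> g k \<omega> - g *\<^sub>R cond_exp_mat M (F k) (\<lambda>\<omega>. X (Suc k) \<omega> ** X (Suc k) \<omega>) \<omega>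
      + \<theta> *\<^sub>R X (Suc k) \<omega>" for \<omega>
    by (simp add: A_def S_def W_def algebra_simps)
  have "(\<integral>\<omega>. Re (trace (mexp (A \<theta> g (Suc k) \<omega>))) \<partial>M) \<le> (\<integral>\<omega>. Re (trace (mexp (A \<theta> g k \<omega>))) \<partial>M)"
    unfolding eq
    by (rule trace_exp_step[OF subalg A_measurable A_ess_bounded A_self_adjoint
        X_ess_bounded[OF i] hermitian[OF i] op_norm_le[OF i] _ exp_le])
       (use Suc.prems mart[OF i] in simp_all)
  also have "\<dots> \<le> real CARD('d)" using Suc by simp
  finally show ?case .
qed

lemma integral_trace_S:
  "(\<integral>\<omega>. Re (trace (T ** S n \<omega>)) \<partial>M) = 0"
proof -
  have X0: "(\<integral>\<omega>. Re (trace (T ** X i \<omega>)) \<partial>M) = 0" if i: "i \<in> {1..n}" for i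
  proof -
    have "(\<integral>\<omega>. Re (trace (T ** X i \<omega>)) \<partial>M) = (\<integral>\<omega>. Re (trace (T ** cond_exp_mat M (F (i - 1)) (X i) \<omega>)) \<partial>M)"
      by (rule integral_trace_cond_exp_mat[OF subalg_pred[OF i] borel_measurable_const ess_bounded_const X_ess_bounded[OF i], symmetric])
    also have "\<dots> = (\<integral>\<omega>. 0 \<partial>M)"
    proof (rule integral_cong_AE)
      show "(\<lambda>\<omega>. Re (trace (T ** cond_exp_mat M (F (i - 1)) (X i) \<omega>))) \<in> borel_measurable M"
        by (intro borel_measurable_integrable ess_bounded_integrable_trace ess_bounded_mult ess_bounded_const
            cond_exp_mat_ess_bounded subalg_pred i X_ess_bounded)
      show "AE \<omega> in M. Re (trace (T ** cond_exp_mat M (F (i - 1)) (X i) \<omega>)) = 0"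
        using mart[OF i] by eventually_elim (simp add: trace_def)
    qed simp
    finally show ?thesis by simp
  qed
  have "(\<integral>\<omega>. Re (trace (T ** S n \<omega>)) \<partial>M) = (\<integral>\<omega>. (\<Sum>i=1..n. Re (trace (T ** X i \<omega>))) \<partial>M)"
    by (simp add: S_def mat_mult_sum_right trace_sum)
  also have "\<dots> = (\<Sum>i=1..n. (\<integral>\<omega>. Re (trace (T ** X i \<omega>)) \<partial>M))"
    by (rule Bochner_Integration.integral_sum)
       (intro ess_bounded_integrable_trace ess_bounded_mult ess_bounded_const X_ess_bounded)
  finally show ?thesis using X0 by simp
qed

lemma trace_integral_W: "Re (trace (T ** (\<integral>\<omega>. W n \<omega> \<partial>M))) = (\<integral>\<omega>. Re (trace (T ** W n \<omega>)) \<partial>M)"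
  by (rule integral_bounded_linear[OF bounded_linear_Re_trace_mult ess_bounded_integrable[OF W_ess_bounded], symmetric])
     simp

lemma trace_integral_W_eq: "Re (trace (T ** (\<integral>\<omega>. W n \<omega> \<partial>M))) = (\<Sum>i=1..n. (\<integral>\<omega>. Re (trace (T ** (X i \<omega> ** X i \<omega>))) \<partial>M))"
proof -
  have "(\<integral>\<omega>. Re (trace (T ** W n \<omega>)) \<partial>M) =
      (\<integral>\<omega>. (\<Sum>i=1..n. Re (trace (T ** cond_exp_mat M (F (i - 1)) (\<lambda>\<omega>'. X i \<omega>' ** X i \<omega>') \<omega>))) \<partial>M)"
    by (simp add: W_def mat_mult_sum_right trace_sum)
  also have "\<dots> = (\<Sum>i=1..n. (\<integral>\<omega>. Re (trace (T ** cond_exp_mat M (F (i - 1)) (\<lambda>\<omega>'. X i \<omega>' ** X i \<omega>') \<omega>)) \<partial>M))"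
    by (rule Bochner_Integration.integral_sum)
       (intro ess_bounded_integrable_trace ess_bounded_mult ess_bounded_const V_ess_bounded)
  also have "\<dots> = (\<Sum>i=1..n. (\<integral>\<omega>. Re (trace (T ** (X i \<omega> ** X i \<omega>))) \<partial>M))"
    by (intro sum.cong refl integral_trace_cond_exp_mat subalg_pred borel_measurable_const ess_bounded_const XX_ess_bounded)
  finally show ?thesis by (simp only: trace_integral_W)
qed

lemma integral_W_self_adjoint: "self_adjoint (\<integral>\<omega>. W n \<omega> \<partial>M)"
proof -
  have int: "integrable M (W n)" by (rule ess_bounded_integrable[OF W_ess_bounded]) simp
  have "adjoint_mat (\<integral>\<omega>. W n \<omega> \<partial>M) = (\<integral>\<omega>. adjoint_mat (W n \<omega>) \<partial>M)"
    by (rule integral_bounded_linear[OF bounded_linear_adjoint_mat int, symmetric])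
  also have "\<dots> = (\<integral>\<omega>. W n \<omega> \<partial>M)"
  proof (rule integral_cong_AE)
    show "(\<lambda>\<omega>. adjoint_mat (W n \<omega>)) \<in> borel_measurable M"
      by (intro borel_measurable_integrable integrable_bounded_linear[OF bounded_linear_adjoint_mat int])
    show "W n \<in> borel_measurable M" using int by (rule borel_measurable_integrable)
    show "AE \<omega> in M. adjoint_mat (W n \<omega>) = W n \<omega>"
      using W_self_adjoint[of n] by (simp add: self_adjoint_def)
  qed
  finally show ?thesis by (simp add: self_adjoint_def)
qed

text \<open>The eigenvalue is the trace of \<open>E W\<close> against the projection onto its
  eigenvector. Inside the expectation each conditional second moment may be replaced by
  \<open>X i ** X i\<close>, whose trace against a projection is visibly nonnegative.\<close>

lemma integral_W_eigenvalue_nonneg: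
  assumes V: "unitary_mat V" and EW: "(\<integral>\<omega>. W n \<omega> \<partial>M) = spec V w"
  shows "0 \<le> w k"
proof -
  define e :: "'d \<Rightarrow> real" where "e j = (if j = k then 1 else 0)" for j
  have "w k = (\<Sum>j\<in>UNIV. e j * w j)"
    by (simp add: e_def if_distrib[of "\<lambda>x. x * _"] cong: if_cong)
  also have "\<dots> = Re (trace (spec V e ** (\<integral>\<omega>. W n \<omega> \<partial>M)))"
    by (simp add: EW spec_mult[OF V] trace_spec[OF V])
  also have "\<dots> = (\<Sum>i=1..n. (\<integral>\<omega>. Re (trace (spec V e ** (X i \<omega> ** X i \<omega>))) \<partial>M))"
    by (rule trace_integral_W_eq)
  also have "\<dots> \<ge> 0"
  proof (intro sum_nonneg integral_nonneg_AE)
    fix i assume i: "i \<in> {1..n}"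
    show "AE \<omega> in M. 0 \<le> Re (trace (spec V e ** (X i \<omega> ** X i \<omega>)))"
      using hermitian[OF i]
    proof eventually_elim
      case (elim \<omega>)
      then obtain R x where R: "unitary_mat R" and x: "X i \<omega> = spec R x"
        using spectral_theorem by metis
      have "X i \<omega> ** X i \<omega> = spec R (\<lambda>i. (x i)\<^sup>2)"
        by (simp add: x spec_mult[OF R] power2_eq_square)
      then have "Re (trace (spec V e ** (X i \<omega> ** X i \<omega>))) = (\<Sum>a\<in>UNIV. \<Sum>b\<in>UNIV. e a * (x b)\<^sup>2 * overlap V R a b)"
        by (simp only: trace_spec_spec Re_complex_of_real)
      also have "\<dots> \<ge> 0"
        by (intro sum_nonneg mult_nonneg_nonneg) (auto simp: e_def)
      finally show ?case .
    qed
  qed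
  finally show ?thesis .
qed

text \<open>The summand for the eigenvector \<open>k\<close> of \<open>E W\<close> measures the excess of \<open>e\<^sup>x\<close> over its tangent
  \<open>1 + x\<close> at \<open>0\<close> if \<open>g w k \<le> 1\<close>, and over \<open>0\<close> otherwise.\<close>

definition excess :: "complex^'d^'d \<Rightarrow> ('d \<Rightarrow> real) \<Rightarrow> real \<Rightarrow> real \<Rightarrow> 'w \<Rightarrow> real" where
  "excess V w \<theta> g \<omega> = (let r = (\<lambda>k. if g * w k \<le> 1 then 1 else 0) in
     Re (trace (mexp (A \<theta> g n \<omega>))) - (\<Sum>k\<in>UNIV. r k) - Re (trace (spec V r ** A \<theta> g n \<omega>)))"

lemma excess_integrable: "integrable M (excess V w \<theta> g)"
proof -
  have "integrable M (\<lambda>\<omega>. Re (trace (mexp (A \<theta> g n \<omega>))))"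
    by (intro ess_bounded_integrable_trace ess_bounded_mexp A_ess_bounded A_self_adjoint order_refl)
  moreover have "integrable M (\<lambda>\<omega>. Re (trace (T ** A \<theta> g n \<omega>)))" for T
    by (intro ess_bounded_integrable_trace ess_bounded_mult ess_bounded_const A_ess_bounded order_refl)
  ultimately show ?thesis unfolding excess_def[abs_def] Let_def by simp
qed

text \<open>The martingale part of the tangent has mean 0, so the expectation is at most the sum of
  \<open>1 - r k + g * r k * w k\<close>. The choice of \<open>r k\<close> minimises this over
  \<open>[0, 1]\<close>, and the minimum is \<open>min 1 (g * w k)\<close>.\<close>

lemma excess_expectation:
  assumes exp_le: "\<And>x. \<bar>x\<bar> \<le> U \<Longrightarrow> exp (\<theta> * x) \<le> 1 + \<theta> * x + g * x\<^sup>2"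
    and V: "unitary_mat V" and EW: "(\<integral>\<omega>. W n \<omega> \<partial>M) = spec V w"
  shows "(\<integral>\<omega>. excess V w \<theta> g \<omega> \<partial>M) \<le> (\<Sum>k\<in>UNIV. min 1 (g * w k))"
proof -
  define r where "r k = (if g * w k \<le> 1 then 1 else 0 :: real)" for k
  have intA: "integrable M (\<lambda>\<omega>. Re (trace (mexp (A \<theta> g n \<omega>))))"
    by (intro ess_bounded_integrable_trace ess_bounded_mexp A_ess_bounded A_self_adjoint order_refl)
  have intS: "integrable M (\<lambda>\<omega>. Re (trace (spec V r ** S n \<omega>)))"
    and intW: "integrable M (\<lambda>\<omega>. Re (trace (spec V r ** W n \<omega>)))"
    by (intro ess_bounded_integrable_trace ess_bounded_mult ess_bounded_const S_ess_bounded W_ess_bounded order_refl)+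
  have "excess V w \<theta> g \<omega> = Re (trace (mexp (A \<theta> g n \<omega>))) - (\<Sum>k\<in>UNIV. r k)
      - (\<theta> * Re (trace (spec V r ** S n \<omega>)) - g * Re (trace (spec V r ** W n \<omega>)))" for \<omega>
    unfolding excess_def Let_def r_def[abs_def, symmetric] A_def
    by (simp add: mat_mult_diff_right mat_mult_scaleR_right trace_sub trace_scaleR)
  then have "(\<integral>\<omega>. excess V w \<theta> g \<omega> \<partial>M) = (\<integral>\<omega>. Re (trace (mexp (A \<theta> g n \<omega>))) \<partial>M) - (\<Sum>k\<in>UNIV. r k)
      - (\<theta> * (\<integral>\<omega>. Re (trace (spec V r ** S n \<omega>)) \<partial>M) - g * (\<integral>\<omega>. Re (trace (spec V r ** W n \<omega>)) \<partial>M))"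
    using intA intS intW by (simp add: prob_space)
  also have "\<dots> = (\<integral>\<omega>. Re (trace (mexp (A \<theta> g n \<omega>))) \<partial>M) - (\<Sum>k\<in>UNIV. r k) + g * (\<Sum>k\<in>UNIV. r k * w k)"
    by (simp add: integral_trace_S trace_integral_W[symmetric] EW spec_mult[OF V] trace_spec[OF V])
  also have "\<dots> \<le> (\<Sum>k\<in>(UNIV :: 'd set). 1) - (\<Sum>k\<in>UNIV. r k) + g * (\<Sum>k\<in>UNIV. r k * w k)"
    using trace_exp_le_card[OF exp_le, of n] by simp
  also have "\<dots> = (\<Sum>k\<in>UNIV. 1 - r k + g * (r k * w k))"
    by (simp only: sum.distrib sum_subtractf sum_distrib_left)
  also have "\<dots> = (\<Sum>k\<in>UNIV. min 1 (g * w k))"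
    by (intro sum.cong refl) (simp add: r_def)
  finally show ?thesis .
qed

lemma excess_nonneg:
  assumes V: "unitary_mat V"
  shows "AE \<omega> in M. 0 \<le> excess V w \<theta> g \<omega>"
  using A_self_adjoint[of n \<theta> g, OF order_refl]
proof eventually_elim
  case (elim \<omega>)
  then obtain R \<alpha> where R: "unitary_mat R" and eq: "A \<theta> g n \<omega> = spec R \<alpha>"
    using spectral_theorem by metis
  show ?case
    unfolding excess_def Let_def eq by (rule trace_exp_excess(1)[OF V R]) auto
qed

lemma excess_ge:
  assumes V: "unitary_mat V" and R: "unitary_mat R" and eq: "A \<theta> g n \<omega> = spec R \<alpha>"
    and b: "0 \<le> b" "b \<le> \<alpha> j"
  shows "exp b - 1 - b \<le> excess V w \<theta> g \<omega>"
  unfolding excess_def Let_def eq by (rule trace_exp_excess(2)[OF V R, where j = j]) (use b in auto)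

end

section \<open>Scalar inequalities\<close>

text \<open>Since \<open>(k + 2)! >= 2 * 3 ^ k\<close>, the Taylor remainder beyond
  \<open>1 + y\<close> is dominated by \<open>y^2 / 2\<close> times a geometric series of ratio
  \<open>\<theta> U / 3\<close>. This is where the 3 in \<open>t U / 3\<close> comes from.\<close>

lemma bernstein_exp_le:
  fixes \<theta> x U :: real
  assumes \<theta>: "0 \<le> \<theta>" and U: "\<theta> * U < 3" and x: "\<bar>x\<bar> \<le> U"
  shows "exp (\<theta> * x) \<le> 1 + \<theta> * x + \<theta>\<^sup>2 / 2 / (1 - \<theta> * U / 3) * x\<^sup>2"
proof -
  define y c where "y = \<theta> * x" and "c = \<theta> * U / 3"
  have c: "0 \<le> c" "c < 1" using assms by (auto simp: c_def)
  have y: "\<bar>y\<bar> \<le> 3 * c" using \<theta> x by (simp add: y_def c_def abs_mult mult_left_mono)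
  have fact_ge: "2 * 3 ^ k \<le> (fact (k + 2) :: real)" for k
  proof (induction k)
    case (Suc k)
    have "2 * 3 ^ Suc k \<le> 3 * (fact (k + 2) :: real)" using Suc unfolding power_Suc by linarith
    also have "\<dots> \<le> (real k + 3) * fact (k + 2)" by (intro mult_right_mono) auto
    also have "\<dots> = fact (Suc k + 2)" using fact_Suc[of "k + 2", where 'a = real] by (simp add: algebra_simps)
    finally show ?case .
  qed (simp add: numeral_2_eq_2)
  have "(\<lambda>k. y ^ k /\<^sub>R fact k) sums exp y" by (rule exp_converges)
  then have "(\<lambda>k. y ^ (k + 2) /\<^sub>R fact (k + 2)) sums (exp y - (\<Sum>k<2. y ^ k /\<^sub>R fact k))"
    by (rule sums_split_initial_segment)
  moreover have "(\<Sum>k<2. y ^ k /\<^sub>R fact k) = 1 + y" by (simp add: numeral_2_eq_2)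
  ultimately have 1: "(\<lambda>k. y ^ (k + 2) /\<^sub>R fact (k + 2)) sums (exp y - (1 + y))" by simp
  have 2: "(\<lambda>k. y\<^sup>2 / 2 * c ^ k) sums (y\<^sup>2 / 2 * (1 / (1 - c)))"
    by (intro sums_mult geometric_sums) (use c in simp)
  have "exp y - (1 + y) \<le> y\<^sup>2 / 2 * (1 / (1 - c))"
  proof (rule sums_le[OF _ 1 2])
    fix k
    have "y ^ (k + 2) /\<^sub>R fact (k + 2) = y ^ (k + 2) / fact (k + 2)"
      by (simp only: real_scaleR_def divide_inverse mult.commute)
    also have "\<dots> \<le> \<bar>y\<bar> ^ (k + 2) / fact (k + 2)"
      by (intro divide_right_mono) (metis abs_ge_self power_abs, simp)
    also have "\<dots> \<le> \<bar>y\<bar> ^ (k + 2) / (2 * 3 ^ k)"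
      by (intro divide_left_mono fact_ge) auto
    also have "\<dots> = y\<^sup>2 / 2 * (\<bar>y\<bar> / 3) ^ k"
      by (simp add: power_add power_divide power2_eq_square)
    also have "\<dots> \<le> y\<^sup>2 / 2 * c ^ k"
      using y by (intro mult_left_mono power_mono) auto
    finally show "y ^ (k + 2) /\<^sub>R fact (k + 2) \<le> y\<^sup>2 / 2 * c ^ k" .
  qed
  then show ?thesis by (simp add: y_def c_def power_mult_distrib)
qed

text \<open>The quadratic Taylor polynomial gives \<open>exp (1 / 2) >= 13 / 8\<close>, and the
  tangent of \<open>exp\<close> at 1/2 extends this to larger \<open>b\<close>. The value 16 is
  chosen so that three times it stays below 50.\<close>

lemma exp_excess_ge:
  fixes b :: real
  assumes "1 / 2 \<le> b"
  shows "exp b \<le> 16 * (exp b - 1 - b)"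
proof -
  have "13 / 8 \<le> exp (1 / 2 :: real)"
    using exp_lower_Taylor_quadratic[of "1 / 2"] by (simp add: power2_eq_square)
  moreover have "1 + (b - 1 / 2) \<le> exp (b - 1 / 2)" by (rule exp_ge_add_one_self)
  ultimately have "13 / 8 * (1 + (b - 1 / 2)) \<le> exp (1 / 2) * exp (b - 1 / 2)"
    using assms by (intro mult_mono) auto
  also have "\<dots> = exp b" by (simp add: exp_add[symmetric])
  finally show ?thesis using assms by simp
qed


section \<open>The two signed martingales and the tail bound\<close>

lemma (in prob_space) bounded_matrix_martingale_gen_sigma:
  fixes X :: "nat \<Rightarrow> 'a \<Rightarrow> complex^'d^'d" and \<epsilon> :: real
  assumes sa: "\<forall>i\<in>{1..n}. \<forall>\<omega>\<in>space M. self_adjoint (X i \<omega>)"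
    and mart: "martingale_diff_seq M n X"
    and bd: "\<forall>i\<in>{1..n}. AE \<omega> in M. op_norm (X i \<omega>) \<le> U"
    and \<epsilon>: "\<epsilon> \<in> {1, -1}"
  shows "bounded_matrix_martingale M (gen_sigma M X) (\<lambda>i \<omega>. \<epsilon> *\<^sub>R X i \<omega>) n U"
proof
  have X_meas: "X i \<in> borel_measurable M" if "i \<in> {1..n}" for i
    using mart that unfolding martingale_diff_seq_def by (auto intro: borel_measurable_integrable)
  have space: "space (gen_sigma M X k) = space M" for k
    by (simp add: gen_sigma_def space_measure_of_conv)
  have sets: "sets (gen_sigma M X k) =
      sigma_sets (space M) (\<Union>i\<in>{1..k}. {X i -` B \<inter> space M | B. B \<in> sets borel})" for k
    unfolding gen_sigma_def by (rule sets_measure_of) auto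
  show sub: "subalgebra M (gen_sigma M X k)" if "k \<le> n" for k
    unfolding subalgebra_def space sets
    using that X_meas by (auto intro!: sets.sigma_sets_subset measurable_sets)
  show "subalgebra (gen_sigma M X (Suc k)) (gen_sigma M X k)" if "k < n" for k
    unfolding subalgebra_def space sets
    by (intro conjI refl sigma_sets_mono' UN_mono) auto
  fix i assume i: "i \<in> {1..n}"
  have "X i \<in> borel_measurable (gen_sigma M X i)"
  proof (rule measurableI)
    fix B :: "(complex^'d^'d) set" assume "B \<in> sets borel"
    then show "X i -` B \<inter> space (gen_sigma M X i) \<in> sets (gen_sigma M X i)"
      unfolding space sets using i by (intro sigma_sets.Basic UN_I[of i]) auto
  qed simp
  then show "(\<lambda>\<omega>. \<epsilon> *\<^sub>R X i \<omega>) \<in> borel_measurable (gen_sigma M X i)"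
    by (rule borel_measurable_scaleR[OF borel_measurable_const])
  show "AE \<omega> in M. self_adjoint (\<epsilon> *\<^sub>R X i \<omega>)"
    using sa i by (intro AE_I2) (auto intro: self_adjoint_scaleR)
  have "op_norm (\<epsilon> *\<^sub>R X i \<omega>) = op_norm (X i \<omega>)" for \<omega>
  proof -
    have "(*v) (\<epsilon> *\<^sub>R X i \<omega>) = (\<lambda>v. \<epsilon> *\<^sub>R (X i \<omega> *v v))"
      by (simp add: fun_eq_iff vec_eq_iff matrix_vector_mult_def scaleR_sum_right)
    then show ?thesis
      unfolding op_norm_def using \<epsilon> by (simp add: onorm_scaleR[OF bounded_linear_mat_vec]) auto
  qed
  then show "AE \<omega> in M. op_norm (\<epsilon> *\<^sub>R X i \<omega>) \<le> U"
    using bd i by simp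
  have i1: "i - 1 \<le> n" using i by auto
  interpret finite_measure_subalgebra M "gen_sigma M X (i - 1)"
    by (rule finite_measure_subalgebraI[OF sub[OF i1]])
  have int: "integrable M (X i)" using mart i unfolding martingale_diff_seq_def by blast
  have bl: "bounded_linear (\<lambda>A :: complex^'d^'d. A $ k $ l)" for k l
    by (rule bounded_linear_compose[OF bounded_linear_vec_nth bounded_linear_vec_nth])
  have re: "AE \<omega> in M. real_cond_exp M (gen_sigma M X (i - 1)) (\<lambda>\<omega>. \<epsilon> * Re (X i \<omega> $ k $ l)) \<omega> =
      \<epsilon> * real_cond_exp M (gen_sigma M X (i - 1)) (\<lambda>\<omega>. Re (X i \<omega> $ k $ l)) \<omega>" for k l
    by (rule real_cond_exp_cmult)
       (rule integrable_bounded_linear[OF bounded_linear_compose[OF bounded_linear_Re bl] int])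
  have im: "AE \<omega> in M. real_cond_exp M (gen_sigma M X (i - 1)) (\<lambda>\<omega>. \<epsilon> * Im (X i \<omega> $ k $ l)) \<omega> =
      \<epsilon> * real_cond_exp M (gen_sigma M X (i - 1)) (\<lambda>\<omega>. Im (X i \<omega> $ k $ l)) \<omega>" for k l
    by (rule real_cond_exp_cmult)
       (rule integrable_bounded_linear[OF bounded_linear_compose[OF bounded_linear_Im bl] int])
  have lin: "AE \<omega> in M. \<forall>k l. real_cond_exp M (gen_sigma M X (i - 1)) (\<lambda>\<omega>. \<epsilon> * Re (X i \<omega> $ k $ l)) \<omega> =
      \<epsilon> * real_cond_exp M (gen_sigma M X (i - 1)) (\<lambda>\<omega>. Re (X i \<omega> $ k $ l)) \<omega> \<and>
      real_cond_exp M (gen_sigma M X (i - 1)) (\<lambda>\<omega>. \<epsilon> * Im (X i \<omega> $ k $ l)) \<omega> =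
      \<epsilon> * real_cond_exp M (gen_sigma M X (i - 1)) (\<lambda>\<omega>. Im (X i \<omega> $ k $ l)) \<omega>"
    by (intro eventually_all_finite AE_conjI re im)
  have "AE \<omega> in M. cond_exp_mat M (gen_sigma M X (i - 1)) (X i) \<omega> = 0"
    using mart i unfolding martingale_diff_seq_def by blast
  with lin show "AE \<omega> in M. cond_exp_mat M (gen_sigma M X (i - 1)) (\<lambda>\<omega>. \<epsilon> *\<^sub>R X i \<omega>) \<omega> = 0"
    by eventually_elim (simp add: cond_exp_mat_def vec_eq_iff complex_eq_iff)
qed

text \<open>The decomposition returned is one behind the choice operator in \<open>mat_fun\<close>.
  In the tail bound it also supplies the eigenbasis of \<open>E W\<close>, so that the trace and the
  excess refer to the same eigenvalues.\<close>

lemma mat_fun_spectral: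
  assumes "self_adjoint (A :: complex^'n^'n)"
  obtains V l where "unitary_mat V" "A = spec V l" "mat_fun f A = spec V (\<lambda>i. f (l i))"
proof -
  have "\<exists>B V l. unitary_mat V \<and> A = V ** diag_real l ** adjoint_mat V \<and>
      B = V ** diag_real (\<lambda>i. f (l i)) ** adjoint_mat V"
    using spectral_theorem[OF assms] unfolding spec_def by metis
  from someI_ex[OF this] show thesis
    using that unfolding mat_fun_def[symmetric] spec_def by blast
qed

theorem theorem3p2:
  fixes M :: "'w measure"
    and n :: nat
    and X :: "nat \<Rightarrow> 'w \<Rightarrow> complex^'d^'d"
    and U \<sigma> t :: real
  assumes "prob_space M"
    and "\<forall>i\<in>{1..n}. \<forall>\<omega>\<in>space M. self_adjoint (X i \<omega>)"
    and "martingale_diff_seq M n X"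
    and "U > 0"
    and "\<forall>i\<in>{1..n}. AE \<omega> in M. op_norm (X i \<omega>) \<le> U"
    and "\<sigma> > 0"
    and "t \<ge> (1/6) * (U + sqrt (U\<^sup>2 + 36 * \<sigma>\<^sup>2))"
  shows "\<P>(\<omega> in M. op_norm (\<Sum>i=1..n. X i \<omega>) > t \<and> lambda_max (quad_var M X n \<omega>) \<le> \<sigma>\<^sup>2)
    \<le> 50 * Re (trace (mat_fun p_trunc
            ((- (t / U)) *\<^sub>R ((1 / \<sigma>\<^sup>2) *\<^sub>R (\<integral>\<omega>. quad_var M X n \<omega> \<partial>M)))))
        * exp (- (t\<^sup>2 / 2) / (\<sigma>\<^sup>2 + t * U / 3))"
proof -
  interpret prob_space M by fact
  note mart = bounded_matrix_martingale_gen_sigma[OF assms(2,3,5)]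
  \<comment> \<open>Two instances over the filtration generated by \<open>X\<close>, one for each
    tail of the operator norm. Signs cancel in the squares, so both have the quadratic variation
    \<open>quad_var M X n\<close>.\<close>
  interpret P: bounded_matrix_martingale M "gen_sigma M X" "\<lambda>i \<omega>. 1 *\<^sub>R X i \<omega>" n U
    by (rule mart) simp
  interpret N: bounded_matrix_martingale M "gen_sigma M X" "\<lambda>i \<omega>. (-1) *\<^sub>R X i \<omega>" n U
    by (rule mart) simp
  have neg: "(- A) ** (- B) = A ** B" for A B :: "complex^'d^'d"
    by (rule mat_eqI) (simp add: mat_mult_nth)
  have W: "P.W n = quad_var M X n" "N.W n = quad_var M X n"
    by (rule ext, unfold P.W_def quad_var_def, simp)
       (rule ext, unfold N.W_def quad_var_def, simp add: neg)
  have S: "P.S n \<omega> = (\<Sum>i=1..n. X i \<omega>)" "N.S n \<omega> = - (\<Sum>i=1..n. X i \<omega>)" for \<omega>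
    by (unfold P.S_def N.S_def) (simp_all add: sum_negf)
  note pos = \<open>U > 0\<close> \<open>\<sigma> > 0\<close>
  \<comment> \<open>Completing the square: \<open>t^2 - t U / 3 = (t - U / 6)^2 - U^2 / 36\<close>,
    so the hypothesis on \<open>t\<close> is exactly what makes \<open>t2\<close>, and hence
    \<open>b \<ge> 1 / 2\<close>, available.\<close>
  have tU: "\<bar>t - U / 6\<bar> \<ge> sqrt (U\<^sup>2 / 36 + \<sigma>\<^sup>2)"
  proof -
    have "sqrt (U\<^sup>2 + 36 * \<sigma>\<^sup>2) = sqrt (36 * (U\<^sup>2 / 36 + \<sigma>\<^sup>2))" by (simp add: algebra_simps)
    also have "\<dots> = 6 * sqrt (U\<^sup>2 / 36 + \<sigma>\<^sup>2)" by (simp only: real_sqrt_mult) simp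
    finally show ?thesis using assms(7) by simp
  qed
  have t: "t > 0"
    using assms(7) pos by (smt (verit) divide_pos_pos real_sqrt_ge_zero zero_le_power2 mult_pos_pos)
  have t2: "t\<^sup>2 \<ge> \<sigma>\<^sup>2 + t * U / 3"
  proof -
    have "(sqrt (U\<^sup>2 / 36 + \<sigma>\<^sup>2))\<^sup>2 \<le> \<bar>t - U / 6\<bar>\<^sup>2"
      using tU by (intro power_mono) auto
    then show ?thesis by (simp add: power2_eq_square algebra_simps)
  qed
  define D where "D = \<sigma>\<^sup>2 + t * U / 3"
  \<comment> \<open>With this \<open>\<theta>\<close> one has
    \<open>1 - \<theta> U / 3 = \<sigma>\<^sup>2 / D\<close>, so \<open>g\<close> is the coefficient
    of \<open>bernstein_exp_le\<close>. Moreover \<open>g \<sigma>\<^sup>2\<close> is half of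
    \<open>\<theta> t\<close>, and the remaining half is the exponent \<open>b\<close>.\<close>
  define \<theta> where "\<theta> = t / D"
  define g where "g = t\<^sup>2 / (2 * D * \<sigma>\<^sup>2)"
  define b where "b = t\<^sup>2 / 2 / D"
  have D: "D > 0" using pos t by (simp add: D_def add_pos_pos)
  have \<theta>: "\<theta> > 0" and g: "g > 0" using t D pos by (simp_all add: \<theta>_def g_def)
  have exp_le: "exp (\<theta> * x) \<le> 1 + \<theta> * x + g * x\<^sup>2" if "\<bar>x\<bar> \<le> U" for x
  proof -
    have r: "1 - \<theta> * U / 3 = \<sigma>\<^sup>2 / D" using D by (simp add: \<theta>_def D_def field_simps)
    moreover have "\<sigma>\<^sup>2 / D > 0" using D pos by simp
    ultimately have "\<theta> * U < 3" by linarith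
    moreover have "g = \<theta>\<^sup>2 / 2 / (1 - \<theta> * U / 3)"
      unfolding r using D pos by (simp add: g_def \<theta>_def power2_eq_square field_simps)
    ultimately show ?thesis using bernstein_exp_le[of \<theta> U x] \<theta> that by simp
  qed
  have b_eq: "\<theta> * t - g * \<sigma>\<^sup>2 = b"
    using D pos by (simp add: \<theta>_def g_def b_def power2_eq_square field_simps)
  have b: "b \<ge> 1 / 2" using t2 D by (simp add: b_def D_def field_simps)

  define EW where "EW = (\<integral>\<omega>. quad_var M X n \<omega> \<partial>M)"
  have "self_adjoint ((- (t / U)) *\<^sub>R ((1 / \<sigma>\<^sup>2) *\<^sub>R EW))"
    using P.integral_W_self_adjoint unfolding EW_def W by (intro self_adjoint_scaleR)
  then obtain V l where V: "unitary_mat V" and EW_l: "(- (t / U)) *\<^sub>R ((1 / \<sigma>\<^sup>2) *\<^sub>R EW) = spec V l"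
    and mf: "mat_fun p_trunc ((- (t / U)) *\<^sub>R ((1 / \<sigma>\<^sup>2) *\<^sub>R EW)) = spec V (\<lambda>i. p_trunc (l i))"
    by (rule mat_fun_spectral)
  \<comment> \<open>The argument of \<open>p_trunc\<close> is \<open>- a\<close> times
    \<open>E W\<close>, so its eigenvalues are \<open>- a * w k\<close> and the trace becomes the
    sum of \<open>min (a * w k) 1\<close>.\<close>
  define a where "a = t / (U * \<sigma>\<^sup>2)"
  have a: "a > 0" using t pos by (simp add: a_def)
  define w where "w k = - (l k) / a" for k
  have EW: "EW = spec V w"
  proof -
    have "spec V w = (- 1 / a) *\<^sub>R spec V l"
      by (simp add: spec_scaleR w_def[abs_def])
    also have "spec V l = (- a) *\<^sub>R EW"
      using pos by (simp add: EW_l[symmetric] a_def)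
    finally show ?thesis using a by simp
  qed
  have EWP: "(\<integral>\<omega>. P.W n \<omega> \<partial>M) = spec V w" and EWN: "(\<integral>\<omega>. N.W n \<omega> \<partial>M) = spec V w"
    using EW by (simp_all only: W EW_def)
  have w: "w k \<ge> 0" for k by (rule P.integral_W_eigenvalue_nonneg[OF V EWP])
  have tr: "Re (trace (mat_fun p_trunc ((- (t / U)) *\<^sub>R ((1 / \<sigma>\<^sup>2) *\<^sub>R EW)))) = (\<Sum>k\<in>UNIV. min (a * w k) 1)"
    unfolding mf trace_spec[OF V] Re_complex_of_real using a by (simp add: p_trunc_def w_def)

  \<comment> \<open>Which sign produces the large eigenvalue depends on the outcome. Both excesses
    are almost surely nonnegative, so their sum is at least \<open>c\<close> in either case.\<close>
  define Z where "Z \<omega> = P.excess V w \<theta> g \<omega> + N.excess V w \<theta> g \<omega>" for \<omega>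
  have Z_int: "integrable M Z"
    unfolding Z_def[abs_def] by (intro Bochner_Integration.integrable_add P.excess_integrable N.excess_integrable)
  have Z_nonneg: "AE \<omega> in M. 0 \<le> Z \<omega>"
    using P.excess_nonneg[OF V, of w \<theta> g] N.excess_nonneg[OF V, of w \<theta> g]
    by eventually_elim (simp add: Z_def)
  have EZ: "(\<integral>\<omega>. Z \<omega> \<partial>M) \<le> 2 * (\<Sum>k\<in>UNIV. min 1 (g * w k))"
    unfolding Z_def Bochner_Integration.integral_add[OF P.excess_integrable N.excess_integrable]
    using P.excess_expectation[OF exp_le V EWP] N.excess_expectation[OF exp_le V EWN] by linarith
  define c where "c = exp b - 1 - b"
  have c: "exp b \<le> 16 * c" unfolding c_def by (rule exp_excess_ge[OF b])
  then have c_pos: "c > 0" using exp_gt_zero[of b] by linarith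
  let ?E = "{\<omega> \<in> space M. op_norm (\<Sum>i=1..n. X i \<omega>) > t \<and> lambda_max (quad_var M X n \<omega>) \<le> \<sigma>\<^sup>2}"
  have "AE \<omega> in M. \<omega> \<in> ?E \<longrightarrow> c \<le> Z \<omega>"
    using P.S_self_adjoint[of n, OF order_refl] P.W_self_adjoint[of n, OF order_refl]
      P.A_self_adjoint[of n \<theta> g, OF order_refl] N.A_self_adjoint[of n \<theta> g, OF order_refl]
      P.excess_nonneg[OF V, of w \<theta> g] N.excess_nonneg[OF V, of w \<theta> g]
  proof eventually_elim
    case (elim \<omega>)
    show ?case
    proof
      assume \<omega>: "\<omega> \<in> ?E"
      have "op_norm (P.S n \<omega>) > t" "lambda_max (P.W n \<omega>) \<le> \<sigma>\<^sup>2"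
        using \<omega> unfolding S W by auto
      from large_eigenvalue[OF elim(1,2) less_imp_le[OF t] this less_imp_le[OF \<theta>] less_imp_le[OF g]]
      obtain \<epsilon> where \<epsilon>: "\<epsilon> \<in> {1, -1 :: real}"
        and large: "\<forall>R \<alpha>. unitary_mat R \<longrightarrow> \<theta> *\<^sub>R (\<epsilon> *\<^sub>R P.S n \<omega>) - g *\<^sub>R P.W n \<omega> = spec R \<alpha> \<longrightarrow>
          (\<exists>j. b \<le> \<alpha> j)"
        unfolding b_eq by (rule bexE)
      show "c \<le> Z \<omega>"
      proof (cases "\<epsilon> = 1")
        case True
        obtain R \<alpha> where R: "unitary_mat R" and eq: "P.A \<theta> g n \<omega> = spec R \<alpha>"
          using spectral_theorem[OF elim(3)] .
        have "\<theta> *\<^sub>R (\<epsilon> *\<^sub>R P.S n \<omega>) - g *\<^sub>R P.W n \<omega> = P.A \<theta> g n \<omega>"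
          unfolding P.A_def S W True by simp
        then obtain j where "b \<le> \<alpha> j"
          using large[rule_format, OF R, of \<alpha>] eq by metis
        then have "c \<le> P.excess V w \<theta> g \<omega>"
          unfolding c_def using b by (intro P.excess_ge[OF V R eq]) auto
        then show ?thesis using elim(6) by (simp add: Z_def)
      next
        case False
        then have e: "\<epsilon> = -1" using \<epsilon> by simp
        obtain R \<alpha> where R: "unitary_mat R" and eq: "N.A \<theta> g n \<omega> = spec R \<alpha>"
          using spectral_theorem[OF elim(4)] .
        have "\<theta> *\<^sub>R (\<epsilon> *\<^sub>R P.S n \<omega>) - g *\<^sub>R P.W n \<omega> = N.A \<theta> g n \<omega>"
          unfolding N.A_def S W e by simp
        then obtain j where "b \<le> \<alpha> j"
          using large[rule_format, OF R, of \<alpha>] eq by metis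
        then have "c \<le> N.excess V w \<theta> g \<omega>"
          unfolding c_def using b by (intro N.excess_ge[OF V R eq]) auto
        then show ?thesis using elim(5) by (simp add: Z_def)
      qed
    qed
  qed
  moreover have meas: "{\<omega> \<in> space M. c \<le> Z \<omega>} \<in> sets M"
    using borel_measurable_integrable[OF Z_int] by measurable
  ultimately have "measure M ?E \<le> measure M {\<omega> \<in> space M. c \<le> Z \<omega>}"
    by (intro finite_measure_mono_AE) auto
  also have "\<dots> \<le> (\<integral>\<omega>. Z \<omega> \<partial>M) / c"
    by (rule integral_Markov_inequality_measure[OF Z_int sets.top Z_nonneg c_pos])
  also have "\<dots> \<le> 2 * (\<Sum>k\<in>UNIV. min 1 (g * w k)) / c"
    using EZ c_pos by (simp add: divide_right_mono)
  also have "\<dots> \<le> 2 * (3 / 2 * (\<Sum>k\<in>UNIV. min (a * w k) 1)) / c"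
  proof -
    \<comment> \<open>\<open>D\<close> contains the summand \<open>t U / 3\<close>, so
      \<open>t U \<le> 3 D\<close>. The factor 3/2 may be taken out of the minimum because it is at
      least 1.\<close>
    have "g \<le> 3 / 2 * a"
    proof -
      have "t * U \<le> 3 * D" using pos by (simp add: D_def)
      then have "t * (t * U) \<le> t * (3 * D)" using t by (intro mult_left_mono) auto
      then show ?thesis using D pos t by (simp add: g_def a_def field_simps power2_eq_square)
    qed
    then have "min 1 (g * w k) \<le> 3 / 2 * min (a * w k) 1" for k
      using mult_right_mono[OF _ w[of k], of g "3 / 2 * a"] by (auto simp: min_def)
    then have "(\<Sum>k\<in>UNIV. min 1 (g * w k)) \<le> 3 / 2 * (\<Sum>k\<in>UNIV. min (a * w k) 1)"
      unfolding sum_distrib_left by (intro sum_mono)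
    then show ?thesis using c_pos by (intro divide_right_mono mult_left_mono) auto
  qed
  also have "\<dots> = 3 * (\<Sum>k\<in>UNIV. min (a * w k) 1) * (1 / c)" by simp
  also have "\<dots> \<le> 3 * (\<Sum>k\<in>UNIV. min (a * w k) 1) * (16 * exp (- b))"
  proof (intro mult_left_mono)
    show "1 / c \<le> 16 * exp (- b)" using c c_pos by (simp add: exp_minus field_simps)
    show "0 \<le> 3 * (\<Sum>k\<in>UNIV. min (a * w k) 1)" using a w by (simp add: sum_nonneg)
  qed
  \<comment> \<open>The constant reached is \<open>3 * 16 = 48\<close>, where 3 is 2 for the signs
    times 3/2 for the comparison of \<open>g\<close> with \<open>a\<close>.\<close>
  also have "\<dots> \<le> 50 * (\<Sum>k\<in>UNIV. min (a * w k) 1) * exp (- b)"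
    using a w by (simp add: sum_nonneg mult_right_mono)
  also have "- b = - (t\<^sup>2 / 2) / (\<sigma>\<^sup>2 + t * U / 3)" by (simp add: b_def D_def)
  finally show ?thesis unfolding tr[unfolded EW_def] .
qed

end
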